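(* Let $f:\mathbb R\to\mathbb R$ be smooth. Let $v$ be a real vector field on $M^{(\infty)}$ such that $\zeta(v)=0$ and let $g=\eta_0(v)$. Then $v$ is a generalized symmetry of order one of $(M^{(\infty)},\mathcal I^{(\infty)})$ if and only if $\eta_i(v)=(e_{-1})^i(g)$ for all $i\ge0$ and $g$ satisfies $e_{\overline{-1}}e_{-1}g+f_ug=0$.
   Context: Subscripts such as $f_u$ denote partial derivatives; bars denote complex conjugation. For $k\ge 0$ let $M^{(k)}=\mathbb C^{k+2}\times\mathbb R$ with complex coordinates $z,u_0,\dots,u_k$ and real coordinate $u$. Let $M^{(\infty)}$ be the inverse limit of the projections $M^{(k+1)}\to M^{(k)}$ forgetting $u_{k+1}$; smooth functions and differential forms on $M^{(\infty)}$ are by definition pullbacks of such objects from some $M^{(k)}$. A vector field on $M^{(\infty)}$ is a (possibly infinite) formal combination of coordinate vector fields with smooth function coefficients. Put $T^0=f(u)$, $T^{i+1}=\sum_{j=0}^{i}\binom ij u_{i-j}\,T^j_u$, and $\zeta=dz$, $\eta_0=du-u_0\zeta-\bar u_0\bar\zeta$, $\omega_{i+1}=du_i+T^i\bar\zeta$, $\eta_{i+1}=\omega_{i+1}-u_{i+1}\zeta$ ($i\ge0$), $\psi=\operatorname{Im}(\zeta\wedge\omega_1)$. Let $e_{-1}=\partial_z+u_0\partial_u+\sum_{i\ge0}u_{i+1}\partial_{u_i}-\sum_{i\ge0}\overline{T^i}\,\partial_{\bar u_i}$ and $e_{\overline{-1}}=\overline{e_{-1}}$. $\mathcal I^{(0)}$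 is the differential ideal generated by $\eta_0$ and $\psi$; for $l\ge1$, $\mathcal I^{(l)}$ is the differential ideal generated by $\eta_0,\eta_1,\bar\eta_1,\dots,\eta_l,\bar\eta_l$; $\mathcal I^{(\infty)}$ is generated by all $\eta_0,\eta_i,\bar\eta_i$ ($i\ge1$) (all viewed on $M^{(\infty)}$). A real vector field $v$ on $M^{(\infty)}$ is a generalized symmetry of order $r$ of $(M^{(\infty)},\mathcal I^{(\infty)})$ if $\mathcal L_v(\mathcal I^{(l)})\subset\mathcal I^{(l+r)}$ for all $l\ge0$, where $\mathcal L_v$ is the Lie derivative; "order one" means $r=1$.
   Formalization: The right-hand side also requires that g be a smooth function on M^(0) (of z, u, u_0 only); without this the "if" direction fails, e.g. for f = 0 and g = u_1 + ū_1, where L_v η_0 = η_2 + η̄_2 is not in I^(1). *)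

theory Defs
  imports "HOL-Analysis.Analysis" "HOL-Library.Function_Algebras" "HOL-Library.Groups_Big_Fun"
begin

text \<open>
  All functions, vector fields and forms are complex-valued, i.e. we work in the complexified
  tangent and cotangent spaces; reality is imposed where it is needed. Sums, differences and
  \<open>0\<close> of functions, forms and vector fields are the pointwise ones of \<open>Function_Algebras\<close>.
\<close>

subsection \<open>Smooth functions on the infinite jet space\<close>

text \<open>
  The inverse limit \<open>M\<^sup>\<infinity>\<close>: a point is \<open>(z, u, w)\<close> with \<open>w i\<close> the coordinate \<open>u\<^sub>i\<close>. The product
  topology on this type is the inverse limit topology.
\<close>

type_synonym jet = "complex \<times> real \<times> (nat \<Rightarrow> complex)"

datatype rcoord = Re_z | Im_z | Real_u | Re_u nat | Im_u nat

fun shift :: "rcoord \<Rightarrow> real \<Rightarrow> jet \<Rightarrow> jet" where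
  "shift Re_z t (z, u, w) = (z + complex_of_real t, u, w)"
| "shift Im_z t (z, u, w) = (z + \<i> * complex_of_real t, u, w)"
| "shift Real_u t (z, u, w) = (z, u + t, w)"
| "shift (Re_u i) t (z, u, w) = (z, u, w(i := w i + complex_of_real t))"
| "shift (Im_u i) t (z, u, w) = (z, u, w(i := w i + \<i> * complex_of_real t))"

definition rpartial :: "rcoord \<Rightarrow> (jet \<Rightarrow> complex) \<Rightarrow> jet \<Rightarrow> complex" where
  "rpartial r F p = vector_derivative (\<lambda>t. F (shift r t p)) (at 0)"

definition pulled_back_from :: "nat \<Rightarrow> (jet \<Rightarrow> complex) \<Rightarrow> bool" where
  "pulled_back_from k F \<longleftrightarrow>
     (\<forall>z u w w'. (\<forall>i\<le>k. w i = w' i) \<longrightarrow> F (z, u, w) = F (z, u, w'))"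

text \<open>
  \<open>F\<close> is (the pullback of) a smooth function on \<open>M\<^sup>k\<close>: it depends only on \<open>z, u, u\<^sub>0, \<dots>, u\<^sub>k\<close>, and
  all its iterated partial derivatives in the real coordinates exist and are continuous.
\<close>

definition smooth_from :: "nat \<Rightarrow> (jet \<Rightarrow> complex) \<Rightarrow> bool" where
  "smooth_from k F \<longleftrightarrow> pulled_back_from k F \<and>
     (\<forall>rs. continuous_on UNIV (foldr rpartial rs F) \<and>
           (\<forall>r p. (\<lambda>t. foldr rpartial rs F (shift r t p)) differentiable (at 0)))"

definition smooth :: "(jet \<Rightarrow> complex) \<Rightarrow> bool" where
  "smooth F \<longleftrightarrow> (\<exists>k. smooth_from k F)"

definition smooth_real :: "(real \<Rightarrow> real) \<Rightarrow> bool" where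
  "smooth_real f \<longleftrightarrow> (\<forall>n x. (deriv ^^ n) f field_differentiable (at x))"


subsection \<open>Complex coordinates and vector fields\<close>

text \<open>The coordinate functions \<open>z\<close>, its conjugate, \<open>u\<close>, \<open>u\<^sub>i\<close> and the conjugate of \<open>u\<^sub>i\<close>.\<close>

datatype coord = Z | Zbar | U | Ui nat | Uibar nat

fun coord_fun :: "coord \<Rightarrow> jet \<Rightarrow> complex" where
  "coord_fun Z (z, u, w) = z"
| "coord_fun Zbar (z, u, w) = cnj z"
| "coord_fun U (z, u, w) = complex_of_real u"
| "coord_fun (Ui i) (z, u, w) = w i"
| "coord_fun (Uibar i) (z, u, w) = cnj (w i)"

fun bar :: "coord \<Rightarrow> coord" where
  "bar Z = Zbar"
| "bar Zbar = Z"
| "bar U = U"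
| "bar (Ui i) = Uibar i"
| "bar (Uibar i) = Ui i"

text \<open>Wirtinger derivatives.\<close>

fun partial :: "coord \<Rightarrow> (jet \<Rightarrow> complex) \<Rightarrow> jet \<Rightarrow> complex" where
  "partial Z F = (\<lambda>p. (rpartial Re_z F p - \<i> * rpartial Im_z F p) / 2)"
| "partial Zbar F = (\<lambda>p. (rpartial Re_z F p + \<i> * rpartial Im_z F p) / 2)"
| "partial U F = rpartial Real_u F"
| "partial (Ui i) F = (\<lambda>p. (rpartial (Re_u i) F p - \<i> * rpartial (Im_u i) F p) / 2)"
| "partial (Uibar i) F = (\<lambda>p. (rpartial (Re_u i) F p + \<i> * rpartial (Im_u i) F p) / 2)"

text \<open>
  \<open>v\<close> stands for the formal sum of the \<open>v c \<partial>\<^sub>c\<close> over all (infinitely many) coordinates \<open>c\<close>.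
\<close>

type_synonym vfield = "coord \<Rightarrow> jet \<Rightarrow> complex"

definition vector_field :: "vfield \<Rightarrow> bool" where
  "vector_field v \<longleftrightarrow> (\<forall>c. smooth (v c))"

definition cnj_vfield :: "vfield \<Rightarrow> vfield" where
  "cnj_vfield v = (\<lambda>c p. cnj (v (bar c) p))"

definition real_vector_field :: "vfield \<Rightarrow> bool" where
  "real_vector_field v \<longleftrightarrow> vector_field v \<and> cnj_vfield v = v"

text \<open>The sum has finite support when \<open>F\<close> is smooth.\<close>

definition vapply :: "vfield \<Rightarrow> (jet \<Rightarrow> complex) \<Rightarrow> jet \<Rightarrow> complex" where
  "vapply v F = (\<lambda>p. Sum_any (\<lambda>c. v c p * partial c F p))"


subsection \<open>Differential forms\<close>

text \<open>
  The form \<open>\<alpha>\<close> stands for the sum of the \<open>\<alpha> I dx\<^sub>I\<close> over finite sets \<open>I\<close> of coordinates, where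
  \<open>dx\<^sub>I\<close> is the wedge product of the \<open>dc\<close> for \<open>c \<in> I\<close>, in the order of increasing \<open>crank\<close>. The
  components of \<open>\<alpha>\<close> may have different degrees; functions are the forms supported at \<open>{}\<close>.
\<close>

type_synonym form = "coord set \<Rightarrow> jet \<Rightarrow> complex"

fun crank :: "coord \<Rightarrow> nat" where
  "crank Z = 0"
| "crank Zbar = 1"
| "crank U = 2"
| "crank (Ui i) = 2 * i + 3"
| "crank (Uibar i) = 2 * i + 4"

definition coords_upto :: "nat \<Rightarrow> coord set" where
  "coords_upto k = {Z, Zbar, U} \<union> Ui ` {..k} \<union> Uibar ` {..k}"

definition forms :: "form set" where
  "forms = {\<alpha>. \<exists>k. (\<forall>I. smooth_from k (\<alpha> I)) \<and> (\<forall>I. \<alpha> I \<noteq> 0 \<longrightarrow> I \<subseteq> coords_upto k)}"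

text \<open>For disjoint \<open>I\<close> and \<open>J\<close>: \<open>dx\<^sub>I \<and> dx\<^sub>J = wsign I J dx\<^sub>I\<^sub>\<union>\<^sub>J\<close>.\<close>

definition wsign :: "coord set \<Rightarrow> coord set \<Rightarrow> complex" where
  "wsign I J = (- 1) ^ card {(a, b). a \<in> I \<and> b \<in> J \<and> crank b < crank a}"

definition wedge :: "form \<Rightarrow> form \<Rightarrow> form" (infixr "\<and>\<^sub>w" 75) where
  "\<alpha> \<and>\<^sub>w \<beta> = (\<lambda>K p. \<Sum>I\<in>Pow K. wsign I (K - I) * \<alpha> I p * \<beta> (K - I) p)"

definition smult :: "(jet \<Rightarrow> complex) \<Rightarrow> form \<Rightarrow> form" (infixr "\<cdot>" 76) where
  "F \<cdot> \<alpha> = (\<lambda>I p. F p * \<alpha> I p)"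

definition ext_d :: "form \<Rightarrow> form" where
  "ext_d \<alpha> = (\<lambda>K p. \<Sum>c\<in>K. wsign {c} (K - {c}) * partial c (\<alpha> (K - {c})) p)"

definition contract :: "vfield \<Rightarrow> form \<Rightarrow> form" where
  "contract v \<alpha> = (\<lambda>K p. Sum_any (\<lambda>c. if c \<in> K then 0 else wsign {c} K * v c p * \<alpha> (insert c K) p))"

text \<open>Vector fields on \<open>M\<^sup>\<infinity>\<close> need not have flows; the Lie derivative is given by Cartan's formula.\<close>

definition lie :: "vfield \<Rightarrow> form \<Rightarrow> form" where
  "lie v \<alpha> = ext_d (contract v \<alpha>) + contract v (ext_d \<alpha>)"

text \<open>The value \<open>\<alpha>(v)\<close> of a one-form on a vector field.\<close>

definition pairing :: "form \<Rightarrow> vfield \<Rightarrow> jet \<Rightarrow> complex" where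
  "pairing \<alpha> v = contract v \<alpha> {}"

definition dcoord :: "coord \<Rightarrow> form" where
  "dcoord c = (\<lambda>I p. if I = {c} then 1 else 0)"

text \<open>
  Complex conjugation; the sign restores the order of the factors \<open>dc\<close> after \<open>c\<close> has been
  replaced by \<open>bar c\<close>.
\<close>

definition cnj_form :: "form \<Rightarrow> form" where
  "cnj_form \<alpha> = (\<lambda>I p. (- 1) ^ card {(a, b). a \<in> I \<and> b \<in> I \<and> crank a < crank b \<and> crank (bar b) < crank (bar a)}
                       * cnj (\<alpha> (bar ` I) p))"

definition Im_form :: "form \<Rightarrow> form" where
  "Im_form \<alpha> = (\<lambda>p. 1 / (2 * \<i>)) \<cdot> (\<alpha> - cnj_form \<alpha>)"

definition differential_ideal :: "form set \<Rightarrow> bool" where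
  "differential_ideal J \<longleftrightarrow> J \<subseteq> forms \<and> 0 \<in> J \<and>
     (\<forall>\<alpha>\<in>J. \<forall>\<beta>\<in>J. \<alpha> + \<beta> \<in> J) \<and>
     (\<forall>\<alpha>\<in>J. \<forall>\<beta>\<in>forms. \<beta> \<and>\<^sub>w \<alpha> \<in> J \<and> \<alpha> \<and>\<^sub>w \<beta> \<in> J) \<and>
     (\<forall>\<alpha>\<in>J. ext_d \<alpha> \<in> J)"


subsection \<open>The exterior differential system and its generalized symmetries\<close>

fun T :: "(real \<Rightarrow> real) \<Rightarrow> nat \<Rightarrow> jet \<Rightarrow> complex" where
  "T f 0 = (\<lambda>(z, u, w). complex_of_real (f u))"
| "T f (Suc i) = (\<lambda>p. \<Sum>j\<le>i. of_nat (i choose j) * coord_fun (Ui (i - j)) p * partial U (T f j) p)"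

abbreviation zeta :: form where
  "zeta \<equiv> dcoord Z"

text \<open>\<open>omega_Suc f i\<close> is \<open>\<omega>\<^sub>i\<^sub>+\<^sub>1\<close>.\<close>

definition omega_Suc :: "(real \<Rightarrow> real) \<Rightarrow> nat \<Rightarrow> form" where
  "omega_Suc f i = dcoord (Ui i) + T f i \<cdot> cnj_form zeta"

fun eta :: "(real \<Rightarrow> real) \<Rightarrow> nat \<Rightarrow> form" where
  "eta f 0 = dcoord U - coord_fun (Ui 0) \<cdot> zeta - coord_fun (Uibar 0) \<cdot> cnj_form zeta"
| "eta f (Suc i) = omega_Suc f i - coord_fun (Ui (Suc i)) \<cdot> zeta"

definition psi :: "(real \<Rightarrow> real) \<Rightarrow> form" where
  "psi f = Im_form (zeta \<and>\<^sub>w omega_Suc f 0)"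

text \<open>The total derivative \<open>e\<^sub>-\<^sub>1\<close>.\<close>

fun e_minus1 :: "(real \<Rightarrow> real) \<Rightarrow> vfield" where
  "e_minus1 f Z = (\<lambda>p. 1)"
| "e_minus1 f Zbar = (\<lambda>p. 0)"
| "e_minus1 f U = coord_fun (Ui 0)"
| "e_minus1 f (Ui i) = coord_fun (Ui (Suc i))"
| "e_minus1 f (Uibar i) = (\<lambda>p. - cnj (T f i p))"

definition ideal_gens :: "(real \<Rightarrow> real) \<Rightarrow> nat \<Rightarrow> form set" where
  "ideal_gens f l =
     (if l = 0 then {eta f 0, psi f}
      else {eta f 0} \<union> {eta f i | i. 1 \<le> i \<and> i \<le> l} \<union> {cnj_form (eta f i) | i. 1 \<le> i \<and> i \<le> l})"

definition eds_ideal :: "(real \<Rightarrow> real) \<Rightarrow> nat \<Rightarrow> form set" where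
  "eds_ideal f l = differential_ideal hull ideal_gens f l"

definition generalized_symmetry :: "(real \<Rightarrow> real) \<Rightarrow> nat \<Rightarrow> vfield \<Rightarrow> bool" where
  "generalized_symmetry f r v \<longleftrightarrow> real_vector_field v \<and>
     (\<forall>l. lie v ` eds_ideal f l \<subseteq> eds_ideal f (l + r))"

text \<open>
  A symmetry of order one has a generating function \<open>g = \<eta>\<^sub>0(v)\<close> that lives on \<open>M\<^sup>0\<close>, i.e.
  \<open>smooth_from 0 g\<close>: the \<open>du\<^sub>i\<close>-components, \<open>i \<ge> 1\<close>, of the one-forms in \<open>eds_ideal f 1\<close> vanish.
  The other two conditions that characterise such symmetries do not imply this. For \<open>f = 0\<close> the
  prolongation of \<open>g = u\<^sub>1 + cnj u\<^sub>1\<close> satisfies both, but is a symmetry of order two only.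
\<close>

end

theory Submission
  imports Defs
begin

text \<open>
  The one-forms of a differential ideal that contains no functions are just the combinations
  of the one-forms among its generators. As \<open>\<eta>\<^sub>i\<close> and its conjugate vanish on \<open>e\<^sub>-\<^sub>1\<close> and its conjugate, so
  does the Lie derivative of \<open>\<eta>\<^sub>i\<close> along a symmetry \<open>v\<close>. With \<open>g\<^sub>i = \<eta>\<^sub>i(v)\<close> one has
  \<open>L\<^sub>v \<eta>\<^sub>i\<^sub>+\<^sub>1 = dg\<^sub>i\<^sub>+\<^sub>1 - g\<^sub>i\<^sub>+\<^sub>2 \<zeta> + v(T\<^sup>i) d(cnj z)\<close>, and evaluation on \<open>e\<^sub>-\<^sub>1\<close> gives the
  recursion for the \<open>g\<^sub>i\<close>, evaluation on the conjugate of \<open>e\<^sub>-\<^sub>1\<close> (for \<open>i = 0\<close>) the equation for \<open>g\<close>.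
  Since the one-forms of \<open>\<I>\<^sup>1\<close> have no \<open>du\<^sub>i\<close>-components with \<open>i \<ge> 1\<close>, the function \<open>g\<close> lives on \<open>M\<^sup>0\<close>.

  Conversely, \<open>T\<^sup>i\<^sup>+\<^sup>1 = e\<^sub>-\<^sub>1(T\<^sup>i)\<close>, the field \<open>e\<^sub>-\<^sub>1\<close> commutes with its conjugate, and it commutes with \<open>v\<close> on functions
  of \<open>u, u\<^sub>0, u\<^sub>1, \<dots>\<close>. By induction the conjugate of \<open>e\<^sub>-\<^sub>1\<close> maps \<open>g\<^sub>i\<^sub>+\<^sub>1\<close> to \<open>- v(T\<^sup>i)\<close>, so \<open>L\<^sub>v \<eta>\<^sub>i\<close> is the
  contact part of \<open>dg\<^sub>i\<close>. It lies in \<open>\<I>\<^sup>i\<^sup>+\<^sup>1\<close> because \<open>g\<^sub>i\<close> is a function on \<open>M\<^sup>i\<close>.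
  For \<open>\<psi>\<close> one needs in addition that \<open>g\<^sub>1\<close> does not depend on the conjugate of \<open>u\<^sub>1\<close>.
\<close>

section \<open>Calculus on the jet space\<close>

text \<open>The ideals are hulls, so membership is used from two sides. To draw conclusions from
  \<open>\<alpha> \<in> eds_ideal f l\<close>, one exhibits a differential ideal that contains the
  generators and has the wanted property. To show that \<open>lie v\<close> maps one ideal into the
  next, one observes that the forms for which this holds make up a differential ideal, which leaves
  only the generators. This rests on the Leibniz rule for \<open>lie v\<close> and on its commuting
  with \<open>ext_d\<close>, both derived from Cartan's formula since no flow is available.

  The delicate generator is \<psi>. Its Lie derivative must lie in \<open>eds_ideal f 1\<close>, but
  \<psi> is built from \<eta>_1, whose Lie derivative is only known to lie in
  \<open>eds_ideal f 2\<close>. The rescue is the structure equation d \<eta>_1 = \<zeta> \<and>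
  \<eta>_2 modulo \<eta>_0: a term in \<eta>_2 is harmless once it is wedged with \<zeta>, and the
  conjugate term once it is wedged with the conjugate of \<zeta>. The two must not be crossed, hence
  the condition on g_1.

  The coefficients of \<open>v\<close> may have unbounded order, so a finite level is chosen anew
  for every function and form.\<close>

lemma shift_0 [simp]: "shift r 0 p = p"
  by (cases p; cases r) auto

lemma shift_shift: "shift r s (shift r t p) = shift r (s + t) p"
  by (cases p; cases r) (auto simp: algebra_simps)

lemma shift_commute: "shift r s (shift r' t p) = shift r' t (shift r s p)"
  by (cases p; cases r; cases r') (auto simp: fun_eq_iff)

text \<open>Shift amount and base point vary together; this joint continuity is what differentiation
  under the integral sign asks for in \<open>rpartial_commute\<close>.\<close>

lemma continuous_on_shift:
  assumes a: "continuous_on S a" and q: "continuous_on S q"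
  shows "continuous_on S (\<lambda>x. shift r (a x) (q x))"
proof -
  have z: "continuous_on S (\<lambda>x. fst (q x))" and u: "continuous_on S (\<lambda>x. fst (snd (q x)))"
    and w: "continuous_on S (\<lambda>x. snd (snd (q x)))"
    by (intro continuous_intros q)+
  have wj: "continuous_on S (\<lambda>x. snd (snd (q x)) j)" for j
    using continuous_on_product_then_coordinatewise[OF w] .
  have fun_upd: "continuous_on S (\<lambda>x. (snd (snd (q x)))(i := b x))" if "continuous_on S b" for i b
  proof (rule continuous_on_coordinatewise_then_product)
    show "continuous_on S (\<lambda>x. ((snd (snd (q x)))(i := b x)) j)" for j
      by (cases "j = i") (simp_all add: that wj)
  qed
  \<comment> \<open>\<open>shift\<close> matches on a literal triple; written with projections it
    can be applied to the variable point \<open>q x\<close>.\<close>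
  have shift_eq: "shift r t p = (case r of
      Re_z \<Rightarrow> (fst p + complex_of_real t, fst (snd p), snd (snd p))
    | Im_z \<Rightarrow> (fst p + \<i> * complex_of_real t, fst (snd p), snd (snd p))
    | Real_u \<Rightarrow> (fst p, fst (snd p) + t, snd (snd p))
    | Re_u i \<Rightarrow> (fst p, fst (snd p), (snd (snd p))(i := snd (snd p) i + complex_of_real t))
    | Im_u i \<Rightarrow> (fst p, fst (snd p), (snd (snd p))(i := snd (snd p) i + \<i> * complex_of_real t)))" for t p
    by (cases p; cases r) auto
  show ?thesis
    unfolding shift_eq by (cases r) (auto intro!: continuous_intros a q z u w wj fun_upd)
qed

section \<open>Smooth functions and their closure properties\<close>

lemma smooth_from_continuous: "smooth_from k F \<Longrightarrow> continuous_on S F"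
  unfolding smooth_from_def by (auto intro: continuous_on_subset dest!: spec[of _ "[]"])

lemma smooth_from_pulled_back: "smooth_from k F \<Longrightarrow> pulled_back_from k F"
  by (simp add: smooth_from_def)

lemma smooth_from_differentiable:
  "smooth_from k F \<Longrightarrow> (\<lambda>t. F (shift r t p)) differentiable (at 0)"
  unfolding smooth_from_def by (drule conjunct2, drule spec[of _ "[]"], simp only: foldr.simps id_apply)

lemma has_rpartial_0:
  assumes "(\<lambda>t. F (shift r t p)) differentiable (at 0)"
  shows "((\<lambda>t. F (shift r t p)) has_vector_derivative rpartial r F p) (at 0)"
  using assms unfolding rpartial_def by (rule vector_derivative_works[THEN iffD1])

lemma rpartial_eqI:
  assumes "((\<lambda>t. F (shift r t p)) has_vector_derivative d) (at 0)"
  shows "rpartial r F p = d"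
  unfolding rpartial_def using assms by (rule vector_derivative_at)

text \<open>Smoothness gives differentiability at 0 only, but at every base point; the flow law
  \<open>shift_shift\<close> carries it to any \<open>t\<close>.\<close>

lemma has_rpartial:
  assumes "smooth_from k F"
  shows "((\<lambda>t. F (shift r t p)) has_vector_derivative rpartial r F (shift r t p)) (at t)"
proof -
  have "((\<lambda>s. F (shift r s (shift r t p))) has_vector_derivative rpartial r F (shift r t p)) (at (t - t))"
    using has_rpartial_0[OF smooth_from_differentiable[OF assms]] by simp
  moreover have "((\<lambda>s. s - t) has_vector_derivative 1) (at t)"
    by (auto intro!: derivative_eq_intros)
  ultimately have "((\<lambda>s. F (shift r s (shift r t p))) \<circ> (\<lambda>s. s - t)
      has_vector_derivative 1 *\<^sub>R rpartial r F (shift r t p)) (at t)"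
    by (intro vector_diff_chain_at)
  then show ?thesis
    by (simp add: o_def shift_shift)
qed

lemma pulled_back_rpartial:
  assumes "pulled_back_from k F"
  shows "pulled_back_from k (rpartial r F)"
proof -
  have eq: "F (shift r t (z, u, w)) = F (shift r t (z, u, w'))" if "\<forall>i\<le>k. w i = w' i" for z u w w' t
    using assms that unfolding pulled_back_from_def by (cases r) auto
  have "rpartial r F (z, u, w) = rpartial r F (z, u, w')" if "\<forall>i\<le>k. w i = w' i" for z u w w'
    unfolding rpartial_def by (simp only: eq[OF that])
  then show ?thesis
    unfolding pulled_back_from_def by blast
qed

lemma smooth_from_rpartial:
  assumes "smooth_from k F"
  shows "smooth_from k (rpartial r F)"
proof -
  have eq: "foldr rpartial rs (rpartial r F) = foldr rpartial (rs @ [r]) F" for rs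
    by simp
  have "continuous_on UNIV (foldr rpartial (rs @ [r]) F) \<and>
      (\<forall>r' p. (\<lambda>t. foldr rpartial (rs @ [r]) F (shift r' t p)) differentiable (at 0))" for rs
    using assms unfolding smooth_from_def by blast
  then show ?thesis
    using pulled_back_rpartial[OF smooth_from_pulled_back[OF assms]]
    unfolding smooth_from_def eq by blast
qed

text \<open>A coinduction principle: instead of computing iterated derivatives, one exhibits a set
  of continuous functions, differentiable along every coordinate line, that is closed under
  \<open>rpartial\<close>.\<close>

lemma smooth_from_coinduct:
  assumes "F \<in> S" and "\<And>F. F \<in> S \<Longrightarrow> pulled_back_from k F"
    and "\<And>F. F \<in> S \<Longrightarrow> continuous_on UNIV F"
    and "\<And>F r p. F \<in> S \<Longrightarrow> (\<lambda>t. F (shift r t p)) differentiable (at 0)"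
    and "\<And>F r. F \<in> S \<Longrightarrow> rpartial r F \<in> S"
  shows "smooth_from k F"
proof -
  have S: "foldr rpartial rs F \<in> S" for rs
    by (induction rs) (simp_all add: assms(1,5))
  show ?thesis
    unfolding smooth_from_def using assms(2)[OF assms(1)] assms(3,4)[OF S] by blast
qed

lemma pulled_back_from_mono: "pulled_back_from k F \<Longrightarrow> k \<le> l \<Longrightarrow> pulled_back_from l F"
  unfolding pulled_back_from_def using order_trans by blast

lemma smooth_from_mono: "smooth_from k F \<Longrightarrow> k \<le> l \<Longrightarrow> smooth_from l F"
  unfolding smooth_from_def using pulled_back_from_mono by blast

lemma smooth_from_imp_smooth: "smooth_from k F \<Longrightarrow> smooth F"
  by (auto simp: smooth_def)

text \<open>The derivative of a product is a sum of products, so products alone are not stable under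
  \<open>rpartial\<close>. This closure is stable and serves as the invariant set in
  \<open>smooth_from_coinduct\<close>; in the end it is just the set of smooth functions of order
  \<open>k\<close>.\<close>

inductive_set smooth_algebra :: "nat \<Rightarrow> (jet \<Rightarrow> complex) set" for k where
  base: "smooth_from k F \<Longrightarrow> F \<in> smooth_algebra k"
| add: "F \<in> smooth_algebra k \<Longrightarrow> G \<in> smooth_algebra k \<Longrightarrow> (\<lambda>p. F p + G p) \<in> smooth_algebra k"
| mult: "F \<in> smooth_algebra k \<Longrightarrow> G \<in> smooth_algebra k \<Longrightarrow> (\<lambda>p. F p * G p) \<in> smooth_algebra k"
| cnj: "F \<in> smooth_algebra k \<Longrightarrow> (\<lambda>p. cnj (F p)) \<in> smooth_algebra k"

lemma pulled_back_from_compose2: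
  assumes "pulled_back_from k F" "pulled_back_from k G"
  shows "pulled_back_from k (\<lambda>p. h (F p) (G p))"
  unfolding pulled_back_from_def
proof (intro allI impI)
  fix z u and w w' :: "nat \<Rightarrow> complex" assume "\<forall>i\<le>k. w i = w' i"
  then have "F (z, u, w) = F (z, u, w')" "G (z, u, w) = G (z, u, w')"
    using assms unfolding pulled_back_from_def by blast+
  then show "h (F (z, u, w)) (G (z, u, w)) = h (F (z, u, w')) (G (z, u, w'))"
    by simp
qed

lemma smooth_algebra_props:
  assumes "F \<in> smooth_algebra k"
  shows "pulled_back_from k F" "continuous_on UNIV F" "(\<lambda>t. F (shift r t p)) differentiable (at 0)"
  using assms
proof (induction arbitrary: r p)
  case (base F)
  { case 1 show ?case using base by (rule smooth_from_pulled_back) }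
  { case 2 show ?case using base by (rule smooth_from_continuous) }
  { case 3 show ?case using base by (rule smooth_from_differentiable) }
next
  case (cnj F)
  { case 1 show ?case using pulled_back_from_compose2[OF cnj.IH(1) cnj.IH(1), of "\<lambda>x y. cnj x"] by simp }
  { case 2 show ?case using cnj.IH(2) by (rule continuous_on_cnj) }
  { case 3 show ?case
      using has_vector_derivative_cnj[OF has_rpartial_0[OF cnj.IH(3)]] by (rule differentiableI_vector) }
next
  case (add F G)
  { case 1 show ?case using add.IH(1,4) by (rule pulled_back_from_compose2) }
  { case 2 show ?case using add.IH(2,5) by (rule continuous_on_add) }
  { case 3 show ?case using add.IH(3,6) by (rule differentiable_add) }
next
  case (mult F G)
  { case 1 show ?case using mult.IH(1,4) by (rule pulled_back_from_compose2) }
  { case 2 show ?case using mult.IH(2,5) by (rule continuous_on_mult) }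
  { case 3 show ?case using mult.IH(3,6) by (rule differentiable_mult) }
qed

text \<open>Differentiability along coordinate lines is all that is assumed, because members of
  \<open>smooth_algebra k\<close> are not yet known to be smooth when these rules are
  applied.\<close>

lemma rpartial_add_weak:
  assumes "\<And>p. (\<lambda>t. F (shift r t p)) differentiable (at 0)" "\<And>p. (\<lambda>t. G (shift r t p)) differentiable (at 0)"
  shows "rpartial r (\<lambda>p. F p + G p) = (\<lambda>p. rpartial r F p + rpartial r G p)"
  by (intro ext rpartial_eqI has_vector_derivative_add has_rpartial_0 assms)

lemma rpartial_mult_weak:
  assumes "\<And>p. (\<lambda>t. F (shift r t p)) differentiable (at 0)" "\<And>p. (\<lambda>t. G (shift r t p)) differentiable (at 0)"
  shows "rpartial r (\<lambda>p. F p * G p) = (\<lambda>p. F p * rpartial r G p + rpartial r F p * G p)"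
  using has_vector_derivative_mult[OF has_rpartial_0[OF assms(1)] has_rpartial_0[OF assms(2)]]
  by (intro ext rpartial_eqI) simp

lemma rpartial_cnj_weak:
  assumes "\<And>p. (\<lambda>t. F (shift r t p)) differentiable (at 0)"
  shows "rpartial r (\<lambda>p. cnj (F p)) = (\<lambda>p. cnj (rpartial r F p))"
  by (intro ext rpartial_eqI has_vector_derivative_cnj has_rpartial_0 assms)

lemma smooth_from_algebra:
  assumes "F \<in> smooth_algebra k"
  shows "smooth_from k F"
proof (rule smooth_from_coinduct[OF assms])
  show "rpartial r F \<in> smooth_algebra k" if "F \<in> smooth_algebra k" for F r
    using that
  proof induction
    case (base F)
    then show ?case by (intro smooth_algebra.base smooth_from_rpartial)
  next
    case (add F G)
    show ?case
      unfolding rpartial_add_weak[OF add.hyps[THEN smooth_algebra_props(3)]]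
      using add.IH by (rule smooth_algebra.add)
  next
    case (mult F G)
    show ?case
      unfolding rpartial_mult_weak[OF mult.hyps[THEN smooth_algebra_props(3)]]
      by (intro smooth_algebra.add smooth_algebra.mult mult.IH mult.hyps)
  next
    case (cnj F)
    show ?case
      unfolding rpartial_cnj_weak[OF cnj.hyps[THEN smooth_algebra_props(3)]]
      using cnj.IH by (rule smooth_algebra.cnj)
  qed
qed (fact smooth_algebra_props)+

named_theorems smooth_intros

lemma smooth_from_add [smooth_intros]:
  "smooth_from k F \<Longrightarrow> smooth_from k G \<Longrightarrow> smooth_from k (\<lambda>p. F p + G p)"
  by (rule smooth_from_algebra[OF smooth_algebra.add]) (auto intro: smooth_algebra.base)

lemma smooth_from_mult [smooth_intros]:
  "smooth_from k F \<Longrightarrow> smooth_from k G \<Longrightarrow> smooth_from k (\<lambda>p. F p * G p)"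
  by (rule smooth_from_algebra[OF smooth_algebra.mult]) (auto intro: smooth_algebra.base)

lemma smooth_from_cnj [smooth_intros]:
  "smooth_from k F \<Longrightarrow> smooth_from k (\<lambda>p. cnj (F p))"
  by (rule smooth_from_algebra[OF smooth_algebra.cnj]) (auto intro: smooth_algebra.base)

lemma rpartial_const [simp]: "rpartial r (\<lambda>p. a) = (\<lambda>p. 0)"
  by (intro ext rpartial_eqI) auto

lemma smooth_from_const [smooth_intros]: "smooth_from k (\<lambda>p. a)"
  by (rule smooth_from_coinduct[where S = "range (\<lambda>a p. a)"]) (auto simp: pulled_back_from_def)

lemma smooth_from_zero [smooth_intros]: "smooth_from k 0"
  using smooth_from_const[of k 0] by (simp add: zero_fun_def)

lemma smooth_from_minus [smooth_intros]: "smooth_from k F \<Longrightarrow> smooth_from k (\<lambda>p. - F p)"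
  using smooth_from_mult[OF smooth_from_const[of k "-1"]] by simp

lemma smooth_from_sum [smooth_intros]:
  "(\<And>a. a \<in> A \<Longrightarrow> smooth_from k (F a)) \<Longrightarrow> smooth_from k (\<lambda>p. \<Sum>a\<in>A. F a p)"
  by (induction A rule: infinite_finite_induct) (auto intro: smooth_intros)

section \<open>Derivatives of the coordinates and of functions of u\<close>

fun rcoord_value :: "coord \<Rightarrow> rcoord \<Rightarrow> complex" where
  "rcoord_value Z r = (if r = Re_z then 1 else if r = Im_z then \<i> else 0)"
| "rcoord_value Zbar r = (if r = Re_z then 1 else if r = Im_z then - \<i> else 0)"
| "rcoord_value U r = (if r = Real_u then 1 else 0)"
| "rcoord_value (Ui i) r = (if r = Re_u i then 1 else if r = Im_u i then \<i> else 0)"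
| "rcoord_value (Uibar i) r = (if r = Re_u i then 1 else if r = Im_u i then - \<i> else 0)"

lemma coord_fun_shift:
  "coord_fun c (shift r t p) = coord_fun c p + rcoord_value c r * complex_of_real t"
  by (cases p; cases c; cases r) auto

lemma has_vector_derivative_coord_fun:
  "((\<lambda>t. coord_fun c (shift r t p)) has_vector_derivative rcoord_value c r) (at t)"
proof -
  have "((\<lambda>t. rcoord_value c r * complex_of_real t) has_vector_derivative rcoord_value c r * 1) (at t)"
    using has_vector_derivative_of_real[OF DERIV_ident]
    by (intro has_vector_derivative_mult_right) simp
  then have "((\<lambda>t. coord_fun c p + rcoord_value c r * complex_of_real t) has_vector_derivative
      0 + rcoord_value c r * 1) (at t)"
    by (intro has_vector_derivative_add has_vector_derivative_const)
  then show ?thesis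
    by (simp add: coord_fun_shift)
qed

lemma rpartial_coord_fun: "rpartial r (coord_fun c) = (\<lambda>p. rcoord_value c r)"
  by (intro ext rpartial_eqI has_vector_derivative_coord_fun)

lemma continuous_coord_fun: "continuous_on UNIV (coord_fun c)"
proof -
  have w: "continuous_on UNIV (\<lambda>p :: jet. snd (snd p) i)" for i
    by (rule continuous_on_product_then_coordinatewise) (intro continuous_intros)
  have "coord_fun c = (\<lambda>p. case c of Z \<Rightarrow> fst p | Zbar \<Rightarrow> cnj (fst p) | U \<Rightarrow> complex_of_real (fst (snd p))
      | Ui i \<Rightarrow> snd (snd p) i | Uibar i \<Rightarrow> cnj (snd (snd p) i))"
    by (intro ext, cases c) (auto split: prod.splits)
  then show ?thesis
    by (cases c) (auto intro!: continuous_intros w)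
qed

lemma smooth_from_coord_fun:
  assumes "c \<in> coords_upto k"
  shows "smooth_from k (coord_fun c)"
proof (rule smooth_from_coinduct[where S = "insert (coord_fun c) (range (\<lambda>a p. a))"])
  show "(\<lambda>t. F (shift r t p)) differentiable (at 0)" if "F \<in> insert (coord_fun c) (range (\<lambda>a p. a))" for F r p
    using that by (auto simp only: insert_iff image_iff intro: differentiableI_vector[OF has_vector_derivative_coord_fun] differentiable_const)
  show "pulled_back_from k F" if "F \<in> insert (coord_fun c) (range (\<lambda>a p. a))" for F
    using that assms by (auto simp: pulled_back_from_def coords_upto_def)
qed (auto simp: rpartial_coord_fun continuous_coord_fun)

lemma rpartial_function_of_u:
  assumes "\<And>x. f field_differentiable (at x)"
  shows "rpartial r (\<lambda>(z, u, w). complex_of_real (f u)) =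
    (if r = Real_u then (\<lambda>(z, u, w). complex_of_real (deriv f u)) else (\<lambda>p. 0))"
    and "(\<lambda>t. (\<lambda>(z, u, w). complex_of_real (f u)) (shift r t p)) differentiable (at 0)"
proof -
  have "((\<lambda>t. (\<lambda>(z, u, w). complex_of_real (f u)) (shift r t p)) has_vector_derivative
     (if r = Real_u then (\<lambda>(z, u, w). complex_of_real (deriv f u)) p else 0)) (at 0)" for p
  proof (cases "r = Real_u")
    case True
    obtain z u w where p: "p = (z, u, w)" by (cases p)
    have "(f has_field_derivative deriv f u) (at (0 + u))"
      by (simp add: DERIV_deriv_iff_field_differentiable assms)
    then have "((\<lambda>t. f (t + u)) has_field_derivative deriv f u) (at 0)"
      by (simp only: DERIV_shift)
    then have "((\<lambda>t. complex_of_real (f (t + u))) has_vector_derivative complex_of_real (deriv f u)) (at 0)"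
      by (rule has_vector_derivative_of_real)
    then show ?thesis
      using True p by (simp add: add.commute)
  next
    case False
    then have "(\<lambda>t. (\<lambda>(z, u, w). complex_of_real (f u)) (shift r t p)) = (\<lambda>t. (\<lambda>(z, u, w). complex_of_real (f u)) p)"
      by (intro ext, cases p; cases r) auto
    then show ?thesis
      using False by simp
  qed
  note D = this
  show "rpartial r (\<lambda>(z, u, w). complex_of_real (f u)) =
    (if r = Real_u then (\<lambda>(z, u, w). complex_of_real (deriv f u)) else (\<lambda>p. 0))"
    using rpartial_eqI[OF D] by auto
  show "(\<lambda>t. (\<lambda>(z, u, w). complex_of_real (f u)) (shift r t p)) differentiable (at 0)"
    using D by (rule differentiableI_vector)
qed

lemma smooth_from_function_of_u:
  assumes "smooth_real f"
  shows "smooth_from k (\<lambda>(z, u, w). complex_of_real (f u))"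
proof -
  \<comment> \<open>All derivatives of \<open>f\<close>, together with the zero function, which is
    the derivative in every direction other than \<open>Real_u\<close>.\<close>
  define S where "S = insert (\<lambda>p. 0) (range (\<lambda>n (z :: complex, u, w :: nat \<Rightarrow> complex). complex_of_real ((deriv ^^ n) f u)))"
  have fd: "(deriv ^^ n) f field_differentiable (at x)" for n x
    using assms by (auto simp: smooth_real_def)
  show ?thesis
  proof (rule smooth_from_coinduct[where S = S])
    show "(\<lambda>(z, u, w). complex_of_real (f u)) \<in> S"
      unfolding S_def by (intro insertI2 range_eqI[of _ _ 0]) simp
    show "pulled_back_from k F" if "F \<in> S" for F
      using that by (auto simp: S_def pulled_back_from_def)
    show "continuous_on UNIV F" if "F \<in> S" for F
    proof -
      have "continuous_on UNIV ((deriv ^^ n) f)" for n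
        using fd by (intro continuous_at_imp_continuous_on ballI field_differentiable_imp_continuous_at)
      then have "continuous_on UNIV (\<lambda>p :: jet. (deriv ^^ n) f (fst (snd p)))" for n
        by (rule continuous_on_compose2[of UNIV "(deriv ^^ n) f"]) (auto intro!: continuous_intros)
      then have "continuous_on UNIV (\<lambda>p :: jet. complex_of_real ((deriv ^^ n) f (fst (snd p))))" for n
        by (rule continuous_on_of_real)
      then show ?thesis
        using that by (auto simp: S_def split_beta)
    qed
    show "(\<lambda>t. F (shift r t p)) differentiable (at 0)" if "F \<in> S" for F r p
      using that rpartial_function_of_u(2)[OF fd, of _ r p] by (auto simp: S_def)
    show "rpartial r F \<in> S" if "F \<in> S" for F r
    proof -
      have "rpartial r (\<lambda>(z, u, w). complex_of_real ((deriv ^^ n) f u)) \<in> S" for n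
        unfolding rpartial_function_of_u(1)[OF fd] S_def by (auto intro: range_eqI[of _ _ "Suc n"])
      then show ?thesis
        using that by (auto simp: S_def)
    qed
  qed
qed

section \<open>Leibniz rules and symmetry of mixed derivatives\<close>

lemma rpartial_add:
  assumes "smooth_from k F" "smooth_from l G"
  shows "rpartial r (\<lambda>p. F p + G p) = (\<lambda>p. rpartial r F p + rpartial r G p)"
  using assms by (intro rpartial_add_weak smooth_from_differentiable)

lemma rpartial_mult:
  assumes "smooth_from k F" "smooth_from l G"
  shows "rpartial r (\<lambda>p. F p * G p) = (\<lambda>p. F p * rpartial r G p + rpartial r F p * G p)"
  using assms by (intro rpartial_mult_weak smooth_from_differentiable)

lemma rpartial_cnj:
  assumes "smooth_from k F"
  shows "rpartial r (\<lambda>p. cnj (F p)) = (\<lambda>p. cnj (rpartial r F p))"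
  using assms by (intro rpartial_cnj_weak smooth_from_differentiable)

lemma rpartial_cmult:
  assumes "smooth_from k F"
  shows "rpartial r (\<lambda>p. a * F p) = (\<lambda>p. a * rpartial r F p)"
  using rpartial_mult[OF smooth_from_const[of 0 a] assms] by simp

text \<open>Both mixed derivatives are obtained by differentiating
  \<open>F(s, t) = F(s, 0) + \<integral>\<^sub>0\<^sup>t F\<^sub>t(s, \<tau>) d\<tau>\<close> under the integral sign.\<close>

lemma rpartial_commute:
  assumes F: "smooth_from k F"
  shows "rpartial r (rpartial r' F) = rpartial r' (rpartial r F)"
proof
  fix p
  define h where "h s t = F (shift r s (shift r' t p))" for s t
  define h2 where "h2 s t = rpartial r' F (shift r s (shift r' t p))" for s t
  define h21 where "h21 s t = rpartial r (rpartial r' F) (shift r s (shift r' t p))" for s t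
  have F': "smooth_from k (rpartial r' F)" "smooth_from k (rpartial r (rpartial r' F))"
    using F by (auto intro: smooth_from_rpartial)
  have dt: "((\<lambda>t. h s t) has_vector_derivative h2 s t) (at t within S)" for s t S
    using has_rpartial[OF F, of r' "shift r s p" t, THEN has_vector_derivative_at_within, of S]
    by (simp add: h_def h2_def shift_commute[of r])
  have dts: "((\<lambda>s. h2 s t) has_vector_derivative h21 s t) (at s within S)" for s t S
    using has_rpartial[OF F'(1), of r "shift r' t p" s, THEN has_vector_derivative_at_within, of S]
    by (simp add: h2_def h21_def)
  have cont: "continuous_on A (\<lambda>(s, t). G (shift r s (shift r' t p)))" if "smooth_from k G" for A G
    unfolding split_beta
    by (intro continuous_on_compose2[OF smooth_from_continuous[OF that, of UNIV]] continuous_on_shift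
        continuous_intros) auto
  have cont2: "continuous_on A (\<lambda>t. h2 s t)" for A s
    unfolding h2_def
    by (intro continuous_on_compose2[OF smooth_from_continuous[OF F'(1), of UNIV]] continuous_on_shift
        continuous_intros) auto
  have cont21: "continuous_on A (\<lambda>t. h21 s t)" for A s
    unfolding h21_def
    by (intro continuous_on_compose2[OF smooth_from_continuous[OF F'(2), of UNIV]] continuous_on_shift
        continuous_intros) auto
  \<comment> \<open>The base point is -1 instead of 0, so that 0 becomes an interior point of the
    interval from -1 to 1 and the derivative of the integral within that interval is a full
    derivative at 0.\<close>
  have FTC: "h s t - h s (-1) = integral {-1..t} (h2 s)" if "t \<ge> -1" for s t
    using integral_unique[OF fundamental_theorem_of_calculus[OF that dt]] by simp
  have ds: "((\<lambda>s. h s t) has_vector_derivative rpartial r F (shift r s (shift r' t p))) (at s)" for s t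
    unfolding h_def by (rule has_rpartial[OF F])
  have int: "((\<lambda>s. integral {-1..t} (h2 s)) has_vector_derivative integral {-1..t} (h21 0)) (at 0)" if "t \<ge> -1" for t
    using leibniz_rule_vector_derivative[of UNIV "-1" t h2 h21 0] dts cont[OF F'(2)] cont2
    by (simp add: h21_def integrable_continuous_real)
  have eq: "rpartial r F (shift r' t p) = rpartial r F (shift r' (-1) p) + integral {-1..t} (h21 0)" if "t \<ge> -1" for t
  proof -
    have "((\<lambda>s. h s (-1) + integral {-1..t} (h2 s)) has_vector_derivative
        rpartial r F (shift r' (-1) p) + integral {-1..t} (h21 0)) (at 0)"
      using has_vector_derivative_add[OF ds[of "-1" 0] int[OF that]] by simp
    moreover have "(\<lambda>s. h s (-1) + integral {-1..t} (h2 s)) = (\<lambda>s. h s t)"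
      using FTC[OF that] by (auto simp: algebra_simps)
    ultimately show ?thesis
      using vector_derivative_unique_at[OF ds[of t 0]] by simp
  qed
  have "((\<lambda>t. integral {-1..t} (h21 0)) has_vector_derivative h21 0 0) (at 0 within {-1..1})"
    by (rule integral_has_vector_derivative) (auto intro: cont21)
  then have "((\<lambda>t. rpartial r F (shift r' (-1) p) + integral {-1..t} (h21 0)) has_vector_derivative h21 0 0) (at 0 within {-1..1})"
    using has_vector_derivative_add[OF has_vector_derivative_const, of _ "h21 0 0"] by simp
  then have "((\<lambda>t. rpartial r F (shift r' t p)) has_vector_derivative h21 0 0) (at 0 within {-1..1})"
    by (rule has_vector_derivative_transform[rotated 2]) (simp, rule eq, simp)
  then have "((\<lambda>t. rpartial r F (shift r' t p)) has_vector_derivative h21 0 0) (at 0)"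
    by (simp add: at_within_Icc_at)
  from rpartial_eqI[OF this]
  show "rpartial r (rpartial r' F) p = rpartial r' (rpartial r F) p"
    by (simp add: h21_def)
qed

text \<open>A Wirtinger derivative is a fixed complex combination of two real ones, so its rules
  follow from those of \<open>rpartial\<close> without distinguishing kinds of coordinates. For
  \<open>U\<close> the second term is a dummy with coefficient 0.\<close>

lemma partial_as_rpartials:
  "\<exists>a r b r'. \<forall>F. partial c F = (\<lambda>p. a * rpartial r F p + b * rpartial r' F p)"
proof -
  have *: ?thesis if "\<And>F. partial c F = (\<lambda>p. a * rpartial r F p + b * rpartial r' F p)" for a r b r'
    using that by blast
  show ?thesis
  proof (cases c)
    case Z
    then show ?thesis by (intro *[of "1 / 2" Re_z "- \<i> / 2" Im_z]) (simp add: field_simps)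
  next
    case Zbar
    then show ?thesis by (intro *[of "1 / 2" Re_z "\<i> / 2" Im_z]) (simp add: field_simps)
  next
    case U
    then show ?thesis by (intro *[of 1 Real_u 0 Real_u]) simp
  next
    case (Ui i)
    then show ?thesis by (intro *[of "1 / 2" "Re_u i" "- \<i> / 2" "Im_u i"]) (simp add: field_simps)
  next
    case (Uibar i)
    then show ?thesis by (intro *[of "1 / 2" "Re_u i" "\<i> / 2" "Im_u i"]) (simp add: field_simps)
  qed
qed

lemma smooth_from_partial [smooth_intros]:
  assumes "smooth_from k F"
  shows "smooth_from k (partial c F)"
proof -
  obtain a r b r' where eq: "\<forall>F. partial c F = (\<lambda>p. a * rpartial r F p + b * rpartial r' F p)"
    using partial_as_rpartials[of c] by blast
  show ?thesis
    unfolding eq[rule_format] using assms by (intro smooth_intros smooth_from_rpartial)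
qed

lemma partial_add:
  assumes "smooth_from k F" "smooth_from l G"
  shows "partial c (\<lambda>p. F p + G p) = (\<lambda>p. partial c F p + partial c G p)"
proof -
  obtain a r b r' where eq: "\<forall>F. partial c F = (\<lambda>p. a * rpartial r F p + b * rpartial r' F p)"
    using partial_as_rpartials[of c] by blast
  show ?thesis
    unfolding eq[rule_format] rpartial_add[OF assms] by (simp add: algebra_simps)
qed

lemma partial_mult:
  assumes "smooth_from k F" "smooth_from l G"
  shows "partial c (\<lambda>p. F p * G p) = (\<lambda>p. F p * partial c G p + partial c F p * G p)"
proof -
  obtain a r b r' where eq: "\<forall>F. partial c F = (\<lambda>p. a * rpartial r F p + b * rpartial r' F p)"
    using partial_as_rpartials[of c] by blast
  show ?thesis
    unfolding eq[rule_format] rpartial_mult[OF assms] by (simp add: algebra_simps)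
qed

lemma partial_const [simp]: "partial c (\<lambda>p. a) = (\<lambda>p. 0)"
  by (cases c) simp_all

lemma partial_zero [simp]: "partial c 0 = (\<lambda>p. 0)"
  unfolding zero_fun_def by (rule partial_const)

lemma partial_cmult:
  "smooth_from k F \<Longrightarrow> partial c (\<lambda>p. a * F p) = (\<lambda>p. a * partial c F p)"
  using partial_mult[OF smooth_from_const[of 0 a]] by simp

lemma partial_minus: "smooth_from k F \<Longrightarrow> partial c (\<lambda>p. - F p) = (\<lambda>p. - partial c F p)"
  using partial_cmult[of k F c "- 1"] by simp

lemma partial_sum:
  "(\<And>a. a \<in> A \<Longrightarrow> smooth_from k (F a)) \<Longrightarrow>
    partial c (\<lambda>p. \<Sum>a\<in>A. F a p) = (\<lambda>p. \<Sum>a\<in>A. partial c (F a) p)"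
proof (induction A rule: infinite_finite_induct)
  case (insert x A)
  then show ?case
    using partial_add[of k "F x" k "\<lambda>p. \<Sum>a\<in>A. F a p" c]
    by (simp add: smooth_from_sum)
qed simp_all

lemma partial_cnj:
  assumes "smooth_from k F"
  shows "partial c (\<lambda>p. cnj (F p)) = (\<lambda>p. cnj (partial (bar c) F p))"
  by (cases c) (simp_all add: rpartial_cnj[OF assms])

lemma partial_coord_fun: "partial c (coord_fun d) = (\<lambda>p. if c = d then 1 else 0)"
  by (cases c; cases d) (simp_all add: rpartial_coord_fun)

lemma partial_commute:
  assumes "smooth_from k F"
  shows "partial c (partial d F) = partial d (partial c F)"
proof -
  obtain a r b r' where eq: "\<forall>F. partial c F = (\<lambda>p. a * rpartial r F p + b * rpartial r' F p)"
    using partial_as_rpartials[of c] by blast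
  obtain a' s b' s' where eq': "\<forall>F. partial d F = (\<lambda>p. a' * rpartial s F p + b' * rpartial s' F p)"
    using partial_as_rpartials[of d] by blast
  have sm: "smooth_from k (\<lambda>p. x * rpartial r F p)" for x r
    using assms by (intro smooth_from_mult smooth_from_const smooth_from_rpartial)
  have lin: "rpartial t (\<lambda>p. x * rpartial r1 F p + y * rpartial r2 F p) =
      (\<lambda>p. x * rpartial t (rpartial r1 F) p + y * rpartial t (rpartial r2 F) p)" for t x y r1 r2
    by (simp add: rpartial_add[OF sm sm] rpartial_cmult[OF smooth_from_rpartial[OF assms]])
  show ?thesis
    unfolding eq[rule_format] eq'[rule_format] lin rpartial_commute[OF assms, of s] rpartial_commute[OF assms, of s']
    by (simp add: algebra_simps)
qed

section \<open>Functions independent of the higher coordinates\<close>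

lemma rpartial_eq_0:
  assumes "\<And>t p. F (shift r t p) = F p"
  shows "rpartial r F = (\<lambda>p. 0)"
  by (intro ext rpartial_eqI) (simp add: assms)

text \<open>This is what makes the formal infinite sums finite: on a function of order
  \<open>k\<close> only \<open>coords_upto k\<close> contributes.\<close>

lemma partial_eq_0:
  assumes F: "pulled_back_from k F" and c: "c \<notin> coords_upto k"
  shows "partial c F = (\<lambda>p. 0)"
proof -
  have *: "F (shift r t p) = F p" if "i > k" "r = Re_u i \<or> r = Im_u i" for r i t p
  proof -
    obtain z u w where "p = (z, u, w)" by (cases p)
    moreover have "F (z, u, w(i := x)) = F (z, u, w)" for x
      using F[unfolded pulled_back_from_def, rule_format, of "w(i := x)" w z u] that by simp
    ultimately show ?thesis
      using that(2) by auto
  qed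
  consider i where "i > k" "c = Ui i" | i where "i > k" "c = Uibar i"
    using c by (cases c) (auto simp: coords_upto_def image_iff not_le)
  then show ?thesis
  proof cases
    case 1
    then show ?thesis by (simp add: rpartial_eq_0[OF *[of i]])
  next
    case 2
    then show ?thesis by (simp add: rpartial_eq_0[OF *[of i]])
  qed
qed

text \<open>When both Wirtinger derivatives vanish, so do both real ones, and \<open>F\<close> is
  constant in \<open>u_i\<close>. As \<open>F\<close> already comes from a finite level
  \<open>k\<close>, it remains to change the coordinates 1 to \<open>k\<close>, one at a
  time.\<close>

lemma smooth_from_0I:
  assumes F: "smooth_from k F"
    and "\<And>i. i \<ge> 1 \<Longrightarrow> partial (Ui i) F = 0" "\<And>i. i \<ge> 1 \<Longrightarrow> partial (Uibar i) F = 0"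
  shows "smooth_from 0 F"
proof -
  have rp: "rpartial (Re_u i) F p = 0" "rpartial (Im_u i) F p = 0" if "i \<ge> 1" for i p
  proof -
    have "(rpartial (Re_u i) F p - \<i> * rpartial (Im_u i) F p) / 2 = 0"
      "(rpartial (Re_u i) F p + \<i> * rpartial (Im_u i) F p) / 2 = 0"
      using fun_cong[OF assms(2)[OF that], of p] fun_cong[OF assms(3)[OF that], of p] by simp_all
    then show "rpartial (Re_u i) F p = 0" "rpartial (Im_u i) F p = 0"
      by auto
  qed
  have const: "F (shift r t p) = F p" if "\<And>q. rpartial r F q = 0" for r t p
  proof -
    have "((\<lambda>t. F (shift r t p)) has_vector_derivative 0) (at s within UNIV)" for s
      using has_rpartial[OF F, of r p s] that by simp
    then obtain c where "\<And>s. s \<in> UNIV \<Longrightarrow> F (shift r s p) = c"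
      using has_vector_derivative_zero_constant[of UNIV "\<lambda>t. F (shift r t p)"] by auto
    from this[of t] this[of 0] show ?thesis by simp
  qed
  have upd: "F (z, u, w(i := x)) = F (z, u, w)" if "i \<ge> 1" for z u w i x
  proof -
    have "(z, u, w(i := x)) = shift (Im_u i) (Im (x - w i)) (shift (Re_u i) (Re (x - w i)) (z, u, w))"
      by (simp add: fun_eq_iff complex_eq_iff)
    then show ?thesis
      by (simp only: const[OF rp(1)[OF that]] const[OF rp(2)[OF that]])
  qed
  \<comment> \<open>Descends from \<open>k\<close> to \<open>n\<close>, replacing the coordinate
    \<open>Suc n\<close> in each step. At \<open>n = k\<close> nothing has to be replaced, since
    \<open>w\<close> and \<open>w'\<close> agree above \<open>k\<close>.\<close>
  have step: "F (z, u, w) = F (z, u, \<lambda>i. if i \<le> n then w i else w' i)" if "n \<le> k"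
    "\<forall>i>k. w i = w' i" for z u w w' n
    using that(1)
  proof (induction "k - n" arbitrary: n)
    case 0
    then have "w = (\<lambda>i. if i \<le> n then w i else w' i)"
      using that by auto
    then show ?case by simp
  next
    case (Suc d)
    then have "F (z, u, w) = F (z, u, \<lambda>i. if i \<le> Suc n then w i else w' i)"
      by (intro Suc.hyps) auto
    also have "\<dots> = F (z, u, (\<lambda>i. if i \<le> Suc n then w i else w' i)(Suc n := w' (Suc n)))"
      by (rule upd[symmetric]) simp
    also have "(\<lambda>i. if i \<le> Suc n then w i else w' i)(Suc n := w' (Suc n)) = (\<lambda>i. if i \<le> n then w i else w' i)"
      by (auto simp: fun_eq_iff)
    finally show ?case .
  qed
  have *: "F (z, u, w) = F (z, u, w')" if "w 0 = w' 0" "\<forall>i>k. w i = w' i" for z u w w'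
  proof -
    have "(\<lambda>i. if i \<le> 0 then w i else w' i) = w'"
      using that by auto
    then show ?thesis
      using step[of 0 w w' z u] that by simp
  qed
  have "pulled_back_from 0 F"
    unfolding pulled_back_from_def
  proof (intro allI impI)
    fix z u and w w' :: "nat \<Rightarrow> complex" assume "\<forall>i\<le>0. w i = w' i"
    \<comment> \<open>The intermediate point agrees with \<open>w\<close> above \<open>k\<close>, as
      \<open>*\<close> requires, and with \<open>w'\<close> up to \<open>k\<close>, as the pullback
      property of \<open>F\<close> requires.\<close>
    then have "F (z, u, w) = F (z, u, \<lambda>i. if i \<le> k then w' i else w i)"
      by (intro *) auto
    also have "\<dots> = F (z, u, w')"
      using smooth_from_pulled_back[OF F, unfolded pulled_back_from_def, rule_format,
          of "\<lambda>i. if i \<le> k then w' i else w i" w' z u] by simp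
    finally show "F (z, u, w) = F (z, u, w')" .
  qed
  then show ?thesis
    using F by (simp add: smooth_from_def)
qed

section \<open>Vector fields as derivations\<close>

lemma finite_coords_upto [simp]: "finite (coords_upto k)"
  by (simp add: coords_upto_def)

lemma coords_upto_mono: "k \<le> l \<Longrightarrow> coords_upto k \<subseteq> coords_upto l"
  by (auto simp: coords_upto_def)

lemma coord_in_coords_upto: "\<exists>k. c \<in> coords_upto k"
  by (cases c) (auto simp: coords_upto_def)

lemma bar_bar [simp]: "bar (bar c) = c"
  by (cases c) simp_all

lemma bar_in_coords_upto [simp]: "bar c \<in> coords_upto k \<longleftrightarrow> c \<in> coords_upto k"
  by (cases c) (auto simp: coords_upto_def)

lemma sum_coords_upto:
  "(\<Sum>c\<in>coords_upto k. h c) = h Z + h Zbar + h U + (\<Sum>i\<le>k. h (Ui i)) + (\<Sum>i\<le>k. h (Uibar i))"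
  for h :: "coord \<Rightarrow> 'a::comm_monoid_add"
proof -
  have eq: "coords_upto k = ({Z, Zbar, U} \<union> Ui ` {..k}) \<union> Uibar ` {..k}"
    by (simp add: coords_upto_def)
  have "sum h (coords_upto k) = sum h {Z, Zbar, U} + sum h (Ui ` {..k}) + sum h (Uibar ` {..k})"
    unfolding eq[rule_format] by (subst sum.union_disjoint; (subst sum.union_disjoint)?) auto
  then show ?thesis
    by (simp add: sum.reindex inj_on_def add.assoc)
qed

lemma vapply_eq:
  assumes "smooth_from k F"
  shows "vapply v F = (\<lambda>p. \<Sum>c\<in>coords_upto k. v c p * partial c F p)"
proof
  fix p
  show "vapply v F p = (\<Sum>c\<in>coords_upto k. v c p * partial c F p)"
    unfolding vapply_def
    by (rule Sum_any.expand_superset) (auto simp: partial_eq_0[OF smooth_from_pulled_back[OF assms]] elim: contrapos_np)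
qed

lemma vapply_const [simp]: "vapply v (\<lambda>p. a) = (\<lambda>p. 0)"
  by (simp add: vapply_def)

lemma vapply_add:
  assumes "smooth_from k F" "smooth_from l G"
  shows "vapply v (\<lambda>p. F p + G p) = (\<lambda>p. vapply v F p + vapply v G p)"
proof -
  have F: "smooth_from (max k l) F" and G: "smooth_from (max k l) G"
    using assms smooth_from_mono by (meson max.cobounded1 max.cobounded2)+
  show ?thesis
    unfolding vapply_eq[OF F] vapply_eq[OF G] vapply_eq[OF smooth_from_add[OF F G]] partial_add[OF F G]
    by (simp add: sum.distrib algebra_simps)
qed

lemma vapply_mult:
  assumes "smooth_from k F" "smooth_from l G"
  shows "vapply v (\<lambda>p. F p * G p) = (\<lambda>p. F p * vapply v G p + vapply v F p * G p)"
proof -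
  have F: "smooth_from (max k l) F" and G: "smooth_from (max k l) G"
    using assms smooth_from_mono by (meson max.cobounded1 max.cobounded2)+
  show ?thesis
    unfolding vapply_eq[OF F] vapply_eq[OF G] vapply_eq[OF smooth_from_mult[OF F G]] partial_mult[OF F G]
    by (simp add: sum.distrib sum_distrib_left sum_distrib_right algebra_simps)
qed

lemma vapply_minus:
  assumes "smooth_from k F"
  shows "vapply v (\<lambda>p. - F p) = (\<lambda>p. - vapply v F p)"
  using vapply_mult[OF smooth_from_const[of k "-1"] assms] by simp

lemma vapply_sum:
  "(\<And>a. a \<in> A \<Longrightarrow> smooth_from k (F a)) \<Longrightarrow>
    vapply v (\<lambda>p. \<Sum>a\<in>A. F a p) = (\<lambda>p. \<Sum>a\<in>A. vapply v (F a) p)"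
proof (induction A rule: infinite_finite_induct)
  case (insert x A)
  then show ?case
    using vapply_add[of k "F x" k "\<lambda>p. \<Sum>a\<in>A. F a p" v]
    by (simp add: smooth_from_sum)
qed simp_all

lemma vapply_coord_fun: "vapply v (coord_fun c) = v c"
proof -
  obtain k where k: "c \<in> coords_upto k"
    using coord_in_coords_upto by blast
  show ?thesis
    unfolding vapply_eq[OF smooth_from_coord_fun[OF k]] partial_coord_fun
    using k by (simp add: if_distrib[of "\<lambda>x. _ * x"] sum.delta' cong: if_cong)
qed

lemma vapply_cnj:
  assumes "smooth_from k F"
  shows "vapply (cnj_vfield v) (\<lambda>p. cnj (F p)) = (\<lambda>p. cnj (vapply v F p))"
  unfolding vapply_eq[OF assms] vapply_eq[OF smooth_from_cnj[OF assms]] partial_cnj[OF assms] cnj_vfield_def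
  by (rule ext, simp, rule sum.reindex_bij_witness[where i = bar and j = bar]) simp_all

text \<open>The coefficients of a vector field may have no common order, but only finitely many of
  them meet an object of order \<open>k\<close>, and for those a maximum exists. Asking for
  \<open>k \<le> m\<close> lets the object itself be regarded as one of order
  \<open>m\<close>.\<close>

lemma vector_field_smooth_from:
  assumes "vector_field v"
  shows "\<exists>m\<ge>k. \<forall>c\<in>coords_upto k. smooth_from m (v c)"
proof -
  obtain l where l: "\<And>c. smooth_from (l c) (v c)"
    using assms unfolding vector_field_def smooth_def by metis
  define m where "m = Max (insert k (l ` coords_upto k))"
  have "smooth_from m (v c)" if "c \<in> coords_upto k" for c
    using that by (intro smooth_from_mono[OF l]) (simp add: m_def)
  moreover have "m \<ge> k"
    by (simp add: m_def)
  ultimately show ?thesis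
    by blast
qed

lemma smooth_from_vapply:
  assumes "smooth_from k F" "k \<le> m" "\<And>c. c \<in> coords_upto k \<Longrightarrow> smooth_from m (v c)"
  shows "smooth_from m (vapply v F)"
  unfolding vapply_eq[OF assms(1)]
  using assms by (intro smooth_intros) (auto intro: smooth_from_mono)

text \<open>The second-order part is split off because exchanging the two fields amounts to
  exchanging \<open>c\<close> and \<open>d\<close> in it; by \<open>partial_commute\<close> it drops
  out of the commutator.\<close>

lemma vapply_vapply:
  assumes F: "smooth_from k F" and Y: "vector_field Y"
  shows "vapply X (vapply Y F) = (\<lambda>p. (\<Sum>c\<in>coords_upto k. vapply X (Y c) p * partial c F p)
    + (\<Sum>c\<in>coords_upto k. \<Sum>d\<in>coords_upto k. X d p * Y c p * partial d (partial c F) p))"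
proof -
  obtain m where m: "m \<ge> k" "\<And>c. c \<in> coords_upto k \<Longrightarrow> smooth_from m (Y c)"
    using vector_field_smooth_from[OF Y] by blast
  have F': "smooth_from k (partial c F)" for c
    using F by (rule smooth_from_partial)
  then have F'm: "smooth_from m (partial c F)" for c
    using m(1) by (rule smooth_from_mono)
  have "vapply X (vapply Y F) =
      (\<lambda>p. \<Sum>c\<in>coords_upto k. Y c p * vapply X (partial c F) p + vapply X (Y c) p * partial c F p)"
    unfolding vapply_eq[OF F, of Y]
    using m F'm by (subst vapply_sum[where k = m])
      (auto intro!: smooth_from_mult sum.cong simp: vapply_mult[OF m(2) F'])
  then show ?thesis
    unfolding vapply_eq[OF F']
    by (simp add: sum.distrib sum_distrib_left algebra_simps)
qed

lemma vapply_commutator: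
  assumes F: "smooth_from k F" and "vector_field X" "vector_field Y"
  shows "vapply X (vapply Y F) p - vapply Y (vapply X F) p =
    (\<Sum>c\<in>coords_upto k. (vapply X (Y c) p - vapply Y (X c) p) * partial c F p)"
proof -
  have "(\<Sum>c\<in>coords_upto k. \<Sum>d\<in>coords_upto k. X d p * Y c p * partial d (partial c F) p) =
      (\<Sum>c\<in>coords_upto k. \<Sum>d\<in>coords_upto k. Y d p * X c p * partial d (partial c F) p)"
    by (subst sum.swap) (simp add: partial_commute[OF F] mult.commute)
  then show ?thesis
    unfolding vapply_vapply[OF F assms(2)] vapply_vapply[OF F assms(3)]
    by (simp add: sum_subtractf left_diff_distrib)
qed

lemma vapply_commute:
  assumes F: "smooth_from k F" and "vector_field X" "vector_field Y"
    and "\<And>c. c \<in> coords_upto k \<Longrightarrow> partial c F = (\<lambda>p. 0) \<or> vapply X (Y c) = vapply Y (X c)"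
  shows "vapply X (vapply Y F) = vapply Y (vapply X F)"
proof
  fix p
  have "(\<Sum>c\<in>coords_upto k. (vapply X (Y c) p - vapply Y (X c) p) * partial c F p) = 0"
    using assms(4) by (intro sum.neutral) fastforce
  then show "vapply X (vapply Y F) p = vapply Y (vapply X F) p"
    using vapply_commutator[OF assms(1-3), of p] by simp
qed

section \<open>The algebra of differential forms\<close>

lemma crank_eq_iff: "crank c = crank d \<longleftrightarrow> c = d"
  by (cases c; cases d) (auto, presburger+)

section \<open>Reordering signs of wedge products\<close>

lemma wsign_empty [simp]: "wsign {} J = 1" "wsign I {} = 1"
  by (simp_all add: wsign_def)

lemma wsign_square [simp]: "wsign I J * wsign I J = 1" "wsign I J * (wsign I J * x) = x"
proof -
  show 1: "wsign I J * wsign I J = 1"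
    unfolding wsign_def by (simp flip: power_mult_distrib)
  show "wsign I J * (wsign I J * x) = x"
    by (simp add: mult.assoc[symmetric] 1)
qed

lemma wsign_union:
  assumes "finite I" "finite J" "finite K"
  shows "I \<inter> J = {} \<Longrightarrow> wsign (I \<union> J) K = wsign I K * wsign J K"
    and "J \<inter> K = {} \<Longrightarrow> wsign I (J \<union> K) = wsign I J * wsign I K"
proof -
  let ?S = "\<lambda>I J. {(a, b). a \<in> I \<and> b \<in> J \<and> crank b < crank a}"
  have fin: "finite (?S A B)" if "finite A" "finite B" for A B
    by (rule finite_subset[of _ "A \<times> B"]) (use that in auto)
  show "wsign (I \<union> J) K = wsign I K * wsign J K" if "I \<inter> J = {}"
  proof -
    have "?S (I \<union> J) K = ?S I K \<union> ?S J K" and "?S I K \<inter> ?S J K = {}"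
      using that by auto
    then show ?thesis
      unfolding wsign_def using fin assms by (simp add: card_Un_disjoint power_add)
  qed
  show "wsign I (J \<union> K) = wsign I J * wsign I K" if "J \<inter> K = {}"
  proof -
    have "?S I (J \<union> K) = ?S I J \<union> ?S I K" and "?S I J \<inter> ?S I K = {}"
      using that by auto
    then show ?thesis
      unfolding wsign_def using fin assms by (simp add: card_Un_disjoint power_add)
  qed
qed

lemma wsign_insert:
  assumes "finite I" "finite J"
  shows "c \<notin> I \<Longrightarrow> wsign (insert c I) J = wsign {c} J * wsign I J"
    and "c \<notin> J \<Longrightarrow> wsign I (insert c J) = wsign I {c} * wsign I J"
  using wsign_union(1)[of "{c}" I J] wsign_union(2)[of I "{c}" J] assms by simp_all

text \<open>Each element of \<open>I\<close> has rank either below or above that of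
  \<open>c\<close>, so it is counted in exactly one of the two factors. Hence the cost of moving
  \<open>dc\<close> past \<open>dx_I\<close> depends only on the degree.\<close>

lemma wsign_swap:
  assumes "finite I" "c \<notin> I"
  shows "wsign {c} I * wsign I {c} = (- 1) ^ card I"
proof -
  have "{(a, b). a \<in> {c} \<and> b \<in> I \<and> crank b < crank a} = Pair c ` {b \<in> I. crank b < crank c}"
    by auto
  then have 1: "card {(a, b). a \<in> {c} \<and> b \<in> I \<and> crank b < crank a} = card {b \<in> I. crank b < crank c}"
    by (simp add: card_image inj_on_def)
  have "{(a, b). a \<in> I \<and> b \<in> {c} \<and> crank b < crank a} = (\<lambda>a. (a, c)) ` {a \<in> I. crank c < crank a}"
    by auto
  then have 2: "card {(a, b). a \<in> I \<and> b \<in> {c} \<and> crank b < crank a} = card {a \<in> I. crank c < crank a}"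
    by (simp add: card_image inj_on_def)
  have less: "crank b < crank c \<or> crank c < crank b" if "b \<in> I" for b
    using that assms(2) crank_eq_iff[of b c] linorder_neq_iff[of "crank b"] by auto
  have "b \<in> I \<longleftrightarrow> b \<in> {b \<in> I. crank b < crank c} \<union> {a \<in> I. crank c < crank a}" for b
    using less[of b] by (simp only: Un_iff mem_Collect_eq conj_disj_distribL[symmetric]) blast
  then have "I = {b \<in> I. crank b < crank c} \<union> {a \<in> I. crank c < crank a}" (is "I = ?A \<union> ?B")
    by (rule set_eqI)
  then have "card I = card (?A \<union> ?B)"
    by (rule arg_cong)
  also have "\<dots> = card ?A + card ?B"
    using assms(1) by (intro card_Un_disjoint) auto
  finally have "card I = card ?A + card ?B" .
  then show ?thesis
    unfolding wsign_def 1 2 by (simp add: power_add)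
qed

text \<open>In a wedge product this separates the terms where \<open>dc\<close> belongs to the
  second factor from those where it belongs to the first.\<close>

lemma sum_Pow_insert:
  fixes h :: "'a set \<Rightarrow> 'b::comm_monoid_add"
  assumes "finite A" "c \<notin> A"
  shows "(\<Sum>I\<in>Pow (insert c A). h I) = (\<Sum>I\<in>Pow A. h I + h (insert c I))"
proof -
  have "inj_on (insert c) (Pow A)"
    using assms(2) by (auto intro!: inj_onI simp: insert_ident dest: subsetD)
  moreover have "Pow A \<inter> insert c ` Pow A = {}"
    using assms(2) by auto
  ultimately show ?thesis
    using assms(1) by (simp add: Pow_insert sum.union_disjoint sum.reindex sum.distrib)
qed

lemma eq_uminus_imp_0:
  fixes x :: complex
  assumes "x = - x"
  shows "x = 0"
proof -
  have "x + x = x + - x"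
    using assms by (rule arg_cong[where f = "(+) x"])
  then have "2 * x = 0"
    by (simp only: mult_2 add.right_inverse)
  then show ?thesis
    by simp
qed

lemma sum_antisymmetric:
  fixes h :: "'a \<Rightarrow> 'a \<Rightarrow> complex"
  assumes "finite K" "\<And>c d. c \<in> K \<Longrightarrow> d \<in> K \<Longrightarrow> c \<noteq> d \<Longrightarrow> h c d = - h d c"
  shows "(\<Sum>c\<in>K. \<Sum>d\<in>K - {c}. h c d) = 0"
proof -
  let ?h = "\<lambda>c d. if c = d then 0 else h c d"
  have "(\<Sum>d\<in>K - {c}. h c d) = (\<Sum>d\<in>K. ?h c d)" if "c \<in> K" for c
    using assms(1) that by (intro sum.mono_neutral_cong_left) auto
  then have S: "(\<Sum>c\<in>K. \<Sum>d\<in>K - {c}. h c d) = (\<Sum>c\<in>K. \<Sum>d\<in>K. ?h c d)"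
    by simp
  have anti: "?h c d = - ?h d c" if "c \<in> K" "d \<in> K" for c d
    using assms(2)[OF that] by auto
  have "(\<Sum>c\<in>K. \<Sum>d\<in>K. ?h c d) = (\<Sum>d\<in>K. \<Sum>c\<in>K. ?h c d)"
    by (rule sum.swap)
  also have "\<dots> = (\<Sum>d\<in>K. \<Sum>c\<in>K. - ?h d c)"
    by (intro sum.cong refl anti)
  also have "\<dots> = - (\<Sum>c\<in>K. \<Sum>d\<in>K. ?h c d)"
    by (simp add: sum_negf)
  finally show ?thesis
    unfolding S by (rule eq_uminus_imp_0)
qed

subsection \<open>Closure of the space of forms\<close>

definition form_of_order :: "nat \<Rightarrow> form \<Rightarrow> bool" where
  "form_of_order k \<alpha> \<longleftrightarrow> (\<forall>I. smooth_from k (\<alpha> I)) \<and> (\<forall>I. \<alpha> I \<noteq> 0 \<longrightarrow> I \<subseteq> coords_upto k)"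

lemma forms_iff: "\<alpha> \<in> forms \<longleftrightarrow> (\<exists>k. form_of_order k \<alpha>)"
  by (simp add: forms_def form_of_order_def)

lemma form_of_order_smooth: "form_of_order k \<alpha> \<Longrightarrow> smooth_from k (\<alpha> I)"
  by (simp add: form_of_order_def)

lemma form_of_order_eq_0: "form_of_order k \<alpha> \<Longrightarrow> \<not> I \<subseteq> coords_upto k \<Longrightarrow> \<alpha> I = 0"
  unfolding form_of_order_def by blast

lemma form_of_order_infinite: "form_of_order k \<alpha> \<Longrightarrow> infinite I \<Longrightarrow> \<alpha> I = 0"
  by (erule form_of_order_eq_0) (auto dest: finite_subset[OF _ finite_coords_upto])

lemma form_of_order_mono: "form_of_order k \<alpha> \<Longrightarrow> k \<le> l \<Longrightarrow> form_of_order l \<alpha>"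
  unfolding form_of_order_def using coords_upto_mono[of k l] by (auto intro: smooth_from_mono)

lemma forms_common_order:
  assumes "\<alpha> \<in> forms" "\<beta> \<in> forms"
  obtains k where "form_of_order k \<alpha>" "form_of_order k \<beta>"
proof -
  obtain k l where "form_of_order k \<alpha>" "form_of_order l \<beta>"
    using assms by (auto simp: forms_iff)
  then have "form_of_order (max k l) \<alpha>" "form_of_order (max k l) \<beta>"
    by (auto intro: form_of_order_mono)
  then show thesis
    by (rule that)
qed

lemma form_of_orderI:
  assumes "\<And>I. smooth_from k (\<alpha> I)" "\<And>I p. \<not> I \<subseteq> coords_upto k \<Longrightarrow> \<alpha> I p = 0"
  shows "form_of_order k \<alpha>"
  unfolding form_of_order_def
proof (intro conjI allI impI)
  show "I \<subseteq> coords_upto k" if "\<alpha> I \<noteq> 0" for I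
  proof (rule ccontr)
    assume "\<not> I \<subseteq> coords_upto k"
    then have "\<alpha> I = 0"
      by (intro ext) (simp add: assms(2))
    then show False
      using that by simp
  qed
qed (rule assms(1))

lemma form_of_order_0: "form_of_order k 0"
  by (rule form_of_orderI) (simp_all add: smooth_from_zero)

lemma form_of_order_add:
  assumes "form_of_order k \<alpha>" "form_of_order k \<beta>"
  shows "form_of_order k (\<alpha> + \<beta>)"
proof (rule form_of_orderI)
  show "smooth_from k ((\<alpha> + \<beta>) I)" for I
    using smooth_from_add[OF assms[THEN form_of_order_smooth]] by (simp add: plus_fun_def)
qed (use assms in \<open>simp add: form_of_order_eq_0\<close>)

lemma form_of_order_smult:
  assumes "smooth_from k F" "form_of_order k \<alpha>"
  shows "form_of_order k (F \<cdot> \<alpha>)"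
proof (rule form_of_orderI)
  show "smooth_from k ((F \<cdot> \<alpha>) I)" for I
    using smooth_from_mult[OF assms(1) assms(2)[THEN form_of_order_smooth]] by (simp add: smult_def)
qed (use assms in \<open>simp add: form_of_order_eq_0 smult_def\<close>)

lemma minus_form: "- \<alpha> = (\<lambda>p. - 1) \<cdot> \<alpha>" for \<alpha> :: form
  by (simp add: smult_def fun_eq_iff)

lemma form_of_order_wedge:
  assumes "form_of_order k \<alpha>" "form_of_order k \<beta>"
  shows "form_of_order k (\<alpha> \<and>\<^sub>w \<beta>)"
proof (rule form_of_orderI)
  show "smooth_from k ((\<alpha> \<and>\<^sub>w \<beta>) I)" for I
    unfolding wedge_def using assms
    by (intro smooth_from_sum smooth_from_mult smooth_from_const form_of_order_smooth)
  fix K p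
  assume K: "\<not> K \<subseteq> coords_upto k"
  have "wsign I (K - I) * \<alpha> I p * \<beta> (K - I) p = 0" for I
  proof (cases "I \<subseteq> coords_upto k")
    case True
    then have "\<not> K - I \<subseteq> coords_upto k"
      using K by blast
    then show ?thesis
      by (simp add: form_of_order_eq_0[OF assms(2)])
  qed (simp add: form_of_order_eq_0[OF assms(1)])
  then show "(\<alpha> \<and>\<^sub>w \<beta>) K p = 0"
    unfolding wedge_def by (intro sum.neutral) simp
qed

lemma form_of_order_ext_d:
  assumes "form_of_order k \<alpha>"
  shows "form_of_order k (ext_d \<alpha>)"
proof (rule form_of_orderI)
  show "smooth_from k (ext_d \<alpha> I)" for I
    unfolding ext_d_def using assms
    by (intro smooth_from_sum smooth_from_mult smooth_from_const smooth_from_partial form_of_order_smooth)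
  fix K p
  assume K: "\<not> K \<subseteq> coords_upto k"
  have "partial c (\<alpha> (K - {c})) p = 0" if "c \<in> K" for c
  proof (cases "c \<in> coords_upto k")
    case True
    then have "\<alpha> (K - {c}) = 0"
      using K assms by (intro form_of_order_eq_0) blast+
    then show ?thesis by simp
  next
    case False
    then show ?thesis
      using partial_eq_0[OF smooth_from_pulled_back[OF form_of_order_smooth[OF assms]]] by simp
  qed
  then show "ext_d \<alpha> K p = 0"
    unfolding ext_d_def by (intro sum.neutral) simp
qed

subsection \<open>Interior product and exterior derivative as antiderivations\<close>

text \<open>The antiderivation rules hold already for the summands of \<open>contract\<close> and \<open>ext_d\<close> that belong
  to a single coordinate.\<close>

definition contract1 :: "coord \<Rightarrow> form \<Rightarrow> form" where
  "contract1 c \<alpha> = (\<lambda>K p. if c \<in> K then 0 else wsign {c} K * \<alpha> (insert c K) p)"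

definition ext_d1 :: "coord \<Rightarrow> form \<Rightarrow> form" where
  "ext_d1 c \<alpha> = (\<lambda>K p. if c \<in> K then wsign {c} (K - {c}) * partial c (\<alpha> (K - {c})) p else 0)"

text \<open>The parity operator. Forms may mix degrees, so the sign in an antiderivation rule cannot
  be a scalar and is made an operator on the left factor.\<close>

definition grading :: "form \<Rightarrow> form" where
  "grading \<alpha> = (\<lambda>I p. (- 1) ^ card I * \<alpha> I p)"

lemma contract_eq:
  assumes "form_of_order k \<alpha>"
  shows "contract v \<alpha> = (\<lambda>K p. \<Sum>c\<in>coords_upto k. v c p * contract1 c \<alpha> K p)"
proof (intro ext)
  fix K p
  have "contract v \<alpha> K p = (\<Sum>c\<in>coords_upto k. if c \<in> K then 0 else wsign {c} K * v c p * \<alpha> (insert c K) p)"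
    unfolding contract_def
    by (rule Sum_any.expand_superset)
      (auto split: if_splits elim: contrapos_np simp: form_of_order_eq_0[OF assms])
  then show "contract v \<alpha> K p = (\<Sum>c\<in>coords_upto k. v c p * contract1 c \<alpha> K p)"
    by (simp add: contract1_def if_distrib mult_ac cong: if_cong)
qed

lemma ext_d_eq: "ext_d \<alpha> = (\<lambda>K p. \<Sum>c\<in>K. ext_d1 c \<alpha> K p)"
  by (simp add: ext_d_def ext_d1_def)

lemma contract1_wedge:
  assumes K: "finite K"
  shows "contract1 c (\<alpha> \<and>\<^sub>w \<beta>) K p = (contract1 c \<alpha> \<and>\<^sub>w \<beta>) K p + (grading \<alpha> \<and>\<^sub>w contract1 c \<beta>) K p"
proof (cases "c \<in> K")
  case False
  have "wsign {c} K * (wsign I (insert c K - I) * \<alpha> I p * \<beta> (insert c K - I) p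
        + wsign (insert c I) (insert c K - insert c I) * \<alpha> (insert c I) p * \<beta> (insert c K - insert c I) p) =
      wsign I (K - I) * contract1 c \<alpha> I p * \<beta> (K - I) p
        + wsign I (K - I) * grading \<alpha> I p * contract1 c \<beta> (K - I) p" if "I \<in> Pow K" for I
  proof -
    have fin: "finite I" "finite (K - I)" and c: "c \<notin> I" "c \<notin> K - I"
      using that K False finite_subset by auto
    have sets: "insert c K - I = insert c (K - I)" "insert c K - insert c I = K - I"
      using c False by auto
    have "wsign {c} K = wsign {c} I * wsign {c} (K - I)"
      using wsign_union(2)[of "{c}" I "K - I"] fin that by (simp add: Un_absorb1 Un_Diff_cancel)
    then show ?thesis
      unfolding sets contract1_def grading_def wsign_swap[OF fin(1) c(1), symmetric]
      using c wsign_insert[OF fin] by (simp add: algebra_simps)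
  qed
  moreover have "contract1 c (\<alpha> \<and>\<^sub>w \<beta>) K p = wsign {c} K * (\<alpha> \<and>\<^sub>w \<beta>) (insert c K) p"
    using False by (simp add: contract1_def)
  ultimately show ?thesis
    using False K by (simp add: wedge_def sum_Pow_insert sum_distrib_left sum.distrib[symmetric])
next
  case True
  define A where "A = K - {c}"
  have KA: "K = insert c A" and A: "finite A" "c \<notin> A"
    using True K by (auto simp: A_def)
  \<comment> \<open>Two of the four terms vanish because \<open>contract1 c\<close> is evaluated on
    an index set containing \<open>c\<close>. The other two both contain
    \<open>\<alpha> (insert c I) p * \<beta> (insert c (A - I)) p\<close>, with opposite
    signs.\<close>
  have "wsign I (K - I) * contract1 c \<alpha> I p * \<beta> (K - I) p
        + wsign (insert c I) (K - insert c I) * contract1 c \<alpha> (insert c I) p * \<beta> (K - insert c I) p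
        + (wsign I (K - I) * grading \<alpha> I p * contract1 c \<beta> (K - I) p
        + wsign (insert c I) (K - insert c I) * grading \<alpha> (insert c I) p * contract1 c \<beta> (K - insert c I) p) = 0"
    if "I \<in> Pow A" for I
  proof -
    have fin: "finite I" "finite (A - I)" and c: "c \<notin> I" "c \<notin> A - I"
      using that A finite_subset by auto
    have sets: "K - I = insert c (A - I)" "K - insert c I = A - I"
      using c A by (auto simp: KA)
    show ?thesis
      unfolding sets contract1_def grading_def
      using c fin wsign_insert[OF fin] by (simp add: wsign_swap[OF fin(1) c(1), symmetric] algebra_simps)
  qed
  then have "(\<Sum>I\<in>Pow A. wsign I (K - I) * contract1 c \<alpha> I p * \<beta> (K - I) p
        + wsign (insert c I) (K - insert c I) * contract1 c \<alpha> (insert c I) p * \<beta> (K - insert c I) p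
        + (wsign I (K - I) * grading \<alpha> I p * contract1 c \<beta> (K - I) p
        + wsign (insert c I) (K - insert c I) * grading \<alpha> (insert c I) p * contract1 c \<beta> (K - insert c I) p)) = 0"
    by (rule sum.neutral[OF ballI])
  then have "(contract1 c \<alpha> \<and>\<^sub>w \<beta>) K p + (grading \<alpha> \<and>\<^sub>w contract1 c \<beta>) K p = 0"
    unfolding wedge_def KA sum_Pow_insert[OF A] sum.distrib by simp
  moreover have "contract1 c (\<alpha> \<and>\<^sub>w \<beta>) K p = 0"
    using True by (simp add: contract1_def)
  ultimately show ?thesis
    by simp
qed

lemma ext_d1_wedge:
  assumes K: "finite K" and \<alpha>: "form_of_order k \<alpha>" and \<beta>: "form_of_order k \<beta>"
  shows "ext_d1 c (\<alpha> \<and>\<^sub>w \<beta>) K p = (ext_d1 c \<alpha> \<and>\<^sub>w \<beta>) K p + (grading \<alpha> \<and>\<^sub>w ext_d1 c \<beta>) K p"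
proof (cases "c \<in> K")
  case False
  have "ext_d1 c \<alpha> I p = 0" "ext_d1 c \<beta> (K - I) p = 0" if "I \<in> Pow K" for I
    using that False by (auto simp: ext_d1_def)
  moreover have "ext_d1 c (\<alpha> \<and>\<^sub>w \<beta>) K p = 0"
    using False by (simp add: ext_d1_def)
  ultimately show ?thesis
    by (simp add: wedge_def)
next
  case True
  define A where "A = K - {c}"
  have KA: "K = insert c A" and A: "finite A" "c \<notin> A"
    using True K by (auto simp: A_def)
  note sm = form_of_order_smooth[OF \<alpha>] form_of_order_smooth[OF \<beta>]
  have "partial c ((\<alpha> \<and>\<^sub>w \<beta>) A) =
      (\<lambda>p. \<Sum>I\<in>Pow A. partial c (\<lambda>p. wsign I (A - I) * \<alpha> I p * \<beta> (A - I) p) p)"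
    unfolding wedge_def
    by (rule partial_sum[where k = k]) (intro smooth_from_mult smooth_from_const sm)
  also have "\<dots> = (\<lambda>p. \<Sum>I\<in>Pow A. wsign I (A - I) * (\<alpha> I p * partial c (\<beta> (A - I)) p + partial c (\<alpha> I) p * \<beta> (A - I) p))"
    by (simp add: mult.assoc partial_cmult[OF smooth_from_mult[OF sm]] partial_mult[OF sm])
  finally have d: "ext_d1 c (\<alpha> \<and>\<^sub>w \<beta>) K p = wsign {c} A *
      (\<Sum>I\<in>Pow A. wsign I (A - I) * (\<alpha> I p * partial c (\<beta> (A - I)) p + partial c (\<alpha> I) p * \<beta> (A - I) p))"
    using A by (simp add: ext_d1_def KA)
  \<comment> \<open>The factor whose index set contains \<open>c\<close> is the differentiated one:
    \<beta> for \<open>I\<close>, \<alpha> for \<open>insert c I\<close>. These are the two halves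
    of the product rule.\<close>
  have "wsign I (K - I) * ext_d1 c \<alpha> I p * \<beta> (K - I) p
        + wsign (insert c I) (K - insert c I) * ext_d1 c \<alpha> (insert c I) p * \<beta> (K - insert c I) p
        + (wsign I (K - I) * grading \<alpha> I p * ext_d1 c \<beta> (K - I) p
        + wsign (insert c I) (K - insert c I) * grading \<alpha> (insert c I) p * ext_d1 c \<beta> (K - insert c I) p) =
      wsign {c} A * (wsign I (A - I) * (\<alpha> I p * partial c (\<beta> (A - I)) p + partial c (\<alpha> I) p * \<beta> (A - I) p))"
    if "I \<in> Pow A" for I
  proof -
    have fin: "finite I" "finite (A - I)" and c: "c \<notin> I" "c \<notin> A - I"
      using that A finite_subset by auto
    have sets: "K - I = insert c (A - I)" "K - insert c I = A - I"
      using c A by (auto simp: KA)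
    have "wsign {c} A = wsign {c} I * wsign {c} (A - I)"
      using wsign_union(2)[of "{c}" I "A - I"] fin that by (simp add: Un_absorb1 Un_Diff_cancel)
    then show ?thesis
      unfolding sets ext_d1_def grading_def
      using c fin wsign_insert[OF fin] by (simp add: wsign_swap[OF fin(1) c(1), symmetric] algebra_simps)
  qed
  then have "(\<Sum>I\<in>Pow A. wsign I (K - I) * ext_d1 c \<alpha> I p * \<beta> (K - I) p
        + wsign (insert c I) (K - insert c I) * ext_d1 c \<alpha> (insert c I) p * \<beta> (K - insert c I) p
        + (wsign I (K - I) * grading \<alpha> I p * ext_d1 c \<beta> (K - I) p
        + wsign (insert c I) (K - insert c I) * grading \<alpha> (insert c I) p * ext_d1 c \<beta> (K - insert c I) p)) =
      ext_d1 c (\<alpha> \<and>\<^sub>w \<beta>) K p"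
    unfolding d sum_distrib_left by (rule sum.cong[OF refl])
  then show ?thesis
    unfolding wedge_def[of "ext_d1 c \<alpha>"] wedge_def[of "grading \<alpha>"] KA sum_Pow_insert[OF A] sum.distrib by simp
qed

text \<open>The type \<open>form\<close> also has components at infinite index sets; there
  \<open>Pow K\<close> is infinite and the sum over it is 0 by convention.\<close>

lemma wedge_infinite: "infinite K \<Longrightarrow> (\<alpha> \<and>\<^sub>w \<beta>) K p = 0"
  by (simp add: wedge_def)

lemma contract_wedge:
  assumes \<alpha>: "form_of_order k \<alpha>" and \<beta>: "form_of_order k \<beta>"
  shows "contract v (\<alpha> \<and>\<^sub>w \<beta>) = contract v \<alpha> \<and>\<^sub>w \<beta> + grading \<alpha> \<and>\<^sub>w contract v \<beta>"
proof (intro ext)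
  fix K p
  show "contract v (\<alpha> \<and>\<^sub>w \<beta>) K p = (contract v \<alpha> \<and>\<^sub>w \<beta> + grading \<alpha> \<and>\<^sub>w contract v \<beta>) K p"
  proof (cases "finite K")
    case True
    have "(contract v \<alpha> \<and>\<^sub>w \<beta>) K p = (\<Sum>c\<in>coords_upto k. v c p * (contract1 c \<alpha> \<and>\<^sub>w \<beta>) K p)"
      unfolding wedge_def contract_eq[OF \<alpha>] sum_distrib_left sum_distrib_right
      by (subst sum.swap) (simp add: mult_ac)
    moreover have "(grading \<alpha> \<and>\<^sub>w contract v \<beta>) K p =
        (\<Sum>c\<in>coords_upto k. v c p * (grading \<alpha> \<and>\<^sub>w contract1 c \<beta>) K p)"
      unfolding wedge_def contract_eq[OF \<beta>] sum_distrib_left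
      by (subst sum.swap) (simp add: mult_ac)
    ultimately show ?thesis
      by (simp add: contract_eq[OF form_of_order_wedge[OF \<alpha> \<beta>]] contract1_wedge[OF True]
          sum.distrib distrib_left)
  next
    case False
    then have zero: "(\<lambda>c. if c \<in> K then 0 else wsign {c} K * v c p * (\<alpha> \<and>\<^sub>w \<beta>) (insert c K) p) = (\<lambda>c. 0)"
      by (intro ext) (simp add: wedge_infinite)
    have "contract v (\<alpha> \<and>\<^sub>w \<beta>) K p = 0"
      unfolding contract_def zero by simp
    then show ?thesis
      using False by (simp add: wedge_infinite)
  qed
qed

lemma ext_d_wedge:
  assumes \<alpha>: "form_of_order k \<alpha>" and \<beta>: "form_of_order k \<beta>"
  shows "ext_d (\<alpha> \<and>\<^sub>w \<beta>) = ext_d \<alpha> \<and>\<^sub>w \<beta> + grading \<alpha> \<and>\<^sub>w ext_d \<beta>"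
proof (intro ext)
  fix K p
  show "ext_d (\<alpha> \<and>\<^sub>w \<beta>) K p = (ext_d \<alpha> \<and>\<^sub>w \<beta> + grading \<alpha> \<and>\<^sub>w ext_d \<beta>) K p"
  proof (cases "finite K")
    case True
    \<comment> \<open>Summing over all of \<open>K\<close> instead of \<open>I\<close> adds only
      zeros and makes the range independent of \<open>I\<close>, so the two sums can be
      interchanged.\<close>
    have ext: "ext_d \<gamma> I p = (\<Sum>c\<in>K. ext_d1 c \<gamma> I p)" if "I \<subseteq> K" for \<gamma> I
      unfolding ext_d_eq using that True by (intro sum.mono_neutral_left) (auto simp: ext_d1_def)
    have "(ext_d \<alpha> \<and>\<^sub>w \<beta>) K p = (\<Sum>I\<in>Pow K. \<Sum>c\<in>K. wsign I (K - I) * ext_d1 c \<alpha> I p * \<beta> (K - I) p)"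
      unfolding wedge_def by (simp add: ext sum_distrib_left sum_distrib_right)
    also have "\<dots> = (\<Sum>c\<in>K. (ext_d1 c \<alpha> \<and>\<^sub>w \<beta>) K p)"
      unfolding wedge_def by (rule sum.swap)
    finally have 1: "(ext_d \<alpha> \<and>\<^sub>w \<beta>) K p = (\<Sum>c\<in>K. (ext_d1 c \<alpha> \<and>\<^sub>w \<beta>) K p)" .
    have "(grading \<alpha> \<and>\<^sub>w ext_d \<beta>) K p =
        (\<Sum>I\<in>Pow K. \<Sum>c\<in>K. wsign I (K - I) * grading \<alpha> I p * ext_d1 c \<beta> (K - I) p)"
      unfolding wedge_def by (simp add: ext sum_distrib_left)
    also have "\<dots> = (\<Sum>c\<in>K. (grading \<alpha> \<and>\<^sub>w ext_d1 c \<beta>) K p)"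
      unfolding wedge_def by (rule sum.swap)
    finally show ?thesis
      using 1 by (simp add: ext_d_eq[of "\<alpha> \<and>\<^sub>w \<beta>"] ext_d1_wedge[OF True \<alpha> \<beta>] sum.distrib)
  next
    case False
    then show ?thesis
      by (simp add: ext_d_def wedge_infinite)
  qed
qed

text \<open>The mixed derivatives are symmetric in the two coordinates and the reordering signs
  antisymmetric, so the double sum equals its own negative.\<close>

lemma ext_d_ext_d:
  assumes \<alpha>: "form_of_order k \<alpha>"
  shows "ext_d (ext_d \<alpha>) = 0"
proof (intro ext)
  fix K p
  show "ext_d (ext_d \<alpha>) K p = 0 K p"
  proof (cases "finite K")
    case True
    note sm = form_of_order_smooth[OF \<alpha>]
    define h where "h c d = wsign {c} (K - {c}) * (wsign {d} (K - {c} - {d}) *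
      partial c (partial d (\<alpha> (K - {c} - {d}))) p)" for c d
    have "partial c (ext_d \<alpha> (K - {c})) p =
        (\<Sum>d\<in>K - {c}. wsign {d} (K - {c} - {d}) * partial c (partial d (\<alpha> (K - {c} - {d}))) p)" for c
    proof -
      have "partial c (ext_d \<alpha> (K - {c})) =
          (\<lambda>p. \<Sum>d\<in>K - {c}. partial c (\<lambda>p. wsign {d} (K - {c} - {d}) * partial d (\<alpha> (K - {c} - {d})) p) p)"
        unfolding ext_d_def
        by (rule partial_sum[where k = k]) (intro smooth_from_mult smooth_from_const smooth_from_partial sm)
      then show ?thesis
        by (simp add: partial_cmult[OF smooth_from_partial[OF sm]])
    qed
    then have "ext_d (ext_d \<alpha>) K p = (\<Sum>c\<in>K. \<Sum>d\<in>K - {c}. h c d)"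
      by (simp add: ext_d_def[of "ext_d \<alpha>"] h_def sum_distrib_left)
    also have "\<dots> = 0"
    proof (rule sum_antisymmetric[OF True])
      fix c d
      assume cd: "c \<in> K" "d \<in> K" "c \<noteq> d"
      define A where "A = K - {c} - {d}"
      have A: "finite A" "c \<notin> A" "d \<notin> A" "K - {c} = insert d A" "K - {d} = insert c A" "K - {d} - {c} = A"
        using cd True by (auto simp: A_def)
      have "wsign {c} {d} = wsign {c} {d} * (wsign {d} {c} * wsign {d} {c})"
        by (simp only: wsign_square mult_1_right)
      also have "\<dots> = (wsign {c} {d} * wsign {d} {c}) * wsign {d} {c}"
        by (simp only: mult.assoc)
      also have "\<dots> = - wsign {d} {c}"
        using wsign_swap[of "{d}" c] cd by simp
      finally have s: "wsign {c} {d} = - wsign {d} {c}" .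
      have w: "wsign {c} (K - {c}) = wsign {c} {d} * wsign {c} A" "wsign {d} (K - {d}) = wsign {d} {c} * wsign {d} A"
        unfolding A(4,5) by (intro wsign_insert(2) finite.intros A)+
      have "h c d = wsign {c} {d} * wsign {c} A * (wsign {d} A * partial c (partial d (\<alpha> A)) p)"
        by (simp only: h_def w A_def[symmetric])
      moreover have "h d c = wsign {d} {c} * wsign {d} A * (wsign {c} A * partial d (partial c (\<alpha> A)) p)"
        by (simp only: h_def w A(6))
      moreover have "partial d (partial c (\<alpha> A)) = partial c (partial d (\<alpha> A))"
        by (rule partial_commute[OF sm])
      ultimately show "h c d = - h d c"
        by (simp only: s mult_minus_left mult_minus_right mult_ac)
    qed
    finally show ?thesis by simp
  next
    case False
    then show ?thesis by (simp add: ext_d_def)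
  qed
qed

subsection \<open>The Lie derivative\<close>

lemma wedge_add_left: "(\<alpha> + \<beta>) \<and>\<^sub>w \<gamma> = \<alpha> \<and>\<^sub>w \<gamma> + \<beta> \<and>\<^sub>w \<gamma>"
  by (intro ext) (simp add: wedge_def algebra_simps sum.distrib)

lemma wedge_add_right: "\<alpha> \<and>\<^sub>w (\<beta> + \<gamma>) = \<alpha> \<and>\<^sub>w \<beta> + \<alpha> \<and>\<^sub>w \<gamma>"
  by (intro ext) (simp add: wedge_def algebra_simps sum.distrib)

lemma wedge_minus_left: "(- \<alpha>) \<and>\<^sub>w \<beta> = - (\<alpha> \<and>\<^sub>w \<beta>)"
  by (intro ext) (simp add: wedge_def sum_negf)

lemma wedge_diff_left: "(\<alpha> - \<beta>) \<and>\<^sub>w \<gamma> = \<alpha> \<and>\<^sub>w \<gamma> - \<beta> \<and>\<^sub>w \<gamma>"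
  by (intro ext) (simp add: wedge_def algebra_simps sum_subtractf)

lemma wedge_diff_right: "\<alpha> \<and>\<^sub>w (\<beta> - \<gamma>) = \<alpha> \<and>\<^sub>w \<beta> - \<alpha> \<and>\<^sub>w \<gamma>"
  by (intro ext) (simp add: wedge_def algebra_simps sum_subtractf)

lemma wedge_zero [simp]: "0 \<and>\<^sub>w \<alpha> = 0" "\<alpha> \<and>\<^sub>w 0 = 0"
  by (intro ext; simp add: wedge_def)+

lemma wedge_smult_left: "(F \<cdot> \<alpha>) \<and>\<^sub>w \<beta> = F \<cdot> (\<alpha> \<and>\<^sub>w \<beta>)"
  by (intro ext) (simp add: wedge_def smult_def sum_distrib_left mult_ac)

lemma wedge_smult_right: "\<alpha> \<and>\<^sub>w (F \<cdot> \<beta>) = F \<cdot> (\<alpha> \<and>\<^sub>w \<beta>)"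
  by (intro ext) (simp add: wedge_def smult_def sum_distrib_left mult_ac)

lemma smult_zero [simp]: "F \<cdot> 0 = 0" "(\<lambda>p. 0) \<cdot> \<alpha> = 0"
  by (intro ext; simp add: smult_def)+

lemma ext_d_add:
  assumes "form_of_order k \<alpha>" "form_of_order k \<beta>"
  shows "ext_d (\<alpha> + \<beta>) = ext_d \<alpha> + ext_d \<beta>"
  using partial_add[OF assms[THEN form_of_order_smooth]]
  by (intro ext) (simp add: ext_d_def plus_fun_def sum.distrib algebra_simps)

lemma contract1_add: "contract1 c (\<alpha> + \<beta>) = contract1 c \<alpha> + contract1 c \<beta>"
  by (intro ext) (simp add: contract1_def distrib_left)

lemma contract_add:
  assumes "form_of_order k \<alpha>" "form_of_order k \<beta>"
  shows "contract v (\<alpha> + \<beta>) = contract v \<alpha> + contract v \<beta>"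
  unfolding contract_eq[OF assms(1)] contract_eq[OF assms(2)] contract_eq[OF form_of_order_add[OF assms]]
  by (intro ext) (simp add: contract1_add sum.distrib distrib_left)

lemma form_of_order_grading: "form_of_order k \<alpha> \<Longrightarrow> form_of_order k (grading \<alpha>)"
  by (rule form_of_orderI)
    (auto simp: grading_def form_of_order_eq_0 intro: smooth_from_mult smooth_from_const form_of_order_smooth)

lemma grading_grading [simp]: "grading (grading \<alpha>) = \<alpha>"
  by (intro ext) (simp add: grading_def mult.assoc[symmetric] power_mult_distrib[symmetric])

text \<open>The interior product lowers the degree by one and therefore anticommutes with the parity
  operator. At infinite \<open>K\<close>, where \<open>card K\<close> is 0 and carries no parity,
  both sides vanish because \<alpha> has finite order.\<close>

lemma grading_contract:
  assumes \<alpha>: "form_of_order k \<alpha>"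
  shows "grading (contract v \<alpha>) = - contract v (grading \<alpha>)"
proof (intro ext)
  fix K p
  have "(- 1) ^ card K * contract1 c \<alpha> K p = - contract1 c (grading \<alpha>) K p" for c
  proof (cases "finite K")
    case True
    then show ?thesis by (simp add: contract1_def grading_def)
  next
    case False
    then show ?thesis by (simp add: contract1_def grading_def form_of_order_infinite[OF \<alpha>])
  qed
  note grade = this
  have "grading (contract v \<alpha>) K p = (\<Sum>c\<in>coords_upto k. v c p * ((- 1) ^ card K * contract1 c \<alpha> K p))"
    unfolding grading_def contract_eq[OF \<alpha>] by (simp add: sum_distrib_left mult.left_commute)
  also have "\<dots> = (- contract v (grading \<alpha>)) K p"
    unfolding grade contract_eq[OF form_of_order_grading[OF \<alpha>]] by (simp add: sum_negf)
  finally show "grading (contract v \<alpha>) K p = (- contract v (grading \<alpha>)) K p" .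
qed

lemma grading_ext_d:
  assumes \<alpha>: "form_of_order k \<alpha>"
  shows "grading (ext_d \<alpha>) = - ext_d (grading \<alpha>)"
proof (intro ext)
  fix K p
  have "(- 1) ^ card K * ext_d1 c \<alpha> K p = - ext_d1 c (grading \<alpha>) K p" if "c \<in> K" "finite K" for c
  proof -
    have "(- 1 :: complex) ^ card K = - ((- 1) ^ card (K - {c}))"
      by (simp only: card.remove[OF that(2,1)] power_Suc mult_minus1)
    then show ?thesis
      using that by (simp add: ext_d1_def grading_def partial_cmult[OF form_of_order_smooth[OF \<alpha>]])
  qed
  then show "grading (ext_d \<alpha>) K p = (- ext_d (grading \<alpha>)) K p"
    unfolding grading_def[of "ext_d \<alpha>"] unfolding ext_d_eq
    by (cases "finite K") (simp_all add: sum_distrib_left sum_negf[symmetric])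
qed

text \<open>Unlike \<open>ext_d\<close>, contraction may raise the order, namely to the level on
  which the relevant coefficients of \<open>v\<close> live.\<close>

lemma form_of_order_contract:
  assumes \<alpha>: "form_of_order k \<alpha>" and m: "k \<le> m" "\<forall>c\<in>coords_upto k. smooth_from m (v c)"
  shows "form_of_order m (contract v \<alpha>)"
proof (rule form_of_orderI)
  have sm: "smooth_from m (contract1 c \<alpha> I)" for c I
    unfolding contract1_def
    using smooth_from_mono[OF form_of_order_smooth[OF \<alpha>] m(1)]
    by (cases "c \<in> I") (simp_all add: smooth_from_const smooth_from_mult)
  show "smooth_from m (contract v \<alpha> I)" for I
    unfolding contract_eq[OF \<alpha>] using m(2) by (intro smooth_from_sum smooth_from_mult sm) simp
  fix I p
  assume "\<not> I \<subseteq> coords_upto m"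
  then have "\<not> insert c I \<subseteq> coords_upto k" for c
    using coords_upto_mono[OF m(1)] by blast
  then have "contract1 c \<alpha> I p = 0" for c
    by (simp add: contract1_def form_of_order_eq_0[OF \<alpha>] del: insert_subset)
  then show "contract v \<alpha> I p = 0"
    unfolding contract_eq[OF \<alpha>] by simp
qed

lemma lie_in_forms:
  assumes v: "vector_field v" and "\<alpha> \<in> forms"
  shows "lie v \<alpha> \<in> forms"
proof -
  obtain k where \<alpha>: "form_of_order k \<alpha>"
    using assms(2) by (auto simp: forms_iff)
  obtain m where m: "m \<ge> k" "\<forall>c\<in>coords_upto k. smooth_from m (v c)"
    using vector_field_smooth_from[OF v] by blast
  have "form_of_order m (lie v \<alpha>)"
    unfolding lie_def
    by (intro form_of_order_add form_of_order_ext_d form_of_order_contract[OF _ m] \<alpha>)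
  then show ?thesis
    by (auto simp: forms_iff)
qed

lemma lie_add:
  assumes v: "vector_field v" and "\<alpha> \<in> forms" "\<beta> \<in> forms"
  shows "lie v (\<alpha> + \<beta>) = lie v \<alpha> + lie v \<beta>"
proof -
  obtain k where \<alpha>: "form_of_order k \<alpha>" and \<beta>: "form_of_order k \<beta>"
    using assms(2,3) by (rule forms_common_order)
  obtain m where m: "m \<ge> k" "\<forall>c\<in>coords_upto k. smooth_from m (v c)"
    using vector_field_smooth_from[OF v] by blast
  show ?thesis
    unfolding lie_def ext_d_add[OF \<alpha> \<beta>] contract_add[OF \<alpha> \<beta>]
      contract_add[OF form_of_order_ext_d[OF \<alpha>] form_of_order_ext_d[OF \<beta>]]
      ext_d_add[OF form_of_order_contract[OF \<alpha> m] form_of_order_contract[OF \<beta> m]]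
    by (simp add: algebra_simps)
qed

text \<open>Expanding Cartan's formula gives cross terms in which one factor is differentiated and
  the other contracted. Each occurs twice, and with opposite signs because \<open>grading\<close>
  anticommutes with both operations.\<close>

lemma lie_wedge:
  assumes v: "vector_field v" and "\<alpha> \<in> forms" "\<beta> \<in> forms"
  shows "lie v (\<alpha> \<and>\<^sub>w \<beta>) = lie v \<alpha> \<and>\<^sub>w \<beta> + \<alpha> \<and>\<^sub>w lie v \<beta>"
proof -
  obtain k where \<alpha>: "form_of_order k \<alpha>" and \<beta>: "form_of_order k \<beta>"
    using assms(2,3) by (rule forms_common_order)
  obtain m where m: "m \<ge> k" "\<forall>c\<in>coords_upto k. smooth_from m (v c)"
    using vector_field_smooth_from[OF v] by blast
  note fo = \<alpha> \<beta> form_of_order_grading form_of_order_ext_d form_of_order_wedge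
  note mono = form_of_order_mono[OF _ m(1)]
  note i = form_of_order_contract[OF _ m]
  have "ext_d (contract v (\<alpha> \<and>\<^sub>w \<beta>)) = ext_d (contract v \<alpha> \<and>\<^sub>w \<beta> + grading \<alpha> \<and>\<^sub>w contract v \<beta>)"
    by (simp only: contract_wedge[OF \<alpha> \<beta>])
  also have "\<dots> = ext_d (contract v \<alpha> \<and>\<^sub>w \<beta>) + ext_d (grading \<alpha> \<and>\<^sub>w contract v \<beta>)"
    by (intro ext_d_add[where k = m] form_of_order_wedge i mono[OF \<beta>] mono[OF form_of_order_grading[OF \<alpha>]] \<alpha> \<beta>)
  also have "ext_d (contract v \<alpha> \<and>\<^sub>w \<beta>) = ext_d (contract v \<alpha>) \<and>\<^sub>w \<beta> + grading (contract v \<alpha>) \<and>\<^sub>w ext_d \<beta>"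
    by (intro ext_d_wedge[where k = m] i mono[OF \<beta>] \<alpha>)
  also have "ext_d (grading \<alpha> \<and>\<^sub>w contract v \<beta>) = ext_d (grading \<alpha>) \<and>\<^sub>w contract v \<beta> + \<alpha> \<and>\<^sub>w ext_d (contract v \<beta>)"
    using ext_d_wedge[OF mono[OF form_of_order_grading[OF \<alpha>]] i[OF \<beta>]] by simp
  finally have 1: "ext_d (contract v (\<alpha> \<and>\<^sub>w \<beta>)) =
      ext_d (contract v \<alpha>) \<and>\<^sub>w \<beta> + grading (contract v \<alpha>) \<and>\<^sub>w ext_d \<beta>
      + (ext_d (grading \<alpha>) \<and>\<^sub>w contract v \<beta> + \<alpha> \<and>\<^sub>w ext_d (contract v \<beta>))" .
  have "contract v (ext_d (\<alpha> \<and>\<^sub>w \<beta>)) = contract v (ext_d \<alpha> \<and>\<^sub>w \<beta> + grading \<alpha> \<and>\<^sub>w ext_d \<beta>)"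
    by (simp only: ext_d_wedge[OF \<alpha> \<beta>])
  also have "\<dots> = contract v (ext_d \<alpha> \<and>\<^sub>w \<beta>) + contract v (grading \<alpha> \<and>\<^sub>w ext_d \<beta>)"
    by (intro contract_add[where k = k] fo)
  also have "contract v (ext_d \<alpha> \<and>\<^sub>w \<beta>) = contract v (ext_d \<alpha>) \<and>\<^sub>w \<beta> + grading (ext_d \<alpha>) \<and>\<^sub>w contract v \<beta>"
    by (intro contract_wedge[where k = k] fo)
  also have "contract v (grading \<alpha> \<and>\<^sub>w ext_d \<beta>) = contract v (grading \<alpha>) \<and>\<^sub>w ext_d \<beta> + \<alpha> \<and>\<^sub>w contract v (ext_d \<beta>)"
    using contract_wedge[OF form_of_order_grading[OF \<alpha>] form_of_order_ext_d[OF \<beta>]] by simp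
  finally have 2: "contract v (ext_d (\<alpha> \<and>\<^sub>w \<beta>)) =
      contract v (ext_d \<alpha>) \<and>\<^sub>w \<beta> + grading (ext_d \<alpha>) \<and>\<^sub>w contract v \<beta>
      + (contract v (grading \<alpha>) \<and>\<^sub>w ext_d \<beta> + \<alpha> \<and>\<^sub>w contract v (ext_d \<beta>))" .
  show ?thesis
    unfolding lie_def 1 2 grading_contract[OF \<alpha>] grading_ext_d[OF \<alpha>]
    by (simp add: wedge_add_left wedge_add_right wedge_minus_left algebra_simps)
qed

lemma contract_0 [simp]: "contract v 0 = 0"
proof (intro ext)
  fix K p
  have zero: "(\<lambda>c. if c \<in> K then 0 else wsign {c} K * v c p * (0 :: form) (insert c K) p) = (\<lambda>c. 0)"
    by (intro ext) simp
  show "contract v 0 K p = 0 K p"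
    unfolding contract_def zero by simp
qed

lemma ext_d_0 [simp]: "ext_d 0 = 0"
  by (intro ext) (simp add: ext_d_def)

text \<open>By \<open>ext_d_ext_d\<close>, both sides reduce to
  \<open>ext_d (contract v (ext_d \<alpha>))\<close>.\<close>

lemma lie_ext_d:
  assumes v: "vector_field v" and "\<alpha> \<in> forms"
  shows "lie v (ext_d \<alpha>) = ext_d (lie v \<alpha>)"
proof -
  obtain k where \<alpha>: "form_of_order k \<alpha>"
    using assms(2) by (auto simp: forms_iff)
  obtain m where m: "m \<ge> k" "\<forall>c\<in>coords_upto k. smooth_from m (v c)"
    using vector_field_smooth_from[OF v] by blast
  note i = form_of_order_contract[OF _ m]
  show ?thesis
    unfolding lie_def ext_d_ext_d[OF \<alpha>]
      ext_d_add[OF form_of_order_ext_d[OF i[OF \<alpha>]] i[OF form_of_order_ext_d[OF \<alpha>]]]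
      ext_d_ext_d[OF i[OF \<alpha>]]
    by simp
qed

text \<open>With functions embedded as forms of degree 0, scalar multiplication is a wedge product.
  Its Leibniz rules and the stability of ideals under it become instances of the statements for
  \<open>\<and>\<^sub>w\<close>.\<close>

definition function_form :: "(jet \<Rightarrow> complex) \<Rightarrow> form" where
  "function_form F = (\<lambda>I. if I = {} then F else 0)"

lemma form_of_order_function_form: "smooth_from k F \<Longrightarrow> form_of_order k (function_form F)"
  by (rule form_of_orderI) (auto simp: function_form_def smooth_from_zero)

lemma smult_eq_wedge:
  assumes "form_of_order k \<alpha>"
  shows "F \<cdot> \<alpha> = function_form F \<and>\<^sub>w \<alpha>"
proof (intro ext)
  fix K p
  show "(F \<cdot> \<alpha>) K p = (function_form F \<and>\<^sub>w \<alpha>) K p"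
  proof (cases "finite K")
    case True
    have "(function_form F \<and>\<^sub>w \<alpha>) K p = (\<Sum>I\<in>Pow K. if I = {} then F p * \<alpha> K p else 0)"
      unfolding wedge_def by (intro sum.cong refl) (simp add: function_form_def)
    then show ?thesis
      using True by (simp add: smult_def)
  next
    case False
    then show ?thesis
      by (simp add: smult_def wedge_infinite form_of_order_infinite[OF assms])
  qed
qed

lemma ext_d_function_form:
  "ext_d (function_form F) = (\<lambda>K p. \<Sum>c\<in>K. if K = {c} then partial c F p else 0)"
  unfolding ext_d_def function_form_def
  by (intro ext sum.cong refl) auto

lemma ext_d_function_form_singleton: "ext_d (function_form F) {c} = partial c F"
  by (intro ext) (simp add: ext_d_function_form)

lemma ext_d_function_form_eq_0:
  assumes "\<nexists>c. I = {c}"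
  shows "ext_d (function_form F) I = 0"
  using assms by (intro ext) (auto simp: ext_d_function_form intro!: sum.neutral)

lemma contract_function_form [simp]: "contract v (function_form F) = 0"
proof (intro ext)
  fix K p
  have zero: "(\<lambda>c. if c \<in> K then 0 else wsign {c} K * v c p * function_form F (insert c K) p) = (\<lambda>c. 0)"
    by (intro ext) (simp add: function_form_def)
  show "contract v (function_form F) K p = 0 K p"
    unfolding contract_def zero by simp
qed

lemma lie_function_form: "lie v (function_form F) = function_form (vapply v F)"
proof (intro ext)
  fix K p
  show "lie v (function_form F) K p = function_form (vapply v F) K p"
  proof (cases "K = {}")
    case True
    then show ?thesis
      by (simp add: lie_def contract_def[of v "ext_d _"] ext_d_function_form_singleton)
        (simp add: function_form_def vapply_def)
  next
    case False
    have "ext_d (function_form F) (insert c K) = 0" if "c \<notin> K" for c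
      using that False by (intro ext_d_function_form_eq_0) auto
    then have zero: "(\<lambda>c. if c \<in> K then 0 else wsign {c} K * v c p * ext_d (function_form F) (insert c K) p) = (\<lambda>c. 0)"
      by (intro ext) simp
    have "contract v (ext_d (function_form F)) K p = 0"
      unfolding contract_def zero by simp
    then show ?thesis
      using False by (simp add: lie_def function_form_def[of "vapply v F"])
  qed
qed

lemma grading_function_form [simp]: "grading (function_form F) = function_form F"
  by (intro ext) (simp add: grading_def function_form_def)

lemma ext_d_smult:
  assumes F: "smooth_from k F" and \<alpha>: "form_of_order k \<alpha>"
  shows "ext_d (F \<cdot> \<alpha>) = ext_d (function_form F) \<and>\<^sub>w \<alpha> + F \<cdot> ext_d \<alpha>"
  unfolding smult_eq_wedge[OF \<alpha>] smult_eq_wedge[OF form_of_order_ext_d[OF \<alpha>]]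
    ext_d_wedge[OF form_of_order_function_form[OF F] \<alpha>] by simp

lemma form_of_order_dcoord:
  assumes "c \<in> coords_upto k"
  shows "form_of_order k (dcoord c)"
  by (rule form_of_orderI) (use assms in \<open>auto simp: dcoord_def smooth_from_const\<close>)

lemma ext_d_dcoord [simp]: "ext_d (dcoord c) = 0"
  by (intro ext) (auto simp: ext_d_def dcoord_def intro!: sum.neutral)

lemma contract_dcoord: "contract v (dcoord c) = function_form (v c)"
proof -
  obtain k where k: "c \<in> coords_upto k"
    using coord_in_coords_upto by blast
  have eq: "v d p * contract1 d (dcoord c) K p = (if d = c then function_form (v c) K p else 0)" for d K p
    by (auto simp: contract1_def dcoord_def function_form_def)
  show ?thesis
    unfolding contract_eq[OF form_of_order_dcoord[OF k]] eq using k by (intro ext) simp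
qed

lemma lie_dcoord: "lie v (dcoord c) = ext_d (function_form (v c))"
  by (simp add: lie_def contract_dcoord)

subsection \<open>Differential ideals\<close>

lemma
  shows zero_in_forms: "0 \<in> forms"
    and add_in_forms: "\<alpha> \<in> forms \<Longrightarrow> \<beta> \<in> forms \<Longrightarrow> \<alpha> + \<beta> \<in> forms"
    and wedge_in_forms: "\<alpha> \<in> forms \<Longrightarrow> \<beta> \<in> forms \<Longrightarrow> \<alpha> \<and>\<^sub>w \<beta> \<in> forms"
    and ext_d_in_forms: "\<alpha> \<in> forms \<Longrightarrow> ext_d \<alpha> \<in> forms"
proof -
  show "0 \<in> forms"
    using form_of_order_0 by (auto simp: forms_iff)
  show "\<alpha> + \<beta> \<in> forms" if \<alpha>\<beta>: "\<alpha> \<in> forms" "\<beta> \<in> forms"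
  proof -
    obtain k where "form_of_order k \<alpha>" "form_of_order k \<beta>"
      using \<alpha>\<beta> by (rule forms_common_order)
    then show ?thesis
      using form_of_order_add by (auto simp: forms_iff)
  qed
  show "\<alpha> \<and>\<^sub>w \<beta> \<in> forms" if \<alpha>\<beta>: "\<alpha> \<in> forms" "\<beta> \<in> forms"
  proof -
    obtain k where "form_of_order k \<alpha>" "form_of_order k \<beta>"
      using \<alpha>\<beta> by (rule forms_common_order)
    then show ?thesis
      using form_of_order_wedge by (auto simp: forms_iff)
  qed
  show "ext_d \<alpha> \<in> forms" if "\<alpha> \<in> forms"
    using that form_of_order_ext_d by (auto simp: forms_iff)
qed

lemma function_form_in_forms: "smooth_from k F \<Longrightarrow> function_form F \<in> forms"
  using form_of_order_function_form by (auto simp: forms_iff)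

lemma dcoord_in_forms: "dcoord c \<in> forms"
  using coord_in_coords_upto[of c] form_of_order_dcoord by (auto simp: forms_iff)

lemma smult_eq_wedge_forms: "\<alpha> \<in> forms \<Longrightarrow> F \<cdot> \<alpha> = function_form F \<and>\<^sub>w \<alpha>"
  using smult_eq_wedge by (auto simp: forms_iff)

lemma smult_in_forms: "smooth_from k F \<Longrightarrow> \<alpha> \<in> forms \<Longrightarrow> F \<cdot> \<alpha> \<in> forms"
  by (simp add: smult_eq_wedge_forms wedge_in_forms function_form_in_forms)

lemma diff_in_forms: "\<alpha> \<in> forms \<Longrightarrow> \<beta> \<in> forms \<Longrightarrow> \<alpha> - \<beta> \<in> forms"
  unfolding diff_conv_add_uminus[of \<alpha>] minus_form
  by (intro add_in_forms smult_in_forms smooth_from_const)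

lemma lie_smult_forms:
  assumes v: "vector_field v" and F: "smooth_from k F" and \<alpha>: "\<alpha> \<in> forms"
  shows "lie v (F \<cdot> \<alpha>) = vapply v F \<cdot> \<alpha> + F \<cdot> lie v \<alpha>"
  unfolding smult_eq_wedge_forms[OF \<alpha>] smult_eq_wedge_forms[OF lie_in_forms[OF v \<alpha>]]
  by (simp add: lie_wedge[OF v function_form_in_forms[OF F] \<alpha>] lie_function_form)

lemma lie_diff:
  assumes v: "vector_field v" and \<alpha>: "\<alpha> \<in> forms" and \<beta>: "\<beta> \<in> forms"
  shows "lie v (\<alpha> - \<beta>) = lie v \<alpha> - lie v \<beta>"
proof -
  have "lie v ((\<lambda>p. - 1) \<cdot> \<beta>) = (\<lambda>p. - 1) \<cdot> lie v \<beta>"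
    by (simp add: lie_smult_forms[OF v smooth_from_const \<beta>])
  moreover have "(\<lambda>p. - 1) \<cdot> \<beta> \<in> forms"
    using \<beta> by (intro smult_in_forms smooth_from_const)
  ultimately show ?thesis
    unfolding diff_conv_add_uminus[of \<alpha>] diff_conv_add_uminus[of "lie v \<alpha>"] minus_form
    using lie_add[OF v \<alpha>] by simp
qed

lemma differential_ideal_forms: "differential_ideal forms"
  unfolding differential_ideal_def
  by (simp add: zero_in_forms add_in_forms wedge_in_forms ext_d_in_forms)

lemma differential_idealI:
  assumes "J \<subseteq> forms" "0 \<in> J" "\<And>\<alpha> \<beta>. \<alpha> \<in> J \<Longrightarrow> \<beta> \<in> J \<Longrightarrow> \<alpha> + \<beta> \<in> J"
    "\<And>\<alpha> \<beta>. \<alpha> \<in> J \<Longrightarrow> \<beta> \<in> forms \<Longrightarrow> \<beta> \<and>\<^sub>w \<alpha> \<in> J"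
    "\<And>\<alpha> \<beta>. \<alpha> \<in> J \<Longrightarrow> \<beta> \<in> forms \<Longrightarrow> \<alpha> \<and>\<^sub>w \<beta> \<in> J"
    "\<And>\<alpha>. \<alpha> \<in> J \<Longrightarrow> ext_d \<alpha> \<in> J"
  shows "differential_ideal J"
  unfolding differential_ideal_def by (intro conjI ballI) (simp_all add: assms)

lemma differential_idealD:
  assumes "differential_ideal J"
  shows "\<alpha> \<in> J \<Longrightarrow> \<alpha> \<in> forms" "0 \<in> J" "\<alpha> \<in> J \<Longrightarrow> \<beta> \<in> J \<Longrightarrow> \<alpha> + \<beta> \<in> J"
    "\<alpha> \<in> J \<Longrightarrow> \<beta> \<in> forms \<Longrightarrow> \<beta> \<and>\<^sub>w \<alpha> \<in> J" "\<alpha> \<in> J \<Longrightarrow> \<beta> \<in> forms \<Longrightarrow> \<alpha> \<and>\<^sub>w \<beta> \<in> J"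
    "\<alpha> \<in> J \<Longrightarrow> ext_d \<alpha> \<in> J"
proof -
  have "J \<subseteq> forms"
    using assms unfolding differential_ideal_def by (rule conjunct1)
  then show "\<alpha> \<in> J \<Longrightarrow> \<alpha> \<in> forms"
    by (rule subsetD)
qed (use assms[unfolded differential_ideal_def] in simp_all)

text \<open>The hull is the intersection of all differential ideals containing \<open>S\<close>. By
  \<open>S \<subseteq> forms\<close> the set \<open>forms\<close> is one of them, which keeps the
  intersection inside \<open>forms\<close>.\<close>

lemma differential_ideal_hull:
  assumes "S \<subseteq> forms"
  shows "differential_ideal (differential_ideal hull S)"
proof -
  let ?H = "differential_ideal hull S"
  have I: "\<gamma> \<in> ?H" if "\<And>J. differential_ideal J \<Longrightarrow> S \<subseteq> J \<Longrightarrow> \<gamma> \<in> J" for \<gamma>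
    using that by (simp add: hull_def)
  have E: "\<gamma> \<in> J" if "\<gamma> \<in> ?H" "differential_ideal J" "S \<subseteq> J" for \<gamma> J
    using that by (simp add: hull_def)
  have forms: "?H \<subseteq> forms"
    using E[OF _ differential_ideal_forms assms] by (rule subsetI)
  show ?thesis
  proof (rule differential_idealI[OF forms])
    show "0 \<in> ?H"
      by (rule I) (rule differential_idealD)
    show "\<alpha> + \<beta> \<in> ?H" if "\<alpha> \<in> ?H" "\<beta> \<in> ?H" for \<alpha> \<beta>
      by (rule I) (simp add: differential_idealD(3) E that)
    show "\<beta> \<and>\<^sub>w \<alpha> \<in> ?H" "\<alpha> \<and>\<^sub>w \<beta> \<in> ?H" if "\<alpha> \<in> ?H" "\<beta> \<in> forms" for \<alpha> \<beta>
      by (rule I, simp add: differential_idealD(4,5) E that)+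
    show "ext_d \<alpha> \<in> ?H" if "\<alpha> \<in> ?H" for \<alpha>
      by (rule I) (simp add: differential_idealD(6) E that)
  qed
qed

lemma ideal_smult:
  assumes J: "differential_ideal J" and "smooth_from k F" "\<alpha> \<in> J"
  shows "F \<cdot> \<alpha> \<in> J"
  using assms differential_idealD[OF J] by (simp add: smult_eq_wedge_forms function_form_in_forms)

lemma ideal_diff:
  assumes J: "differential_ideal J" and "\<alpha> \<in> J" "\<beta> \<in> J"
  shows "\<alpha> - \<beta> \<in> J"
  unfolding diff_conv_add_uminus[of \<alpha>] minus_form
  by (intro differential_idealD(3)[OF J] ideal_smult[OF J] smooth_from_const assms(2,3))

lemma ideal_sum:
  assumes J: "differential_ideal J" and "\<And>i. i \<in> A \<Longrightarrow> h i \<in> J"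
  shows "sum h A \<in> J"
  using assms(2)
  by (induction A rule: infinite_finite_induct) (simp_all add: differential_idealD[OF J])

text \<open>Reduces invariance of an ideal under \<open>lie v\<close> to its generators. The
  inclusion of \<open>I\<close> in \<open>J\<close> takes care of the Leibniz terms where \<alpha>
  itself stays undifferentiated.\<close>

lemma differential_ideal_lie:
  assumes v: "vector_field v" and I: "differential_ideal I" and J: "differential_ideal J" and "I \<subseteq> J"
  shows "differential_ideal {\<alpha> \<in> I. lie v \<alpha> \<in> J}"
proof -
  note I' = differential_idealD[OF I] and J' = differential_idealD[OF J]
  have IJ: "\<alpha> \<in> J" if "\<alpha> \<in> I" for \<alpha>
    using that \<open>I \<subseteq> J\<close> by auto
  have lie0: "lie v 0 = 0"
    by (simp add: lie_def)
  show ?thesis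
    unfolding differential_ideal_def
    using I' J' by (auto simp: lie0 lie_add[OF v] lie_wedge[OF v] lie_ext_d[OF v] IJ lie_in_forms[OF v])
qed

text \<open>As differentiation and multiplication by forms of positive degree raise the degree, the
  one-forms of a differential ideal without functions may be prescribed by an arbitrary
  linear condition.\<close>

lemma differential_ideal_one_forms:
  assumes zero: "\<And>p. P p (\<lambda>c. 0)"
    and add: "\<And>p x y. P p x \<Longrightarrow> P p y \<Longrightarrow> P p (\<lambda>c. x c + y c)"
    and mult: "\<And>p a x. P p x \<Longrightarrow> P p (\<lambda>c. a * x c)"
  shows "differential_ideal {\<alpha> \<in> forms. \<alpha> {} = 0 \<and> (\<forall>p. P p (\<lambda>c. \<alpha> {c} p))}"
proof -
  have w0: "(\<alpha> \<and>\<^sub>w \<beta>) {} p = \<alpha> {} p * \<beta> {} p" for \<alpha> \<beta> p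
    by (simp add: wedge_def)
  have w1: "(\<alpha> \<and>\<^sub>w \<beta>) {c} p = \<alpha> {} p * \<beta> {c} p + \<alpha> {c} p * \<beta> {} p" for \<alpha> \<beta> c p
    using sum_Pow_insert[of "{}" c "\<lambda>I. wsign I ({c} - I) * \<alpha> I p * \<beta> ({c} - I) p"]
    by (simp add: wedge_def)
  have d0: "ext_d \<alpha> {} = 0" for \<alpha>
    by (intro ext) (simp add: ext_d_def)
  have d1: "ext_d \<alpha> {c} p = 0" if "\<alpha> {} = 0" for \<alpha> c p
    using that by (simp add: ext_d_def)
  show ?thesis
    unfolding differential_ideal_def
  proof (intro conjI ballI, goal_cases)
    case 1
    show ?case by auto
  next
    case 2
    show ?case using zero by (simp add: zero_in_forms)
  next
    case (3 \<alpha> \<beta>)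
    then show ?case
      using add by (simp add: add_in_forms)
  next
    case (4 \<alpha> \<beta>)
    have "(\<beta> \<and>\<^sub>w \<alpha>) {} = 0"
      using 4 by (intro ext) (simp add: w0)
    then show ?case
      using 4 by (simp add: wedge_in_forms w1 mult)
  next
    case (5 \<alpha> \<beta>)
    have "(\<alpha> \<and>\<^sub>w \<beta>) {} = 0"
      using 5 by (intro ext) (simp add: w0)
    then show ?case
      using 5 mult by (simp add: wedge_in_forms w1 mult.commute[of _ "\<beta> {} _"])
  next
    case (6 \<alpha>)
    then show ?case
      using zero by (simp add: ext_d_in_forms d0 d1)
  qed
qed

section \<open>The exterior differential system\<close>

lemma sum_form_apply: "sum h A I p = (\<Sum>i\<in>A. h i I p)" for h :: "'a \<Rightarrow> form"
  by (induction A rule: infinite_finite_induct) simp_all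

section \<open>Conjugation and wedge products of coordinate forms\<close>

lemma coord_fun_bar: "(\<lambda>p. cnj (coord_fun c p)) = coord_fun (bar c)"
proof
  fix p
  show "cnj (coord_fun c p) = coord_fun (bar c) p"
    by (cases p; cases c) auto
qed

lemma cnj_coord_fun [simp]: "cnj (coord_fun c p) = coord_fun (bar c) p"
  using coord_fun_bar[THEN fun_cong] .

lemma cnj_form_add: "cnj_form (\<alpha> + \<beta>) = cnj_form \<alpha> + cnj_form \<beta>"
  by (intro ext) (simp add: cnj_form_def distrib_left)

lemma cnj_form_diff: "cnj_form (\<alpha> - \<beta>) = cnj_form \<alpha> - cnj_form \<beta>"
  by (intro ext) (simp add: cnj_form_def right_diff_distrib)

lemma cnj_form_smult: "cnj_form (F \<cdot> \<alpha>) = (\<lambda>p. cnj (F p)) \<cdot> cnj_form \<alpha>"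
  by (intro ext) (simp add: cnj_form_def smult_def)

lemma bar_image_iff: "bar ` I = J \<longleftrightarrow> I = bar ` J"
  by (auto simp: image_image)

lemma cnj_form_dcoord [simp]: "cnj_form (dcoord c) = dcoord (bar c)"
proof (intro ext)
  fix I p
  show "cnj_form (dcoord c) I p = dcoord (bar c) I p"
  proof (cases "I = {bar c}")
    case True
    have empty: "{(a, b). a \<in> {bar c} \<and> b \<in> {bar c} \<and> crank a < crank b \<and> crank (bar b) < crank (bar a)} = {}"
      by auto
    then show ?thesis
      unfolding True cnj_form_def empty by (simp add: dcoord_def)
  next
    case False
    then have "bar ` I \<noteq> {c}"
      by (simp add: bar_image_iff)
    then show ?thesis
      using False by (simp add: cnj_form_def dcoord_def)
  qed
qed

lemma wedge_dcoord:
  assumes "a \<noteq> b"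
  shows "(dcoord a \<and>\<^sub>w dcoord b) K p = (if K = {a, b} then wsign {a} {b} else 0)"
proof (cases "finite K")
  case True
  have "(dcoord a \<and>\<^sub>w dcoord b) K p = (\<Sum>I\<in>Pow K. if I = {a} then wsign {a} (K - {a}) * dcoord b (K - {a}) p else 0)"
    unfolding wedge_def by (intro sum.cong refl) (simp add: dcoord_def)
  also have "\<dots> = (if a \<in> K then wsign {a} (K - {a}) * dcoord b (K - {a}) p else 0)"
    using True by simp
  also have "\<dots> = (if K = {a, b} then wsign {a} {b} else 0)"
  proof (cases "K = {a, b}")
    case True
    then have "K - {a} = {b}"
      using assms by auto
    then show ?thesis
      using True by (simp add: dcoord_def)
  next
    case False
    then have "a \<in> K \<Longrightarrow> K - {a} \<noteq> {b}"
      by auto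
    then show ?thesis
      using False by (simp add: dcoord_def)
  qed
  finally show ?thesis .
next
  case False
  then show ?thesis
    by (auto simp: wedge_infinite)
qed

lemma wedge_dcoord_self [simp]: "dcoord a \<and>\<^sub>w dcoord a = 0"
proof (intro ext)
  fix K p
  have "wsign I (K - I) * dcoord a I p * dcoord a (K - I) p = 0" for I
    by (cases "I = {a}") (auto simp: dcoord_def)
  then show "(dcoord a \<and>\<^sub>w dcoord a) K p = 0 K p"
    unfolding wedge_def by (simp only: sum.neutral_const zero_fun_apply)
qed

lemma wsign_singleton: "wsign {a} {b} = (if crank b < crank a then - 1 else 1)"
proof -
  have eq: "{(x, y). x \<in> {a} \<and> y \<in> {b} \<and> crank y < crank x} = (if crank b < crank a then {(a, b)} else {})"
    by auto
  show ?thesis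
    unfolding wsign_def eq by simp
qed

lemma wedge_dcoord_swap: "dcoord a \<and>\<^sub>w dcoord b = - (dcoord b \<and>\<^sub>w dcoord a)"
proof (cases "a = b")
  case False
  then have "wsign {a} {b} = - wsign {b} {a}"
    using crank_eq_iff[of a b] by (cases "crank a < crank b") (auto simp: wsign_singleton)
  then show ?thesis
    using False by (intro ext) (simp add: wedge_dcoord insert_commute)
qed simp

text \<open>The two products that occur in \<psi>. Conjugation preserves the order of the factors in
  the one, whereas in the other it exchanges \<open>Z\<close> and \<open>Zbar\<close>, which gives a
  single inversion.\<close>

lemma cnj_form_wedge_zeta:
  "cnj_form (dcoord Z \<and>\<^sub>w dcoord (Ui 0)) = dcoord Zbar \<and>\<^sub>w dcoord (Uibar 0)"
  "cnj_form (dcoord Z \<and>\<^sub>w dcoord Zbar) = dcoord Zbar \<and>\<^sub>w dcoord Z"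
proof -
  have 1: "{(a, b). a \<in> {Zbar, Uibar 0} \<and> b \<in> {Zbar, Uibar 0} \<and> crank a < crank b \<and> crank (bar b) < crank (bar a)} = {}"
    by auto
  have 2: "{(a, b). a \<in> {Z, Zbar} \<and> b \<in> {Z, Zbar} \<and> crank a < crank b \<and> crank (bar b) < crank (bar a)} = {(Z, Zbar)}"
    by auto
  have zz: "{Zbar, Z} = {Z, Zbar}"
    by auto
  show "cnj_form (dcoord Z \<and>\<^sub>w dcoord (Ui 0)) = dcoord Zbar \<and>\<^sub>w dcoord (Uibar 0)"
  proof (intro ext)
    fix K p
    show "cnj_form (dcoord Z \<and>\<^sub>w dcoord (Ui 0)) K p = (dcoord Zbar \<and>\<^sub>w dcoord (Uibar 0)) K p"
    proof (cases "K = {Zbar, Uibar 0}")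
      case True
      show ?thesis
        unfolding True cnj_form_def 1 by (simp add: wedge_dcoord wsign_singleton)
    next
      case False
      then have "bar ` K \<noteq> {Z, Ui 0}"
        by (simp add: bar_image_iff)
      then show ?thesis
        using False by (simp add: cnj_form_def wedge_dcoord)
    qed
  qed
  show "cnj_form (dcoord Z \<and>\<^sub>w dcoord Zbar) = dcoord Zbar \<and>\<^sub>w dcoord Z"
  proof (intro ext)
    fix K p
    show "cnj_form (dcoord Z \<and>\<^sub>w dcoord Zbar) K p = (dcoord Zbar \<and>\<^sub>w dcoord Z) K p"
    proof (cases "K = {Z, Zbar}")
      case True
      show ?thesis
        unfolding True cnj_form_def 2 by (simp add: wedge_dcoord wsign_singleton zz)
    next
      case False
      then have "bar ` K \<noteq> {Z, Zbar}"
        by (simp add: bar_image_iff zz)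
      then show ?thesis
        using False by (simp add: cnj_form_def wedge_dcoord zz)
    qed
  qed
qed

section \<open>Evaluation of one-forms on vector fields\<close>

lemma pairing_eq: "pairing \<alpha> v = (\<lambda>p. Sum_any (\<lambda>c. v c p * \<alpha> {c} p))"
  by (simp add: pairing_def contract_def)

lemma pairing_dcoord: "pairing (dcoord c) v = v c"
  by (simp add: pairing_def contract_dcoord function_form_def)

lemma pairing_add:
  assumes "\<alpha> \<in> forms" "\<beta> \<in> forms"
  shows "pairing (\<alpha> + \<beta>) v = (\<lambda>p. pairing \<alpha> v p + pairing \<beta> v p)"
proof -
  obtain k where "form_of_order k \<alpha>" "form_of_order k \<beta>"
    using assms by (rule forms_common_order)
  then show ?thesis
    unfolding pairing_def by (intro ext) (simp add: contract_add)
qed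

lemma pairing_smult:
  assumes "\<alpha> \<in> forms"
  shows "pairing (F \<cdot> \<alpha>) v = (\<lambda>p. F p * pairing \<alpha> v p)"
proof
  fix p
  obtain k where k: "form_of_order k \<alpha>"
    using assms by (auto simp: forms_iff)
  have "pairing (F \<cdot> \<alpha>) v p = (\<Sum>c\<in>coords_upto k. v c p * (F \<cdot> \<alpha>) {c} p)"
    unfolding pairing_eq
    by (rule Sum_any.expand_superset) (auto simp: smult_def form_of_order_eq_0[OF k] elim: contrapos_np)
  then show "pairing (F \<cdot> \<alpha>) v p = F p * pairing \<alpha> v p"
    unfolding pairing_def contract_eq[OF k]
    by (simp add: contract1_def smult_def sum_distrib_left mult_ac)
qed

lemma pairing_diff:
  assumes "\<alpha> \<in> forms" "\<beta> \<in> forms"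
  shows "pairing (\<alpha> - \<beta>) v = (\<lambda>p. pairing \<alpha> v p - pairing \<beta> v p)"
proof -
  have "(\<lambda>p. - 1) \<cdot> \<beta> \<in> forms"
    using assms(2) by (intro smult_in_forms smooth_from_const)
  then show ?thesis
    unfolding diff_conv_add_uminus[of \<alpha>] minus_form
    by (simp add: pairing_add assms pairing_smult)
qed

lemma pairing_ext_d_function_form: "pairing (ext_d (function_form F)) v = vapply v F"
  by (simp add: pairing_eq ext_d_function_form_singleton vapply_def)

lemma ext_d_smult_dcoord:
  assumes "smooth_from k F"
  shows "ext_d (F \<cdot> dcoord c) = ext_d (function_form F) \<and>\<^sub>w dcoord c"
proof -
  obtain l where l: "form_of_order l (dcoord c)"
    using dcoord_in_forms by (auto simp: forms_iff)
  have "ext_d (F \<cdot> dcoord c) = ext_d (function_form F) \<and>\<^sub>w dcoord c + F \<cdot> ext_d (dcoord c)"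
    by (rule ext_d_smult[where k = "max k l"])
      (auto intro: smooth_from_mono[OF assms] form_of_order_mono[OF l])
  then show ?thesis by simp
qed

lemma ext_d_coord_fun: "ext_d (function_form (coord_fun c)) = dcoord c"
proof (intro ext)
  fix I p
  show "ext_d (function_form (coord_fun c)) I p = dcoord c I p"
  proof (cases "\<exists>d. I = {d}")
    case True
    then obtain d where "I = {d}"
      by blast
    then show ?thesis
      by (simp add: ext_d_function_form_singleton partial_coord_fun dcoord_def)
  next
    case False
    then have "I \<noteq> {c}"
      by blast
    then show ?thesis
      by (simp add: ext_d_function_form_eq_0[OF False] dcoord_def)
  qed
qed

lemma ext_d_diff:
  assumes "\<alpha> \<in> forms" "\<beta> \<in> forms"
  shows "ext_d (\<alpha> - \<beta>) = ext_d \<alpha> - ext_d \<beta>"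
proof -
  obtain k where k: "form_of_order k \<alpha>" "form_of_order k \<beta>"
    using assms by (rule forms_common_order)
  have m: "form_of_order k ((\<lambda>p. - 1) \<cdot> \<beta>)"
    using k by (intro form_of_order_smult smooth_from_const)
  have "ext_d (\<alpha> - \<beta>) = ext_d \<alpha> + ext_d ((\<lambda>p. - 1) \<cdot> \<beta>)"
    unfolding diff_conv_add_uminus[of \<alpha>] minus_form using ext_d_add[OF k(1) m] .
  also have "ext_d ((\<lambda>p. - 1) \<cdot> \<beta>) = - ext_d \<beta>"
    by (intro ext) (simp add: ext_d_def smult_def partial_minus[OF form_of_order_smooth[OF k(2)]] sum_negf)
  finally show ?thesis
    by (simp only: diff_conv_add_uminus)
qed

lemma smooth_from_coord_Ui: "i \<le> k \<Longrightarrow> smooth_from k (coord_fun (Ui i))"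
  by (auto intro!: smooth_from_coord_fun simp: coords_upto_def)

declare partial.simps [simp del]

section \<open>The functions \<open>T f i\<close> and the total derivatives\<close>

locale smooth_system =
  fixes f :: "real \<Rightarrow> real"
  assumes smooth_f: "smooth_real f"
begin

abbreviation "e \<equiv> e_minus1 f"
abbreviation "ebar \<equiv> cnj_vfield (e_minus1 f)"

lemma smooth_from_T: "smooth_from i (T f i)"
proof (induction i rule: less_induct)
  case (less i)
  show ?case
  proof (cases i)
    case 0
    then show ?thesis
      using smooth_from_function_of_u[OF smooth_f] by simp
  next
    case (Suc n)
    have "smooth_from i (coord_fun (Ui (n - j)))" "smooth_from i (T f j)" if "j \<le> n" for j
      using less[of j] that Suc by (auto intro: smooth_from_coord_Ui smooth_from_mono)
    then show ?thesis
      unfolding Suc T.simps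
      by (intro smooth_from_sum smooth_from_mult smooth_from_const smooth_from_partial) auto
  qed
qed

lemma T_real: "cnj (T f 0 p) = T f 0 p"
  by (cases p) simp

lemma partial_T_0: "c \<noteq> U \<Longrightarrow> partial c (T f 0) = (\<lambda>p. 0)"
proof -
  assume "c \<noteq> U"
  have "f field_differentiable (at x)" for x
    using smooth_f[unfolded smooth_real_def, rule_format, of 0 x] by simp
  then show ?thesis
    using \<open>c \<noteq> U\<close> by (cases c) (simp_all add: partial.simps rpartial_function_of_u(1))
qed

text \<open>\<open>T f i\<close> is a polynomial in the \<open>u_j\<close> with coefficients
  depending on \<open>u\<close> alone. The absence of conjugate coordinates is what later allows
  \<open>e\<close> to be interchanged with \<open>partial U\<close> and with \<open>v\<close> on
  these functions.\<close>

lemma partial_T: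
  assumes "c = Z \<or> c = Zbar \<or> c = Uibar j"
  shows "partial c (T f i) = (\<lambda>p. 0)"
proof (induction i rule: less_induct)
  case (less i)
  show ?case
  proof (cases i)
    case 0
    then show ?thesis
      using partial_T_0[of c] assms by auto
  next
    case (Suc n)
    have sm: "smooth_from i (coord_fun (Ui (n - j)))" "smooth_from i (partial U (T f j))" if "j \<le> n" for j
      using that Suc by (auto intro: smooth_from_coord_Ui smooth_from_mono[OF smooth_from_partial[OF smooth_from_T]])
    have "partial c (T f i) =
        (\<lambda>p. \<Sum>j\<le>n. partial c (\<lambda>p. of_nat (n choose j) * coord_fun (Ui (n - j)) p * partial U (T f j) p) p)"
      unfolding Suc T.simps using sm unfolding Suc
      by (intro partial_sum[where k = "Suc n"] smooth_from_mult smooth_from_const) auto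
    moreover have "partial c (\<lambda>p. of_nat (n choose j) * coord_fun (Ui (n - j)) p * partial U (T f j) p) = (\<lambda>p. 0)"
      if "j \<le> n" for j
    proof -
      have "partial c (partial U (T f j)) = (\<lambda>p. 0)"
        using partial_commute[OF smooth_from_T, of c U j] less[of j] that Suc by simp
      moreover have "partial c (coord_fun (Ui (n - j))) = (\<lambda>p. 0)"
        using assms by (auto simp: partial_coord_fun)
      ultimately show ?thesis
        using that
        by (simp add: mult.assoc partial_cmult[OF smooth_from_mult[OF sm(1,2)]] partial_mult[OF sm(1,2)])
    qed
    ultimately show ?thesis
      by simp
  qed
qed

lemma smooth_from_e: "c \<in> coords_upto k \<Longrightarrow> smooth_from (Suc k) (e c)"
  by (cases c)
    (auto simp: coords_upto_def
      intro!: smooth_from_const smooth_from_minus smooth_from_cnj smooth_from_mono[OF smooth_from_T]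
        smooth_from_coord_Ui)

lemma vector_field_e: "vector_field e"
  unfolding vector_field_def smooth_def
  using coord_in_coords_upto smooth_from_e by blast

lemma cnj_vfield_smooth_from: "smooth_from k (v (bar c)) \<Longrightarrow> smooth_from k (cnj_vfield v c)"
  unfolding cnj_vfield_def by (rule smooth_from_cnj)

lemma vector_field_ebar: "vector_field ebar"
  using vector_field_e cnj_vfield_smooth_from unfolding vector_field_def smooth_def by blast

lemma ebar_simps [simp]:
  "ebar Z = (\<lambda>p. 0)" "ebar Zbar = (\<lambda>p. 1)" "ebar U = coord_fun (Uibar 0)"
  "ebar (Ui i) = (\<lambda>p. - T f i p)" "ebar (Uibar i) = coord_fun (Uibar (Suc i))"
  by (simp_all add: cnj_vfield_def)

lemma smooth_from_vapply_e: "smooth_from k F \<Longrightarrow> smooth_from (Suc k) (vapply e F)"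
  by (rule smooth_from_vapply) (auto intro: smooth_from_e)

lemma vapply_e_partial:
  assumes F: "smooth_from k F"
    and "\<And>c. c \<in> coords_upto k \<Longrightarrow> partial c F = (\<lambda>p. 0) \<or> partial d (e c) = (\<lambda>p. 0)"
  shows "vapply e (partial d F) = partial d (vapply e F)"
proof -
  \<comment> \<open>The coordinate field of \<open>d\<close>, so that the commutator lemma for
    vector fields applies to a partial derivative.\<close>
  define X :: vfield where "X = (\<lambda>c p. if c = d then 1 else 0)"
  have X: "vapply X G = partial d G" for G
  proof
    fix p
    have "(\<Sum>c. X c p * partial c G p) = (\<Sum>c\<in>{d}. X c p * partial c G p)"
      by (rule Sum_any.expand_superset) (auto simp: X_def)
    then show "vapply X G p = partial d G p"
      by (simp add: vapply_def X_def)
  qed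
  have "vector_field X"
    unfolding vector_field_def X_def by (auto intro: smooth_from_imp_smooth smooth_from_const)
  moreover have "vapply e (X c) = (\<lambda>p. 0)" for c
    by (simp add: X_def)
  then have "partial c F = (\<lambda>p. 0) \<or> vapply e (X c) = vapply X (e c)" if "c \<in> coords_upto k" for c
    using assms(2)[OF that] by (simp add: X eq_commute)
  ultimately have "vapply e (vapply X F) = vapply X (vapply e F)"
    by (intro vapply_commute[OF F vector_field_e])
  then show ?thesis
    by (simp add: X)
qed

text \<open>The only coefficients of \<open>e\<close> that depend on \<open>u\<close> are those in
  the directions \<open>Uibar i\<close>, and \<open>T f j\<close> does not see these
  directions.\<close>

lemma vapply_e_partial_U_T: "vapply e (partial U (T f j)) = partial U (vapply e (T f j))"
proof (rule vapply_e_partial[OF smooth_from_T])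
  show "partial c (T f j) = (\<lambda>p. 0) \<or> partial U (e c) = (\<lambda>p. 0)" for c
    by (cases c) (simp_all add: partial_T partial_coord_fun)
qed

text \<open>Pascal's rule in the shape in which a further derivative acts on the binomial sum
  defining \<open>T\<close>.\<close>

lemma sum_choose_Suc:
  fixes h :: "nat \<Rightarrow> complex"
  shows "(\<Sum>j\<le>Suc n. of_nat (Suc n choose j) * h j) =
    (\<Sum>j\<le>n. of_nat (n choose j) * h j) + (\<Sum>j\<le>n. of_nat (n choose j) * h (Suc j))"
proof -
  have "(\<Sum>j\<le>n. of_nat (n choose j) * h j) = (\<Sum>j\<le>Suc n. of_nat (n choose j) * h j)"
    by simp
  also have "\<dots> = h 0 + (\<Sum>j\<le>n. of_nat (n choose Suc j) * h (Suc j))"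
    by (subst sum.atMost_Suc_shift) simp
  finally show ?thesis
    by (subst sum.atMost_Suc_shift) (simp add: sum.distrib algebra_simps)
qed

text \<open>The defining recursion is the Leibniz formula for the \<open>i\<close>-fold total
  derivative of \<open>u_0 * f_u\<close>: differentiating \<open>u_0\<close> repeatedly yields
  \<open>u_(i-j)\<close>, and by induction \<open>f_u\<close> yields the \<open>u\<close>-derivative
  of \<open>T f j\<close>.\<close>

lemma vapply_e_T: "vapply e (T f i) = T f (Suc i)"
proof (induction i rule: less_induct)
  case (less i)
  show ?case
  proof (cases i)
    case 0
    show ?thesis
      unfolding 0 vapply_eq[OF smooth_from_T] sum_coords_upto
      by (simp add: partial_T_0 del: T.simps(1))
  next
    case (Suc n)
    have sm: "smooth_from i (coord_fun (Ui (n - j)))" "smooth_from i (partial U (T f j))" if "j \<le> n" for j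
      using that Suc by (auto intro: smooth_from_coord_Ui smooth_from_mono[OF smooth_from_partial[OF smooth_from_T]])
    have "vapply e (T f i) =
        (\<lambda>p. \<Sum>j\<le>n. vapply e (\<lambda>p. of_nat (n choose j) * (coord_fun (Ui (n - j)) p * partial U (T f j) p)) p)"
      unfolding Suc T.simps mult.assoc using sm unfolding Suc
      by (intro vapply_sum[where k = "Suc n"] smooth_from_mult smooth_from_const) auto
    \<comment> \<open>\<open>Suc n - Suc j\<close> is kept for \<open>n - j\<close> so that the
      second sum is visibly the first one with \<open>j\<close> replaced by \<open>Suc j\<close>, as
      \<open>sum_choose_Suc\<close> expects.\<close>
    also have "\<dots> = (\<lambda>p. (\<Sum>j\<le>n. of_nat (n choose j) * (coord_fun (Ui (Suc n - j)) p * partial U (T f j) p))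
        + (\<Sum>j\<le>n. of_nat (n choose j) * (coord_fun (Ui (Suc n - Suc j)) p * partial U (T f (Suc j)) p)))"
    proof
      fix p
      have "vapply e (\<lambda>p. of_nat (n choose j) * (coord_fun (Ui (n - j)) p * partial U (T f j) p)) p =
          of_nat (n choose j) * (coord_fun (Ui (Suc n - j)) p * partial U (T f j) p)
          + of_nat (n choose j) * (coord_fun (Ui (Suc n - Suc j)) p * partial U (T f (Suc j)) p)"
        if "j \<le> n" for j
      proof -
        have "vapply e (partial U (T f j)) = partial U (T f (Suc j))"
          using vapply_e_partial_U_T[of j] less[of j] that Suc by simp
        then show ?thesis
          using that
          by (simp add: vapply_mult[OF smooth_from_const smooth_from_mult[OF sm(1,2)]] vapply_mult[OF sm(1,2)]
              vapply_coord_fun Suc_diff_le algebra_simps)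
      qed
      then show "(\<Sum>j\<le>n. vapply e (\<lambda>p. of_nat (n choose j) * (coord_fun (Ui (n - j)) p * partial U (T f j) p)) p) =
        (\<Sum>j\<le>n. of_nat (n choose j) * (coord_fun (Ui (Suc n - j)) p * partial U (T f j) p))
        + (\<Sum>j\<le>n. of_nat (n choose j) * (coord_fun (Ui (Suc n - Suc j)) p * partial U (T f (Suc j)) p))"
        unfolding sum.distrib[symmetric] by (intro sum.cong refl) (simp only: atMost_iff)
    qed
    also have "\<dots> = T f (Suc i)"
      unfolding Suc T.simps(2) mult.assoc
        sum_choose_Suc[of n "\<lambda>j. coord_fun (Ui (Suc n - j)) p * partial U (T f j) p" for p] ..
    finally show ?thesis .
  qed
qed

text \<open>Stated for a conjugate pair of fields, so that it covers both \<open>e\<close> with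
  \<open>ebar\<close> and a real field paired with itself.\<close>

lemma vapply_cnj_T:
  assumes "cnj_vfield w = v"
  shows "vapply v (\<lambda>p. cnj (T f i p)) = (\<lambda>p. cnj (vapply w (T f i) p))"
  using vapply_cnj[OF smooth_from_T, of w] assms by simp

lemma cnj_vfield_cnj_vfield [simp]: "cnj_vfield (cnj_vfield v) = v"
  by (simp add: cnj_vfield_def)

text \<open>Compatibility of the two total derivatives. In the direction \<open>U\<close> it holds
  because \<open>f\<close> is real, in the directions \<open>Ui i\<close> because
  \<open>T f (Suc i)\<close> is the total derivative of \<open>T f i\<close>; the remaining
  directions are conjugate or trivial.\<close>

lemma vapply_e_ebar_commute:
  assumes F: "smooth_from k F"
  shows "vapply ebar (vapply e F) = vapply e (vapply ebar F)"
proof (rule vapply_commute[OF F vector_field_ebar vector_field_e])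
  fix c
  have "vapply ebar (e c) = vapply e (ebar c)"
  proof (cases c)
    case U
    then show ?thesis
      by (simp add: vapply_coord_fun T_real del: T.simps)
  next
    case (Ui i)
    then show ?thesis
      by (simp add: vapply_coord_fun vapply_minus[OF smooth_from_T] vapply_e_T del: T.simps)
  next
    case (Uibar i)
    then show ?thesis
      by (simp add: vapply_coord_fun vapply_minus[OF smooth_from_cnj[OF smooth_from_T]] vapply_e_T
          vapply_cnj_T[of e] del: T.simps)
  qed simp_all
  then show "partial c F = (\<lambda>p. 0) \<or> vapply ebar (e c) = vapply e (ebar c)" ..
qed

subsection \<open>The contact forms\<close>

definition etabar :: "nat \<Rightarrow> form" where
  "etabar i = cnj_form (eta f i)"

lemma eta_Suc: "eta f (Suc i) = dcoord (Ui i) + T f i \<cdot> dcoord Zbar - coord_fun (Ui (Suc i)) \<cdot> dcoord Z"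
  by (simp add: omega_Suc_def del: T.simps)

lemma eta_0: "eta f 0 = dcoord U - coord_fun (Ui 0) \<cdot> dcoord Z - coord_fun (Uibar 0) \<cdot> dcoord Zbar"
  by simp

lemma etabar_Suc: "etabar (Suc i) =
    dcoord (Uibar i) + (\<lambda>p. cnj (T f i p)) \<cdot> dcoord Z - coord_fun (Uibar (Suc i)) \<cdot> dcoord Zbar"
  by (simp add: etabar_def eta_Suc cnj_form_add cnj_form_diff cnj_form_smult coord_fun_bar del: eta.simps T.simps)

declare eta.simps [simp del] T.simps [simp del]

lemma smult_dcoord_in_forms:
  "smooth F \<Longrightarrow> F \<cdot> dcoord c \<in> forms"
  unfolding smooth_def using smult_in_forms dcoord_in_forms by blast

lemma smooth_coord_fun: "smooth (coord_fun c)"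
  using coord_in_coords_upto smooth_from_coord_fun unfolding smooth_def by blast

lemma smooth_T: "smooth (T f i)" "smooth (\<lambda>p. cnj (T f i p))"
  unfolding smooth_def using smooth_from_T smooth_from_cnj by blast+

lemma eta_in_forms: "eta f i \<in> forms"
  by (cases i)
    (auto simp: eta_0 eta_Suc
      intro!: diff_in_forms add_in_forms dcoord_in_forms smult_dcoord_in_forms smooth_coord_fun smooth_T)

lemma etabar_Suc_in_forms: "etabar (Suc i) \<in> forms"
  by (auto simp: etabar_Suc
      intro!: diff_in_forms add_in_forms dcoord_in_forms smult_dcoord_in_forms smooth_coord_fun smooth_T)

lemma lie_smult_dcoord:
  assumes v: "vector_field v" and "smooth F"
  shows "lie v (F \<cdot> dcoord c) = vapply v F \<cdot> dcoord c + F \<cdot> ext_d (function_form (v c))"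
  using assms(2) lie_smult_forms[OF v _ dcoord_in_forms] unfolding smooth_def by (auto simp: lie_dcoord)

lemma ext_d_function_form_const [simp]: "ext_d (function_form (\<lambda>p. a)) = 0"
  by (intro ext) (simp add: ext_d_function_form cong: if_cong)

lemma lie_eta:
  assumes v: "vector_field v" and z: "v Z = (\<lambda>p. 0)" "v Zbar = (\<lambda>p. 0)"
  shows "lie v (eta f 0) = ext_d (function_form (v U)) - v (Ui 0) \<cdot> dcoord Z - v (Uibar 0) \<cdot> dcoord Zbar"
    and "lie v (eta f (Suc i)) =
      ext_d (function_form (v (Ui i))) + vapply v (T f i) \<cdot> dcoord Zbar - v (Ui (Suc i)) \<cdot> dcoord Z"
    and "lie v (etabar (Suc i)) =
      ext_d (function_form (v (Uibar i))) + vapply v (\<lambda>p. cnj (T f i p)) \<cdot> dcoord Z - v (Uibar (Suc i)) \<cdot> dcoord Zbar"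
  unfolding eta_0 eta_Suc etabar_Suc
  by (simp_all add: lie_diff[OF v] lie_add[OF v] lie_smult_dcoord[OF v] lie_dcoord z vapply_coord_fun
      diff_in_forms add_in_forms dcoord_in_forms smult_dcoord_in_forms smooth_coord_fun smooth_T)

lemma pairing_eta:
  "pairing (eta f 0) w = (\<lambda>p. w U p - coord_fun (Ui 0) p * w Z p - coord_fun (Uibar 0) p * w Zbar p)"
  "pairing (eta f (Suc i)) w = (\<lambda>p. w (Ui i) p + T f i p * w Zbar p - coord_fun (Ui (Suc i)) p * w Z p)"
  "pairing (etabar (Suc i)) w = (\<lambda>p. w (Uibar i) p + cnj (T f i p) * w Z p - coord_fun (Uibar (Suc i)) p * w Zbar p)"
  unfolding eta_0 eta_Suc etabar_Suc
  by (simp_all add: pairing_diff pairing_add pairing_smult pairing_dcoord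
      diff_in_forms add_in_forms dcoord_in_forms smult_dcoord_in_forms smooth_coord_fun smooth_T)

text \<open>Modulo the contact forms, \<open>dF\<close> is \<open>e\<^sub>-\<^sub>1(F) \<zeta>\<close> plus the analogous term in the conjugate of \<open>\<zeta>\<close>.\<close>

lemma ext_d_function_form_contact:
  assumes F: "smooth_from k F"
  shows "ext_d (function_form F) - vapply e F \<cdot> dcoord Z - vapply ebar F \<cdot> dcoord Zbar =
    partial U F \<cdot> eta f 0 + (\<Sum>i\<le>k. partial (Ui i) F \<cdot> eta f (Suc i))
      + (\<Sum>i\<le>k. partial (Uibar i) F \<cdot> etabar (Suc i))"
proof (intro ext)
  fix I p
  have "partial c F p = 0" if "c \<notin> coords_upto k" for c
    using partial_eq_0[OF smooth_from_pulled_back[OF F] that] by simp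
  then have out: "partial (Ui i) F p = 0" "partial (Uibar i) F p = 0" if "\<not> i \<le> k" for i
    using that by (auto simp: coords_upto_def)
  show "(ext_d (function_form F) - vapply e F \<cdot> dcoord Z - vapply ebar F \<cdot> dcoord Zbar) I p =
    (partial U F \<cdot> eta f 0 + (\<Sum>i\<le>k. partial (Ui i) F \<cdot> eta f (Suc i))
      + (\<Sum>i\<le>k. partial (Uibar i) F \<cdot> etabar (Suc i))) I p"
  proof (cases "\<exists>c. I = {c}")
    case True
    then obtain c where I: "I = {c}"
      by blast
    show ?thesis
      unfolding I
      by (cases c)
        (simp_all add: ext_d_function_form_singleton smult_def dcoord_def sum_form_apply eta_0 eta_Suc etabar_Suc
          vapply_eq[OF F] sum_coords_upto out if_distrib[of "\<lambda>x. _ * x"] sum.distrib sum_subtractf sum_negf algebra_simps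
          cong: if_cong)
  next
    case False
    then have "I \<noteq> {c}" for c
      by blast
    then show ?thesis
      by (simp add: ext_d_function_form_eq_0[OF False] smult_def dcoord_def sum_form_apply eta_0 eta_Suc etabar_Suc)
  qed
qed

text \<open>Structure equations, to be solved for the first term: they exhibit \<zeta> \<and>
  \<eta>_2 and its conjugate as elements of \<open>eds_ideal f 1\<close>, although \<eta>_2 itself
  does not belong to that ideal.\<close>

lemma ext_d_eta_1:
  "ext_d (eta f (Suc 0)) = dcoord Z \<and>\<^sub>w eta f (Suc (Suc 0)) + partial U (T f 0) \<cdot> (eta f 0 \<and>\<^sub>w dcoord Zbar)"
  "ext_d (etabar (Suc 0)) = dcoord Zbar \<and>\<^sub>w etabar (Suc (Suc 0)) + partial U (T f 0) \<cdot> (eta f 0 \<and>\<^sub>w dcoord Z)"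
proof -
  have dT: "ext_d (function_form (T f 0)) = partial U (T f 0) \<cdot> dcoord U"
  proof (intro ext)
    fix I p
    show "ext_d (function_form (T f 0)) I p = (partial U (T f 0) \<cdot> dcoord U) I p"
    proof (cases "\<exists>c. I = {c}")
      case True
      then obtain c where I: "I = {c}"
        by blast
      show ?thesis
        unfolding I using partial_T_0[of c]
        by (cases "c = U") (simp_all add: ext_d_function_form_singleton smult_def dcoord_def)
    next
      case False
      then have "I \<noteq> {U}"
        by blast
      then show ?thesis
        by (simp add: ext_d_function_form_eq_0[OF False] smult_def dcoord_def)
    qed
  qed
  have T1: "T f (Suc 0) = (\<lambda>p. coord_fun (Ui 0) p * partial U (T f 0) p)"
    by (simp add: T.simps(2))
  have real: "(\<lambda>p. cnj (T f 0 p)) = T f 0"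
    by (simp add: T_real)
  \<comment> \<open>Since \<open>f\<close> is real, so is \<open>f_u\<close>, and the same
    coefficient appears in both structure equations.\<close>
  have "partial U (T f 0) = (\<lambda>p. cnj (partial U (T f 0) p))"
    using partial_cnj[OF smooth_from_T, of U 0] unfolding real by simp
  then have "cnj (partial U (T f 0) p) = partial U (T f 0) p" for p
    by (rule fun_cong[symmetric])
  then have T1bar: "(\<lambda>p. cnj (T f (Suc 0) p)) = (\<lambda>p. coord_fun (Uibar 0) p * partial U (T f 0) p)"
    unfolding T1 by simp
  have dsm: "ext_d (coord_fun c \<cdot> dcoord d) = dcoord c \<and>\<^sub>w dcoord d" for c d
    using smooth_coord_fun[of c] ext_d_smult_dcoord unfolding smooth_def by (auto simp: ext_d_coord_fun)
  have dTs: "ext_d (T f 0 \<cdot> dcoord d) = (partial U (T f 0) \<cdot> dcoord U) \<and>\<^sub>w dcoord d" for d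
    using ext_d_smult_dcoord[OF smooth_from_T] by (simp add: dT)
  have add: "ext_d (\<alpha> + \<beta>) = ext_d \<alpha> + ext_d \<beta>" if ab: "\<alpha> \<in> forms" "\<beta> \<in> forms" for \<alpha> \<beta>
  proof -
    obtain k where "form_of_order k \<alpha>" "form_of_order k \<beta>"
      using ab by (rule forms_common_order)
    then show ?thesis by (rule ext_d_add)
  qed
  have d1: "ext_d (eta f (Suc 0)) = (partial U (T f 0) \<cdot> dcoord U) \<and>\<^sub>w dcoord Zbar - dcoord (Ui (Suc 0)) \<and>\<^sub>w dcoord Z"
    unfolding eta_Suc
    by (simp add: ext_d_diff add dsm dTs diff_in_forms add_in_forms dcoord_in_forms
      smult_dcoord_in_forms smooth_coord_fun smooth_T)
  have d2: "ext_d (etabar (Suc 0)) = (partial U (T f 0) \<cdot> dcoord U) \<and>\<^sub>w dcoord Z - dcoord (Uibar (Suc 0)) \<and>\<^sub>w dcoord Zbar"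
    unfolding etabar_Suc real
    by (simp add: ext_d_diff add dsm dTs diff_in_forms add_in_forms dcoord_in_forms
      smult_dcoord_in_forms smooth_coord_fun smooth_T)
  show "ext_d (eta f (Suc 0)) = dcoord Z \<and>\<^sub>w eta f (Suc (Suc 0)) + partial U (T f 0) \<cdot> (eta f 0 \<and>\<^sub>w dcoord Zbar)"
    unfolding d1 unfolding eta_Suc eta_0 wedge_dcoord_swap[of "Ui (Suc 0)" Z] T1
    by (simp only: wedge_add_right wedge_diff_right wedge_diff_left wedge_smult_left wedge_smult_right
        wedge_dcoord_self smult_zero) (intro ext, simp add: smult_def algebra_simps)
  show "ext_d (etabar (Suc 0)) = dcoord Zbar \<and>\<^sub>w etabar (Suc (Suc 0)) + partial U (T f 0) \<cdot> (eta f 0 \<and>\<^sub>w dcoord Z)"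
    unfolding d2 unfolding etabar_Suc eta_0 wedge_dcoord_swap[of "Uibar (Suc 0)" Zbar] T1bar
    by (simp only: wedge_add_right wedge_diff_right wedge_diff_left wedge_smult_left wedge_smult_right
        wedge_dcoord_self smult_zero) (intro ext, simp add: smult_def algebra_simps)
qed

text \<open>\<omega>_1 and \<eta>_1 differ by a multiple of \<zeta>, which the factor \<zeta>
  annihilates. In this form \<psi> visibly lies in \<open>eds_ideal f 1\<close>, and its Lie
  derivative reduces to those of \<eta>_1 and its conjugate.\<close>

lemma psi_eq: "psi f =
    (\<lambda>p. 1 / (2 * \<i>)) \<cdot> (dcoord Z \<and>\<^sub>w eta f (Suc 0) - dcoord Zbar \<and>\<^sub>w etabar (Suc 0))"
proof -
  have "dcoord Z \<and>\<^sub>w omega_Suc f 0 = dcoord Z \<and>\<^sub>w dcoord (Ui 0) + T f 0 \<cdot> (dcoord Z \<and>\<^sub>w dcoord Zbar)"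
    by (simp add: omega_Suc_def wedge_add_right wedge_smult_right)
  moreover have "dcoord Z \<and>\<^sub>w eta f (Suc 0) = dcoord Z \<and>\<^sub>w dcoord (Ui 0) + T f 0 \<cdot> (dcoord Z \<and>\<^sub>w dcoord Zbar)"
    by (simp add: eta_Suc wedge_add_right wedge_diff_right wedge_smult_right)
  moreover have "dcoord Zbar \<and>\<^sub>w etabar (Suc 0) =
      dcoord Zbar \<and>\<^sub>w dcoord (Uibar 0) + (\<lambda>p. cnj (T f 0 p)) \<cdot> (dcoord Zbar \<and>\<^sub>w dcoord Z)"
    by (simp add: etabar_Suc wedge_add_right wedge_diff_right wedge_smult_right)
  ultimately show ?thesis
    unfolding psi_def Im_form_def
    by (simp add: cnj_form_add cnj_form_smult cnj_form_wedge_zeta)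
qed


lemma psi_in_forms: "psi f \<in> forms"
  unfolding psi_eq
  by (intro smult_in_forms[OF smooth_from_const] diff_in_forms wedge_in_forms dcoord_in_forms
      eta_in_forms etabar_Suc_in_forms)

section \<open>Membership in the ideals\<close>

lemma eds_ideal: "differential_ideal (eds_ideal f l)"
  unfolding eds_ideal_def
proof (rule differential_ideal_hull, rule subsetI)
  fix \<alpha>
  assume "\<alpha> \<in> ideal_gens f l"
  then consider i where "\<alpha> = eta f i" | i where "i \<ge> 1" "\<alpha> = etabar i" | "\<alpha> = psi f"
    by (auto simp: ideal_gens_def etabar_def split: if_splits)
  then show "\<alpha> \<in> forms"
  proof cases
    case (2 i)
    then show ?thesis
      using etabar_Suc_in_forms[of "i - 1"] by simp
  qed (simp_all add: eta_in_forms psi_in_forms)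
qed

lemma eds_ideal_minimal: "differential_ideal J \<Longrightarrow> ideal_gens f l \<subseteq> J \<Longrightarrow> eds_ideal f l \<subseteq> J"
  unfolding eds_ideal_def by (rule hull_minimal)

lemma eds_ideal_gen: "\<alpha> \<in> ideal_gens f l \<Longrightarrow> \<alpha> \<in> eds_ideal f l"
  unfolding eds_ideal_def by (rule hull_inc)

lemma eta_in_eds: "i \<le> l \<Longrightarrow> eta f i \<in> eds_ideal f l"
  by (rule eds_ideal_gen) (cases "i = 0"; auto simp: ideal_gens_def)

lemma etabar_in_eds: "Suc i \<le> l \<Longrightarrow> etabar (Suc i) \<in> eds_ideal f l"
  by (rule eds_ideal_gen) (auto simp: ideal_gens_def etabar_def)

lemma partial_smult_in_eds: "smooth_from k F \<Longrightarrow> \<alpha> \<in> eds_ideal f l \<Longrightarrow> partial c F \<cdot> \<alpha> \<in> eds_ideal f l"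
  by (rule ideal_smult[OF eds_ideal smooth_from_partial])

text \<open>The shift from \<open>k\<close> to \<open>Suc k\<close> reflects the numbering: the
  contact form that starts with \<open>du_k\<close> is \<eta>_(k+1).\<close>

lemma ext_d_function_form_in_eds:
  assumes "smooth_from k F"
  shows "ext_d (function_form F) - vapply e F \<cdot> dcoord Z - vapply ebar F \<cdot> dcoord Zbar \<in> eds_ideal f (Suc k)"
  unfolding ext_d_function_form_contact[OF assms]
  by (intro differential_idealD(3)[OF eds_ideal] ideal_sum[OF eds_ideal] partial_smult_in_eds[OF assms]
      eta_in_eds etabar_in_eds) auto

lemma wedge_eta_2_in_eds:
  "dcoord Z \<and>\<^sub>w eta f (Suc (Suc 0)) \<in> eds_ideal f 1"
  "dcoord Zbar \<and>\<^sub>w etabar (Suc (Suc 0)) \<in> eds_ideal f 1"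
proof -
  note J = differential_idealD[OF eds_ideal[of 1]]
  have w: "partial U (T f 0) \<cdot> (eta f 0 \<and>\<^sub>w dcoord c) \<in> eds_ideal f 1" for c
    by (intro partial_smult_in_eds[OF smooth_from_T] J(5) eta_in_eds dcoord_in_forms) simp
  have "dcoord Z \<and>\<^sub>w eta f (Suc (Suc 0)) =
      ext_d (eta f (Suc 0)) - partial U (T f 0) \<cdot> (eta f 0 \<and>\<^sub>w dcoord Zbar)"
    unfolding ext_d_eta_1 by simp
  also have "\<dots> \<in> eds_ideal f 1"
    by (intro ideal_diff[OF eds_ideal] w J(6) eta_in_eds) simp
  finally show "dcoord Z \<and>\<^sub>w eta f (Suc (Suc 0)) \<in> eds_ideal f 1" .
  have "dcoord Zbar \<and>\<^sub>w etabar (Suc (Suc 0)) =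
      ext_d (etabar (Suc 0)) - partial U (T f 0) \<cdot> (eta f 0 \<and>\<^sub>w dcoord Z)"
    unfolding ext_d_eta_1 by simp
  also have "\<dots> \<in> eds_ideal f 1"
    by (intro ideal_diff[OF eds_ideal] w J(6) etabar_in_eds) simp
  finally show "dcoord Zbar \<and>\<^sub>w etabar (Suc (Suc 0)) \<in> eds_ideal f 1" .
qed

lemma psi_in_eds: "psi f \<in> eds_ideal f 1"
  unfolding psi_eq
  by (intro ideal_smult[OF eds_ideal smooth_from_const] ideal_diff[OF eds_ideal]
      differential_idealD(4)[OF eds_ideal] dcoord_in_forms eta_in_eds etabar_in_eds) simp_all

text \<open>For \<open>l = 0\<close> the generating sets are not nested, since \<psi> is not a
  generator at the next level; there \<open>psi_in_eds\<close> steps in.\<close>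

lemma eds_ideal_Suc: "eds_ideal f l \<subseteq> eds_ideal f (Suc l)"
proof (rule eds_ideal_minimal[OF eds_ideal])
  show "ideal_gens f l \<subseteq> eds_ideal f (Suc l)"
  proof (cases "l = 0")
    case True
    then show ?thesis
      using psi_in_eds by (simp add: ideal_gens_def eta_in_eds)
  next
    case False
    then have "ideal_gens f l \<subseteq> ideal_gens f (Suc l)"
      unfolding ideal_gens_def by auto
    then show ?thesis
      using eds_ideal_gen by blast
  qed
qed

lemma ideal_gens_cases:
  assumes "\<alpha> \<in> ideal_gens f (Suc l)"
  obtains i where "i \<le> Suc l" "\<alpha> = eta f i" | i where "i \<le> l" "\<alpha> = etabar (Suc i)"
proof -
  consider i where "i \<le> Suc l" "\<alpha> = eta f i" | i where "1 \<le> i" "i \<le> Suc l" "\<alpha> = etabar i"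
    using assms unfolding ideal_gens_def etabar_def by auto
  then show thesis
  proof cases
    case (2 i)
    then show thesis
      using that(2)[of "i - 1"] by simp
  qed (rule that(1))
qed

text \<open>At levels from 1 on all generators are one-forms killed by \<open>w\<close>. The
  function-free forms whose one-form part is killed by \<open>w\<close> make up a differential
  ideal, which therefore contains the whole hull.\<close>

lemma pairing_eds_ideal:
  assumes \<alpha>: "\<alpha> \<in> eds_ideal f (Suc l)" and w: "w = e \<or> w = ebar"
  shows "pairing \<alpha> w = (\<lambda>p. 0)"
proof -
  \<comment> \<open>Finite support belongs to the condition because \<open>P\<close> has to be
    linear on arbitrary families \<open>x\<close>, and \<open>Sum_any\<close> is additive only for
    finite supports.\<close>
  define P where "P p x \<longleftrightarrow> finite {c. x c \<noteq> 0} \<and> Sum_any (\<lambda>c. w c p * x c) = 0"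
    for p and x :: "coord \<Rightarrow> complex"
  have fin: "finite {c. w c p * x c \<noteq> 0}" if "finite {c. x c \<noteq> 0}" for x p
    by (rule finite_subset[OF _ that]) auto
  have "differential_ideal {\<alpha> \<in> forms. \<alpha> {} = 0 \<and> (\<forall>p. P p (\<lambda>c. \<alpha> {c} p))}"
  proof (rule differential_ideal_one_forms)
    show "P p (\<lambda>c. 0)" for p
      by (simp add: P_def)
    show "P p (\<lambda>c. x c + y c)" if "P p x" "P p y" for p x y
    proof -
      have "finite {c. x c + y c \<noteq> 0}"
        by (rule finite_subset[of _ "{c. x c \<noteq> 0} \<union> {c. y c \<noteq> 0}"]) (use that in \<open>auto simp: P_def\<close>)
      moreover have "(\<Sum>c. w c p * x c + w c p * y c) = (\<Sum>c. w c p * x c) + (\<Sum>c. w c p * y c)"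
        using that by (intro Sum_any.distrib fin) (simp_all add: P_def)
      ultimately show ?thesis
        using that by (simp add: P_def distrib_left)
    qed
    show "P p (\<lambda>c. a * x c)" if "P p x" for p a x
    proof -
      have "finite {c. a * x c \<noteq> 0}"
        by (rule finite_subset[of _ "{c. x c \<noteq> 0}"]) (use that in \<open>auto simp: P_def\<close>)
      moreover have "(\<Sum>c. a * (w c p * x c)) = a * (\<Sum>c. w c p * x c)"
        using that fin by (intro Sum_any_right_distrib[symmetric]) (simp add: P_def)
      ultimately show ?thesis
        using that by (simp add: P_def mult.left_commute)
    qed
  qed
  moreover have "ideal_gens f (Suc l) \<subseteq> {\<alpha> \<in> forms. \<alpha> {} = 0 \<and> (\<forall>p. P p (\<lambda>c. \<alpha> {c} p))}"
  proof
    fix \<alpha>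
    assume "\<alpha> \<in> ideal_gens f (Suc l)"
    then have gen: "\<alpha> \<in> forms \<and> \<alpha> {} = 0 \<and> pairing \<alpha> w = (\<lambda>p. 0)"
    proof (cases rule: ideal_gens_cases)
      case (1 i)
      then show ?thesis
        using w by (cases i) (auto simp: eta_in_forms pairing_eta, auto simp: eta_0 eta_Suc dcoord_def smult_def)
    next
      case (2 i)
      then show ?thesis
        using w by (auto simp: etabar_Suc_in_forms pairing_eta) (auto simp: etabar_Suc dcoord_def smult_def)
    qed
    then obtain k where k: "form_of_order k \<alpha>"
      by (auto simp: forms_iff)
    have "finite {c. \<alpha> {c} p \<noteq> 0}" for p
      by (rule finite_subset[OF _ finite_coords_upto[of k]])
        (auto elim: contrapos_np simp: form_of_order_eq_0[OF k])
    then show "\<alpha> \<in> {\<alpha> \<in> forms. \<alpha> {} = 0 \<and> (\<forall>p. P p (\<lambda>c. \<alpha> {c} p))}"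
      using gen by (simp add: P_def pairing_eq fun_eq_iff)
  qed
  ultimately have "eds_ideal f (Suc l) \<subseteq> {\<alpha> \<in> forms. \<alpha> {} = 0 \<and> (\<forall>p. P p (\<lambda>c. \<alpha> {c} p))}"
    by (rule eds_ideal_minimal)
  from subsetD[OF this \<alpha>] have "P p (\<lambda>c. \<alpha> {c} p)" for p
    by blast
  then show ?thesis
    unfolding pairing_eq P_def by (intro ext) simp
qed

text \<open>The same device as for \<open>pairing_eds_ideal\<close>: the generators of
  \<open>eds_ideal f 1\<close> contain no \<open>du_i\<close> or conjugate with
  \<open>i \<ge> 1\<close>, and this is a linear condition on the one-form part.\<close>

lemma eds_ideal_1_component:
  assumes \<alpha>: "\<alpha> \<in> eds_ideal f 1" and i: "i \<ge> 1"
  shows "\<alpha> {Ui i} = 0" "\<alpha> {Uibar i} = 0"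
proof -
  define P where "P p x \<longleftrightarrow> x (Ui i) = 0 \<and> x (Uibar i) = 0" for p :: jet and x :: "coord \<Rightarrow> complex"
  have "differential_ideal {\<alpha> \<in> forms. \<alpha> {} = 0 \<and> (\<forall>p. P p (\<lambda>c. \<alpha> {c} p))}"
    by (rule differential_ideal_one_forms) (simp_all add: P_def)
  moreover have "ideal_gens f (Suc 0) \<subseteq> {\<alpha> \<in> forms. \<alpha> {} = 0 \<and> (\<forall>p. P p (\<lambda>c. \<alpha> {c} p))}"
  proof
    fix \<alpha>
    assume "\<alpha> \<in> ideal_gens f (Suc 0)"
    then show "\<alpha> \<in> {\<alpha> \<in> forms. \<alpha> {} = 0 \<and> (\<forall>p. P p (\<lambda>c. \<alpha> {c} p))}"
    proof (cases rule: ideal_gens_cases)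
      case (1 j)
      then have "j = 0 \<or> j = Suc 0"
        by auto
      then show ?thesis
        using 1 i by (auto simp: eta_in_forms P_def) (auto simp: eta_0 eta_Suc dcoord_def smult_def)
    next
      case (2 j)
      then show ?thesis
        using i by (auto simp: etabar_Suc_in_forms P_def) (auto simp: etabar_Suc dcoord_def smult_def)
    qed
  qed
  ultimately have "eds_ideal f (Suc 0) \<subseteq> {\<alpha> \<in> forms. \<alpha> {} = 0 \<and> (\<forall>p. P p (\<lambda>c. \<alpha> {c} p))}"
    by (rule eds_ideal_minimal)
  from subsetD[OF this \<alpha>[simplified]] have "P p (\<lambda>c. \<alpha> {c} p)" for p
    by blast
  then show "\<alpha> {Ui i} = 0" "\<alpha> {Uibar i} = 0"
    unfolding P_def by (intro ext, simp)+
qed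

text \<open>For \<open>v U = g\<close> this is the source of the term \<open>f_u g\<close> in the
  equation.\<close>

lemma vapply_T_0: "vapply v (T f 0) = (\<lambda>p. v U p * partial U (T f 0) p)"
  unfolding vapply_eq[OF smooth_from_T] sum_coords_upto by (simp add: partial_T_0)

subsection \<open>Generalized symmetries of order one\<close>

lemma generalized_symmetry_imp:
  assumes v: "real_vector_field v" and z: "v Z = (\<lambda>p. 0)" "v Zbar = (\<lambda>p. 0)"
    and sym: "generalized_symmetry f 1 v"
  shows "smooth_from 0 (v U)" "v (Ui 0) = vapply e (v U)" "v (Ui (Suc i)) = vapply e (v (Ui i))"
    "vapply ebar (v (Ui 0)) p + partial U (T f 0) p * v U p = 0"
proof -
  have vf: "vector_field v"
    using v by (simp add: real_vector_field_def)
  have mem: "lie v \<alpha> \<in> eds_ideal f (Suc l)" if "\<alpha> \<in> eds_ideal f l" for \<alpha> l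
  proof -
    have "lie v ` eds_ideal f l \<subseteq> eds_ideal f (l + 1)"
      using sym unfolding generalized_symmetry_def by blast
    then show ?thesis
      using that by auto
  qed
  note lie = lie_eta[OF vf z]
  \<comment> \<open>\<open>pairing\<close> is linear on forms only, so each summand of the Lie
    derivatives must have finite order; that of \<open>vapply v (T f i)\<close> depends on
    \<open>v\<close>.\<close>
  have fin: "ext_d (function_form (v c)) \<in> forms" "v c \<cdot> dcoord d \<in> forms" "vapply v (T f i) \<cdot> dcoord d \<in> forms" for c d i
  proof -
    obtain k where "smooth_from k (v c)"
      using vf unfolding vector_field_def smooth_def by blast
    then show "ext_d (function_form (v c)) \<in> forms" "v c \<cdot> dcoord d \<in> forms"
      by (auto intro: ext_d_in_forms function_form_in_forms smult_in_forms dcoord_in_forms)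
    obtain m where "m \<ge> i" "\<forall>c\<in>coords_upto i. smooth_from m (v c)"
      using vector_field_smooth_from[OF vf] by blast
    then show "vapply v (T f i) \<cdot> dcoord d \<in> forms"
      using smooth_from_vapply[OF smooth_from_T, of i m v] by (auto intro: smult_in_forms dcoord_in_forms)
  qed
  \<comment> \<open>Using \<eta>_0 at the lowest level gives the sharp bound: its Lie derivative
    lies in \<open>eds_ideal f 1\<close>, which confines \<open>v U\<close> to order 0.\<close>
  have 0: "lie v (eta f 0) \<in> eds_ideal f 1"
    using mem[OF eta_in_eds[of 0 0]] by simp
  obtain k where k: "smooth_from k (v U)"
    using vf unfolding vector_field_def smooth_def by blast
  show "smooth_from 0 (v U)"
  proof (rule smooth_from_0I[OF k])
    fix i :: nat
    assume "i \<ge> 1"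
    show "partial (Ui i) (v U) = 0"
      using eds_ideal_1_component(1)[OF 0 \<open>i \<ge> 1\<close>]
      by (simp add: lie fun_eq_iff ext_d_function_form_singleton smult_def dcoord_def)
    show "partial (Uibar i) (v U) = 0"
      using eds_ideal_1_component(2)[OF 0 \<open>i \<ge> 1\<close>]
      by (simp add: lie fun_eq_iff ext_d_function_form_singleton smult_def dcoord_def)
  qed
  have "pairing (lie v (eta f 0)) e = (\<lambda>p. 0)"
    using pairing_eds_ideal[of _ 0 e] 0 by simp
  then show "v (Ui 0) = vapply e (v U)"
    by (simp add: lie pairing_diff pairing_smult pairing_dcoord dcoord_in_forms fin diff_in_forms
        pairing_ext_d_function_form fun_eq_iff)
  have 1: "lie v (eta f (Suc i)) \<in> eds_ideal f (Suc (Suc i))" for i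
    by (rule mem[OF eta_in_eds]) simp
  have "pairing (lie v (eta f (Suc i))) e = (\<lambda>p. 0)"
    using pairing_eds_ideal[OF 1] by simp
  then show "v (Ui (Suc i)) = vapply e (v (Ui i))"
    by (simp add: lie pairing_diff pairing_add pairing_smult pairing_dcoord dcoord_in_forms fin diff_in_forms
        add_in_forms pairing_ext_d_function_form fun_eq_iff)
  \<comment> \<open>The first of a sequence of relations. Only this one is recorded, as the later
    ones follow from it by induction, which is how \<open>ebar_v\<close> arises in
    \<open>generalized_symmetryI\<close>.\<close>
  have "pairing (lie v (eta f (Suc 0))) ebar p = 0"
    using pairing_eds_ideal[OF 1] by simp
  then have "vapply ebar (v (Ui 0)) p + vapply v (T f 0) p = 0"
    by (simp add: lie pairing_diff pairing_add pairing_smult pairing_dcoord dcoord_in_forms fin diff_in_forms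
        add_in_forms pairing_ext_d_function_form)
  then show "vapply ebar (v (Ui 0)) p + partial U (T f 0) p * v U p = 0"
    by (simp add: vapply_T_0 mult.commute)
qed

lemma smult_minus: "(\<lambda>p. - F p) \<cdot> \<alpha> = - (F \<cdot> \<alpha>)"
  by (intro ext) (simp add: smult_def)

text \<open>For \<open>F\<close> of order 1 the contact part of \<open>dF\<close> involves \<eta>_2
  and its conjugate. The wedge with \<zeta> is controlled for the former by
  \<open>wedge_eta_2_in_eds\<close>; the hypothesis on \<open>F\<close> removes the latter. The
  second statement is the mirror image.\<close>

lemma wedge_contact_in_eds:
  assumes F: "smooth_from 1 F"
  shows "partial (Uibar 1) F = (\<lambda>p. 0) \<Longrightarrow>
      dcoord Z \<and>\<^sub>w (ext_d (function_form F) - vapply e F \<cdot> dcoord Z - vapply ebar F \<cdot> dcoord Zbar) \<in> eds_ideal f 1"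
    and "partial (Ui 1) F = (\<lambda>p. 0) \<Longrightarrow>
      dcoord Zbar \<and>\<^sub>w (ext_d (function_form F) - vapply e F \<cdot> dcoord Z - vapply ebar F \<cdot> dcoord Zbar) \<in> eds_ideal f 1"
proof -
  have in_eds: "dcoord c \<and>\<^sub>w eta f 0 \<in> eds_ideal f 1" "dcoord c \<and>\<^sub>w eta f (Suc 0) \<in> eds_ideal f 1"
    "dcoord c \<and>\<^sub>w etabar (Suc 0) \<in> eds_ideal f 1" for c
    by (intro differential_idealD(4)[OF eds_ideal] eta_in_eds etabar_in_eds dcoord_in_forms; simp)+
  have contact: "ext_d (function_form F) - vapply e F \<cdot> dcoord Z - vapply ebar F \<cdot> dcoord Zbar =
      partial U F \<cdot> eta f 0 + (partial (Ui 0) F \<cdot> eta f (Suc 0) + partial (Ui 1) F \<cdot> eta f (Suc (Suc 0)))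
        + (partial (Uibar 0) F \<cdot> etabar (Suc 0) + partial (Uibar 1) F \<cdot> etabar (Suc (Suc 0)))"
    using ext_d_function_form_contact[OF F] by simp
  note closed = differential_idealD(2,3)[OF eds_ideal] partial_smult_in_eds[OF F] in_eds wedge_eta_2_in_eds
  show "dcoord Z \<and>\<^sub>w (ext_d (function_form F) - vapply e F \<cdot> dcoord Z - vapply ebar F \<cdot> dcoord Zbar) \<in> eds_ideal f 1"
    if "partial (Uibar 1) F = (\<lambda>p. 0)"
    unfolding contact that wedge_add_right wedge_smult_right smult_zero wedge_zero by (intro closed)
  show "dcoord Zbar \<and>\<^sub>w (ext_d (function_form F) - vapply e F \<cdot> dcoord Z - vapply ebar F \<cdot> dcoord Zbar) \<in> eds_ideal f 1"
    if "partial (Ui 1) F = (\<lambda>p. 0)"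
    unfolding contact that wedge_add_right wedge_smult_right smult_zero wedge_zero by (intro closed)
qed

lemma generalized_symmetryI:
  assumes v: "real_vector_field v" and z: "v Z = (\<lambda>p. 0)" "v Zbar = (\<lambda>p. 0)"
    and sm0: "smooth_from 0 (v U)" and v0: "v (Ui 0) = vapply e (v U)"
    and vSuc: "\<And>i. v (Ui (Suc i)) = vapply e (v (Ui i))"
    and pde: "\<And>p. vapply ebar (v (Ui 0)) p + partial U (T f 0) p * v U p = 0"
  shows "generalized_symmetry f 1 v"
proof -
  have vf: "vector_field v" and cnj_v: "cnj_vfield v = v"
    using v by (simp_all add: real_vector_field_def)
  have v_bar: "v (bar c) = (\<lambda>p. cnj (v c p))" for c
    using fun_cong[OF cnj_v, of "bar c"] by (simp add: cnj_vfield_def)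
  have vUibar: "v (Uibar i) = (\<lambda>p. cnj (v (Ui i) p))" for i
    using v_bar[of "Ui i"] by simp
  have sm: "smooth_from (Suc i) (v (Ui i))" for i
  proof (induction i)
    case 0
    show ?case
      unfolding v0 by (rule smooth_from_vapply_e[OF sm0])
  next
    case (Suc i)
    then show ?case
      unfolding vSuc by (rule smooth_from_vapply_e)
  qed
  \<comment> \<open>In the directions \<open>Uibar i\<close> commutation would be the conjugate of
    what \<open>ebar_v\<close> is about to establish; it is avoided because \<open>T f i\<close>
    does not depend on these coordinates.\<close>
  have ve_commute: "vapply v (vapply e (T f i)) = vapply e (vapply v (T f i))" for i
  proof (rule vapply_commute[OF smooth_from_T vf vector_field_e])
    show "partial c (T f i) = (\<lambda>p. 0) \<or> vapply v (e c) = vapply e (v c)" for c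
      by (cases c) (simp_all add: partial_T vapply_coord_fun v0 vSuc)
  qed
  have ebar_v: "vapply ebar (v (Ui i)) = (\<lambda>p. - vapply v (T f i) p)" for i
  proof (induction i)
    case 0
    show ?case
      by (intro ext) (use pde in \<open>simp add: vapply_T_0 eq_neg_iff_add_eq_0 mult.commute\<close>)
  next
    case (Suc i)
    obtain m where m: "m \<ge> i" "\<forall>c\<in>coords_upto i. smooth_from m (v c)"
      using vector_field_smooth_from[OF vf] by blast
    have vT: "smooth_from m (vapply v (T f i))"
      using m by (intro smooth_from_vapply[OF smooth_from_T]) auto
    have "vapply ebar (v (Ui (Suc i))) = vapply e (vapply ebar (v (Ui i)))"
      unfolding vSuc by (rule vapply_e_ebar_commute[OF sm])
    also have "\<dots> = (\<lambda>p. - vapply v (T f (Suc i)) p)"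
      unfolding Suc vapply_minus[OF vT] ve_commute[symmetric] vapply_e_T ..
    finally show ?case .
  qed
  \<comment> \<open>As \<open>v\<close> is real, conjugating the relations for
    \<open>v (Ui i)\<close> yields those for \<open>v (Uibar i)\<close>, with \<open>e\<close> and
    \<open>ebar\<close> exchanged.\<close>
  have e_vbar: "vapply e (v (Uibar i)) = (\<lambda>p. - vapply v (\<lambda>p. cnj (T f i p)) p)" for i
    using vapply_cnj[OF sm, of ebar i] by (simp add: vUibar ebar_v vapply_cnj_T[OF cnj_v])
  have ebar_vbar: "vapply ebar (v (Uibar i)) = v (Uibar (Suc i))" for i
    using vapply_cnj[OF sm, of e i] by (simp add: vUibar vSuc)
  have ebar_vU: "vapply ebar (v U) = v (Uibar 0)"
    using vapply_cnj[OF sm0, of e] v_bar[of U] by (simp add: vUibar v0)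
  note lie = lie_eta[OF vf z]
  have lie0: "lie v (eta f 0) =
      ext_d (function_form (v U)) - vapply e (v U) \<cdot> dcoord Z - vapply ebar (v U) \<cdot> dcoord Zbar"
    by (simp add: lie v0 ebar_vU)
  have lieS: "lie v (eta f (Suc i)) =
      ext_d (function_form (v (Ui i))) - vapply e (v (Ui i)) \<cdot> dcoord Z - vapply ebar (v (Ui i)) \<cdot> dcoord Zbar" for i
    by (simp add: lie vSuc ebar_v smult_minus algebra_simps)
  have lieSbar: "lie v (etabar (Suc i)) =
      ext_d (function_form (v (Uibar i))) - vapply e (v (Uibar i)) \<cdot> dcoord Z - vapply ebar (v (Uibar i)) \<cdot> dcoord Zbar" for i
    by (simp add: lie ebar_vbar e_vbar smult_minus)
  have smbar: "smooth_from (Suc i) (v (Uibar i))" for i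
    unfolding vUibar by (rule smooth_from_cnj[OF sm])
  have eds_mono: "eds_ideal f k \<subseteq> eds_ideal f l" if "k \<le> l" for k l
    using that by (rule lift_Suc_mono_le[of "eds_ideal f", OF eds_ideal_Suc])
  have eta_mem: "lie v (eta f i) \<in> eds_ideal f (Suc l)" if "i \<le> l" for i l
  proof (cases i)
    case 0
    show ?thesis
      unfolding 0 lie0 using ext_d_function_form_in_eds[OF sm0] eds_mono[of "Suc 0" "Suc l"] by auto
  next
    case (Suc j)
    show ?thesis
      unfolding Suc lieS
      using ext_d_function_form_in_eds[OF sm[of j]] eds_mono[of "Suc (Suc j)" "Suc l"] that Suc by auto
  qed
  have etabar_mem: "lie v (etabar (Suc i)) \<in> eds_ideal f (Suc l)" if "Suc i \<le> l" for i l
    unfolding lieSbar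
    using ext_d_function_form_in_eds[OF smbar[of i]] eds_mono[of "Suc (Suc i)" "Suc l"] that by auto
  \<comment> \<open>\<open>v U\<close> lives on order 0, where the coefficients of \<open>e\<close>
    that meet it are 1, 0, \<open>u_0\<close>, \<open>u_1\<close> and \<open>- f\<close>. None of
    them involves the conjugate of \<open>u_1\<close>, so its total derivative does not
    either.\<close>
  have Uibar1: "partial (Uibar 1) (v (Ui 0)) = (\<lambda>p. 0)"
  proof -
    have "partial (Uibar 1) (v U) = (\<lambda>p. 0)"
      by (rule partial_eq_0[OF smooth_from_pulled_back[OF sm0]]) (auto simp: coords_upto_def)
    moreover have "vapply e (partial (Uibar 1) (v U)) = partial (Uibar 1) (vapply e (v U))"
    proof (rule vapply_e_partial[OF sm0])
      fix c
      assume "c \<in> coords_upto 0"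
      then have "partial (Uibar 1) (e c) = (\<lambda>p. 0)"
        by (auto simp: coords_upto_def partial_coord_fun partial_minus[OF smooth_from_cnj[OF smooth_from_T]]
            partial_cnj[OF smooth_from_T] partial_T_0)
      then show "partial c (v U) = (\<lambda>p. 0) \<or> partial (Uibar 1) (e c) = (\<lambda>p. 0)" ..
    qed
    ultimately show ?thesis
      by (simp add: v0)
  qed
  then have Ui1: "partial (Ui 1) (v (Uibar 0)) = (\<lambda>p. 0)"
    by (simp add: vUibar partial_cnj[OF sm])
  have psi_mem: "lie v (psi f) \<in> eds_ideal f 1"
  proof -
    have lie_zeta: "lie v (dcoord Z) = 0" "lie v (dcoord Zbar) = 0"
      by (simp_all add: lie_dcoord z)
    note in_forms = wedge_in_forms dcoord_in_forms eta_in_forms etabar_Suc_in_forms diff_in_forms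
    have "lie v (psi f) = (\<lambda>p. 1 / (2 * \<i>)) \<cdot>
        (dcoord Z \<and>\<^sub>w lie v (eta f (Suc 0)) - dcoord Zbar \<and>\<^sub>w lie v (etabar (Suc 0)))"
      unfolding psi_eq
      by (simp add: lie_smult_forms[OF vf smooth_from_const] lie_diff[OF vf] lie_wedge[OF vf] in_forms lie_zeta)
    also have "\<dots> \<in> eds_ideal f 1"
      unfolding lieS lieSbar
      using sm[of 0] smbar[of 0] Uibar1 Ui1
      by (intro ideal_smult[OF eds_ideal smooth_from_const] ideal_diff[OF eds_ideal] wedge_contact_in_eds) simp_all
    finally show ?thesis .
  qed
  \<comment> \<open>The right-hand side is a differential ideal, so minimality of the hull leaves
    only the generators to be checked.\<close>
  have "eds_ideal f l \<subseteq> {\<alpha> \<in> eds_ideal f l. lie v \<alpha> \<in> eds_ideal f (Suc l)}" for l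
  proof (rule eds_ideal_minimal)
    show "differential_ideal {\<alpha> \<in> eds_ideal f l. lie v \<alpha> \<in> eds_ideal f (Suc l)}"
      by (rule differential_ideal_lie[OF vf eds_ideal eds_ideal eds_ideal_Suc])
    show "ideal_gens f l \<subseteq> {\<alpha> \<in> eds_ideal f l. lie v \<alpha> \<in> eds_ideal f (Suc l)}"
    proof
      fix \<alpha>
      assume \<alpha>: "\<alpha> \<in> ideal_gens f l"
      have "lie v \<alpha> \<in> eds_ideal f (Suc l)"
      proof (cases l)
        case 0
        then have "\<alpha> = eta f 0 \<or> \<alpha> = psi f"
          using \<alpha> by (auto simp: ideal_gens_def)
        then show ?thesis
          using eta_mem[of 0 l] psi_mem 0 by auto
      next
        case (Suc k)
        show ?thesis
          using \<alpha> unfolding Suc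
          by (cases rule: ideal_gens_cases) (auto intro: eta_mem etabar_mem)
      qed
      then show "\<alpha> \<in> {\<alpha> \<in> eds_ideal f l. lie v \<alpha> \<in> eds_ideal f (Suc l)}"
        using eds_ideal_gen[OF \<alpha>] by simp
    qed
  qed
  then show ?thesis
    unfolding generalized_symmetry_def using v by auto
qed

end

theorem lemma10p1:
  fixes f :: "real \<Rightarrow> real" and v :: vfield and g :: "jet \<Rightarrow> complex"
  assumes "smooth_real f"
    and "real_vector_field v"
    and "pairing zeta v = 0"
    and "g = pairing (eta f 0) v"
  shows "generalized_symmetry f 1 v \<longleftrightarrow>
    smooth_from 0 g \<and>
    (\<forall>i. pairing (eta f i) v = (vapply (e_minus1 f) ^^ i) g) \<and>
    (\<forall>p. vapply (cnj_vfield (e_minus1 f)) (vapply (e_minus1 f) g) p + partial U (T f 0) p * g p = 0)"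
proof -
  interpret smooth_system f
    by standard (rule assms(1))
  have Z: "v Z = (\<lambda>p. 0)"
    using assms(3) by (simp add: pairing_dcoord zero_fun_def)
  have cnj_v: "cnj_vfield v = v"
    using assms(2) by (simp add: real_vector_field_def)
  have Zbar: "v Zbar = (\<lambda>p. 0)"
    using fun_cong[OF cnj_v, of Zbar] Z by (simp add: cnj_vfield_def)
  have g: "g = v U"
    using assms(4) by (simp add: pairing_eta Z Zbar)
  \<comment> \<open>Off by one: the component of \<open>v\<close> along \<open>u_i\<close> is the
    value of \<eta>_(i+1), hence the exponent \<open>Suc i\<close> in \<open>iter\<close>
    below.\<close>
  have eta_v: "pairing (eta f (Suc i)) v = v (Ui i)" for i
    by (simp add: pairing_eta Z Zbar)
  show ?thesis
  proof
    assume sym: "generalized_symmetry f 1 v"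
    note props = generalized_symmetry_imp[OF assms(2) Z Zbar sym]
    have iter: "v (Ui i) = (vapply e ^^ Suc i) g" for i
      by (induction i) (simp_all add: g props(2,3))
    have "pairing (eta f i) v = (vapply e ^^ i) g" for i
      using iter eta_v assms(4) by (cases i) simp_all
    moreover have "vapply ebar (vapply e g) p + partial U (T f 0) p * g p = 0" for p
      using props(4)[of p] by (simp only: g props(2))
    ultimately show "smooth_from 0 g \<and> (\<forall>i. pairing (eta f i) v = (vapply e ^^ i) g) \<and>
        (\<forall>p. vapply ebar (vapply e g) p + partial U (T f 0) p * g p = 0)"
      using props(1) g by simp
  next
    assume R: "smooth_from 0 g \<and> (\<forall>i. pairing (eta f i) v = (vapply e ^^ i) g) \<and>
        (\<forall>p. vapply ebar (vapply e g) p + partial U (T f 0) p * g p = 0)"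
    then have iter: "v (Ui i) = (vapply e ^^ Suc i) g" for i
      using eta_v[of i] by (metis (no_types))
    show "generalized_symmetry f 1 v"
    proof (rule generalized_symmetryI[OF assms(2) Z Zbar])
      show "smooth_from 0 (v U)"
        using R g by simp
      show "v (Ui 0) = vapply e (v U)"
        using iter[of 0] g by simp
      show "v (Ui (Suc i)) = vapply e (v (Ui i))" for i
        unfolding iter by simp
      show "vapply ebar (v (Ui 0)) p + partial U (T f 0) p * v U p = 0" for p
        using R[THEN conjunct2, THEN conjunct2, THEN spec, of p] iter[of 0] g by simp
    qed
  qed
qed

end
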